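(* Let $p_1,p_2\ge 0$, $p_3>0$, and let $p_4$ be a non-negative Borel measure on $(0,\infty)$ with $\int_{(0,\infty)}(x\wedge 1)\,p_4(\mathrm{d}x)<\infty$. Let $B$ be the Feller's Brownian motion on $[0,\infty)$ with parameters $(p_1,p_2,p_3,p_4)$. Fix $x_0\in[0,\infty)$. For every integer $n\ge 2$ large enough that $\mathfrak p^{(n)}_0$ below is non-negative, let $X^{(n)}=(X^{(n)}_k)_{k\ge 0}$ be the boundary random walk with $X^{(n)}_0=\lfloor nx_0\rfloor$ whose jumping measure $(\mathfrak p^{(n)}_j)_{j\in\mathbb N\cup\{\Delta\}}$ is $$\mathfrak p^{(n)}_\Delta:=\frac{p_1}{n^2p_3},\qquad \mathfrak p^{(n)}_1:=\frac{p_2}{np_3},\qquad \mathfrak p^{(n)}_j:=\frac{p_4\big((j/n,(j+1)/n]\big)}{n^2p_3}\ \ (2\le j\le n^2-1),\qquad \mathfrak p^{(n)}_j:=0\ \ (j\ge n^2),$$ $$\mathfrak p^{(n)}_0:=1-\mathfrak p^{(n)}_\Delta-\sum_{j=1}^\infty\mathfrak p^{(n)}_j,$$ and let $B^{(n)}_t:=\frac1n X^{(n)}_{\lfloor n^2t\rfloor}$, $t\ge 0$. Then, as $n\to\infty$, $B^{(n)}$ converges weakly to $B$ started from $x_0$; that is, the laws of $B^{(n)}$ on the Skorokhod space $D_{E_\Delta}([0,\infty))$ converge weakly to the law of $B$ started from $x_0$.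
   Context: $\mathbb N=\{0,1,2,\dots\}$, $E=[0,\infty)$, $E_\Delta=E\cup\{\Delta\}$ is the one-point compactification of $E$ ($\Delta$ identified with $\infty$, so $E_\Delta\cong[0,\infty]$). $D_{E_\Delta}([0,\infty))$ is the space of càdlàg functions $[0,\infty)\to E_\Delta$ with the Skorokhod ($J_1$) topology and its Borel $\sigma$-algebra. $C_0(E)$ is the space of continuous functions on $E$ vanishing at infinity, with the uniform norm. Boundary random walk: given a probability measure $(\mathfrak p_j)_{j\in\mathbb N\cup\{\Delta\}}$ (the jumping measure), the boundary random walk is the discrete-time Markov chain on $\mathbb N\cup\{\Delta\}$ which from a state $i\ge 1$ moves to $i-1$ or $i+1$ with probability $1/2$ each, from $0$ moves to $j\in\mathbb N$ with probability $\mathfrak p_j$ and to $\Delta$ with probability $\mathfrak p_\Delta$, and is absorbed at the cemetery $\Delta$. By convention $\frac1n\Delta=\Delta$. Feller's Brownian motion: a Feller process on $E$ (i.e. its transition semigroup is a strongly continuous semigroup on $C_0(E)$, with cemetery $\Delta$) whose process killed upon hitting $0$ has the law of Brownian motion on $(0,\infty)$ killed at $0$. It is known (Feller) that these are exactly the Feller processes on $E$ with generator $\mathscr L f=\frac12 f''$ on $C_0(E)$ with domain $$\mathcal D(\mathscr L)=\Big\{f\in C_0(E)\cap C^2((0,\infty)):\ f''\in C_0(E),\ p_1f(0)-p_2f'(0)+\tfrac{p_3}{2}f''(0)+\int_{(0,\infty)}(f(0)-f(x))\,p_4(\mathrm{d}x)=0\Big\},$$ where $p_1,p_2,p_3\ge0$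 and $p_4$ is a non-negative measure on $(0,\infty)$ with $\int_{(0,\infty)}(x\wedge1)\,p_4(\mathrm{d}x)<\infty$ and $p_4((0,\infty))=\infty$ if $p_2=p_3=0$. Here $f''\in C_0(E)$ means that $f''$ extends continuously to $0$ to a function in $C_0(E)$, and $f'(0)=\lim_{x\downarrow0}f'(x)$. "The Feller's Brownian motion with parameters $(p_1,p_2,p_3,p_4)$" is the process with this generator, realized with càdlàg paths in $E_\Delta$. *)

theory Defs
  imports "HOL-Probability.Probability"
begin

section \<open>State spaces\<close>

text \<open>
  The compactification \<open>E\<^sub>\<Delta> = [0,\<infinity>]\<close> is the type \<^typ>\<open>ennreal\<close> with its order topology, the cemetery
  \<open>\<Delta>\<close> being \<^term>\<open>\<top> :: ennreal\<close>; \<open>E = [0,\<infinity>)\<close> is the set of reals \<^term>\<open>{0::real..}\<close>.  In the same way the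
  state space \<open>\<nat> \<union> {\<Delta>}\<close> of a boundary random walk is \<^typ>\<open>enat\<close>, with \<open>\<Delta>\<close> being \<^term>\<open>\<infinity> :: enat\<close>.
  Functions on \<open>E\<close> are of type \<^typ>\<open>real \<Rightarrow> real\<close>; only their values on \<^term>\<open>{0::real..}\<close> matter.
\<close>

definition C0 :: "(real \<Rightarrow> real) set" where
  "C0 = {f. continuous_on {0..} f \<and> (f \<longlongrightarrow> 0) at_top}"

definition extend_by_zero :: "(real \<Rightarrow> real) \<Rightarrow> ennreal \<Rightarrow> real" where
  "extend_by_zero f x = (if x = \<top> then 0 else f (enn2real x))"

section \<open>The Skorokhod space of paths in the compactified half-line\<close>

text \<open>
  A metric inducing the topology of \<open>[0,\<infinity>]\<close> (see \<open>tendsto_iff_compact_dist\<close>), bounded by 1: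
  the usual distance after the homeomorphism \<open>x \<mapsto> 1 / (1 + x)\<close> onto \<open>[0,1]\<close>.
\<close>

definition compact_dist :: "ennreal \<Rightarrow> ennreal \<Rightarrow> real" where
  "compact_dist x y = \<bar>enn2real (inverse (1 + x)) - enn2real (inverse (1 + y))\<bar>"

lemma enn2real_inverse_bounds:
  "inverse (1 + x :: ennreal) \<noteq> \<top>" "ennreal (enn2real (inverse (1 + x))) = inverse (1 + x)"
proof -
  show *: "inverse (1 + x :: ennreal) \<noteq> \<top>"
    by simp
  show "ennreal (enn2real (inverse (1 + x))) = inverse (1 + x)"
    using * by (simp add: ennreal_enn2real_if)
qed

lemma tendsto_iff_compact_dist:
  "(f \<longlongrightarrow> l) F \<longleftrightarrow> ((\<lambda>x. compact_dist (f x) l) \<longlongrightarrow> 0) F"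
proof -
  let ?h = "\<lambda>x::ennreal. enn2real (inverse (1 + x))"
  have inv: "x = inverse (ennreal (?h x)) - 1" for x :: ennreal
  proof -
    have "inverse (inverse (1 + x)) = 1 + x"
      by (cases x) (simp_all add: inverse_ennreal add_pos_nonneg flip: ennreal_1 ennreal_plus)
    then show ?thesis
      by (simp add: enn2real_inverse_bounds(2))
  qed
  have cont: "continuous_on UNIV (\<lambda>x::ennreal. inverse (1 + x))"
    by (intro continuous_intros)
  have "(f \<longlongrightarrow> l) F \<longleftrightarrow> ((\<lambda>x. ?h (f x)) \<longlongrightarrow> ?h l) F"
  proof
    assume "(f \<longlongrightarrow> l) F"
    then have "((\<lambda>x. inverse (1 + f x)) \<longlongrightarrow> inverse (1 + l)) F"
      using continuous_on_tendsto_compose[OF cont, of f l F] by simp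
    then show "((\<lambda>x. ?h (f x)) \<longlongrightarrow> ?h l) F"
      by (intro tendsto_enn2real)
         (auto simp: enn2real_inverse_bounds)
  next
    assume "((\<lambda>x. ?h (f x)) \<longlongrightarrow> ?h l) F"
    then have "((\<lambda>x. ennreal (?h (f x))) \<longlongrightarrow> ennreal (?h l)) F"
      by (rule tendsto_ennrealI)
    then have "((\<lambda>x. inverse (ennreal (?h (f x)))) \<longlongrightarrow> inverse (ennreal (?h l))) F"
      using continuous_on_tendsto_compose[of UNIV inverse "\<lambda>x. ennreal (?h (f x))" "ennreal (?h l)" F]
        continuous_on_inverse_ennreal[of UNIV "\<lambda>x. x"] by simp
    then have "((\<lambda>x. inverse (ennreal (?h (f x))) - 1) \<longlongrightarrow> inverse (ennreal (?h l)) - 1) F"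
      by (intro tendsto_diff_ennreal_general) auto
    then show "(f \<longlongrightarrow> l) F"
      using inv by simp
  qed
  also have "\<dots> \<longleftrightarrow> ((\<lambda>x. compact_dist (f x) l) \<longlongrightarrow> 0) F"
    unfolding compact_dist_def by (subst tendsto_dist_iff) (simp add: dist_real_def)
  finally show ?thesis .
qed

definition cadlag :: "(real \<Rightarrow> ennreal) \<Rightarrow> bool" where
  "cadlag x \<longleftrightarrow> (\<forall>t\<ge>0. (x \<longlongrightarrow> x t) (at_right t)) \<and> (\<forall>t>0. \<exists>l. (x \<longlongrightarrow> l) (at_left t))"

text \<open>Paths are made undefined at negative times, so that a path is determined by its values on \<open>[0,\<infinity>)\<close>.\<close>

definition skorokhod_space :: "(real \<Rightarrow> ennreal) set" where
  "skorokhod_space = {x \<in> extensional {0..}. cadlag x}"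

text \<open>
  The topology is the one of the metric of Ethier and Kurtz (Markov Processes, Section 3.5),
  \<open>d(x,y) = inf\<^sub>\<lambda> (\<gamma>(\<lambda>) \<or> \<integral>\<^sub>0\<^sup>\<infinity> e\<^sup>-\<^sup>u sup\<^sub>t r(x(t \<and> u), y(\<lambda>(t) \<and> u)) du)\<close>.
  Time changes with \<open>\<gamma>(\<lambda>) = \<infinity>\<close> do not contribute to the infimum, so they need not be excluded.
\<close>

definition time_changes :: "(real \<Rightarrow> real) set" where
  "time_changes = {l. strict_mono_on {0..} l \<and> l ` {0..} = {0..}}"

definition time_distortion :: "(real \<Rightarrow> real) \<Rightarrow> ennreal" where
  "time_distortion l = (SUP (s, t) \<in> {(s, t). 0 \<le> t \<and> t < s}. ennreal \<bar>ln ((l s - l t) / (s - t))\<bar>)"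

definition skorokhod_dist :: "(real \<Rightarrow> ennreal) \<Rightarrow> (real \<Rightarrow> ennreal) \<Rightarrow> real" where
  "skorokhod_dist x y = enn2real (INF l \<in> time_changes. max (time_distortion l)
     (\<integral>\<^sup>+ u\<in>{0..}. ennreal (exp (- u)) *
        (SUP t \<in> {0..}. ennreal (compact_dist (x (min t u)) (y (min (l t) u)))) \<partial>lborel))"

definition skorokhod_topology :: "(real \<Rightarrow> ennreal) topology" where
  "skorokhod_topology = Metric_space.mtopology skorokhod_space skorokhod_dist"

section \<open>Laws on a topological space and their weak convergence\<close>

definition borel_of :: "'a topology \<Rightarrow> 'a measure" where
  "borel_of T = sigma (topspace T) {U. openin T U}"

definition weakly_converges_to :: "'a topology \<Rightarrow> (nat \<Rightarrow> 'a measure) \<Rightarrow> 'a measure \<Rightarrow> bool" where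
  "weakly_converges_to T \<mu> \<nu> \<longleftrightarrow>
     (\<forall>\<^sub>F n in sequentially. \<mu> n \<in> space (prob_algebra (borel_of T))) \<and>
     \<nu> \<in> space (prob_algebra (borel_of T)) \<and>
     (\<forall>h. continuous_map T euclideanreal h \<and> bounded (h ` topspace T) \<longrightarrow>
        (\<lambda>n. \<integral>x. h x \<partial>\<mu> n) \<longlonglongrightarrow> (\<integral>x. h x \<partial>\<nu>))"

definition path_law :: "'w measure \<Rightarrow> (real \<Rightarrow> 'w \<Rightarrow> ennreal) \<Rightarrow> (real \<Rightarrow> ennreal) measure" where
  "path_law M Y = distr M (borel_of skorokhod_topology) (\<lambda>\<omega>. restrict (\<lambda>t. Y t \<omega>) {0..})"

section \<open>Feller's Brownian motion\<close>

definition semigroup_op :: "(real \<Rightarrow> ennreal \<Rightarrow> ennreal measure) \<Rightarrow> real \<Rightarrow> (real \<Rightarrow> real) \<Rightarrow> real \<Rightarrow> real" where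
  "semigroup_op \<kappa> t f x = (\<integral>y. extend_by_zero f y \<partial>\<kappa> t (ennreal x))"

text \<open>
  Transition functions on \<open>E\<^sub>\<Delta>\<close>, absorbed at \<open>\<Delta>\<close>, inducing a strongly continuous semigroup on \<open>C\<^sub>0(E)\<close>.
  Convergence in \<open>C\<^sub>0(E)\<close> is uniform convergence on \<open>[0,\<infinity>)\<close>.
\<close>

definition feller_transition :: "(real \<Rightarrow> ennreal \<Rightarrow> ennreal measure) \<Rightarrow> bool" where
  "feller_transition \<kappa> \<longleftrightarrow>
     (\<forall>t\<ge>0. \<kappa> t \<in> borel \<rightarrow>\<^sub>M prob_algebra borel) \<and>
     (\<forall>x. \<kappa> 0 x = return borel x) \<and>
     (\<forall>s\<ge>0. \<forall>t\<ge>0. \<forall>x. \<kappa> (s + t) x = \<kappa> s x \<bind> \<kappa> t) \<and>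
     (\<forall>t\<ge>0. \<kappa> t \<top> = return borel \<top>) \<and>
     (\<forall>f\<in>C0. \<forall>t\<ge>0. semigroup_op \<kappa> t f \<in> C0) \<and>
     (\<forall>f\<in>C0. uniform_limit {0..} (\<lambda>t. semigroup_op \<kappa> t f) f (at_right 0))"

text \<open>Generators are given by their graphs: \<open>f\<close> is in the domain and is mapped to \<open>g\<close>.\<close>

definition semigroup_generator ::
    "(real \<Rightarrow> ennreal \<Rightarrow> ennreal measure) \<Rightarrow> (real \<Rightarrow> real) \<Rightarrow> (real \<Rightarrow> real) \<Rightarrow> bool" where
  "semigroup_generator \<kappa> f g \<longleftrightarrow> f \<in> C0 \<and> g \<in> C0 \<and>
     uniform_limit {0..} (\<lambda>t x. (semigroup_op \<kappa> t f x - f x) / t) g (at_right 0)"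

text \<open>
  Here \<open>f1\<close> and \<open>f2\<close> are \<open>f'\<close> and \<open>f''\<close> on \<open>(0,\<infinity>)\<close>, \<open>f2 0\<close> is the value at \<open>0\<close> of the continuous extension
  of \<open>f''\<close>, and \<open>d\<close> is \<open>f'(0)\<close>.  The measure \<open>p4\<close> lives on \<open>(0,\<infinity>)\<close>, so no domain of integration is indicated.
\<close>

definition feller_bm_generator ::
    "real \<Rightarrow> real \<Rightarrow> real \<Rightarrow> real measure \<Rightarrow> (real \<Rightarrow> real) \<Rightarrow> (real \<Rightarrow> real) \<Rightarrow> bool" where
  "feller_bm_generator p1 p2 p3 p4 f g \<longleftrightarrow> f \<in> C0 \<and>
     (\<exists>f1 f2 d.
        (\<forall>x>0. (f has_real_derivative f1 x) (at x)) \<and>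
        (\<forall>x>0. (f1 has_real_derivative f2 x) (at x)) \<and>
        f2 \<in> C0 \<and> (f1 \<longlongrightarrow> d) (at_right 0) \<and>
        p1 * f 0 - p2 * d + p3 / 2 * f2 0 + (\<integral>x. (f 0 - f x) \<partial>p4) = 0 \<and>
        (\<forall>x\<ge>0. g x = f2 x / 2))"

definition past :: "'w measure \<Rightarrow> (real \<Rightarrow> 'w \<Rightarrow> ennreal) \<Rightarrow> real \<Rightarrow> 'w measure" where
  "past M B s = sigma (space M) {B u -` A \<inter> space M | u A. 0 \<le> u \<and> u \<le> s \<and> A \<in> sets borel}"

definition markov_process ::
    "(real \<Rightarrow> ennreal \<Rightarrow> ennreal measure) \<Rightarrow> ennreal \<Rightarrow> 'w measure \<Rightarrow> (real \<Rightarrow> 'w \<Rightarrow> ennreal) \<Rightarrow> bool" where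
  "markov_process \<kappa> x0 M B \<longleftrightarrow> prob_space M \<and>
     (\<forall>t\<ge>0. B t \<in> borel_measurable M) \<and>
     (AE \<omega> in M. B 0 \<omega> = x0) \<and>
     (\<forall>s\<ge>0. \<forall>t\<ge>0. \<forall>A\<in>sets borel.
        AE \<omega> in M. real_cond_exp M (past M B s) (\<lambda>\<omega>. indicator A (B (s + t) \<omega>)) \<omega>
          = measure (\<kappa> t (B s \<omega>)) A)"

definition feller_brownian_motion ::
    "real \<Rightarrow> real \<Rightarrow> real \<Rightarrow> real measure \<Rightarrow> real \<Rightarrow> 'w measure \<Rightarrow> (real \<Rightarrow> 'w \<Rightarrow> ennreal) \<Rightarrow> bool" where
  "feller_brownian_motion p1 p2 p3 p4 x0 M B \<longleftrightarrow>
     (\<exists>\<kappa>. feller_transition \<kappa> \<and>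
          (\<forall>f g. semigroup_generator \<kappa> f g \<longleftrightarrow> feller_bm_generator p1 p2 p3 p4 f g) \<and>
          markov_process \<kappa> (ennreal x0) M B) \<and>
     (\<forall>\<omega>\<in>space M. cadlag (\<lambda>t. B t \<omega>))"

section \<open>Boundary random walks\<close>

fun brw_step :: "enat pmf \<Rightarrow> enat \<Rightarrow> enat pmf" where
  "brw_step \<pp> (enat 0) = \<pp>"
| "brw_step \<pp> (enat (Suc i)) = pmf_of_set {enat i, enat (i + 2)}"
| "brw_step \<pp> \<infinity> = return_pmf \<infinity>"

definition boundary_random_walk ::
    "enat pmf \<Rightarrow> nat \<Rightarrow> 'w measure \<Rightarrow> (nat \<Rightarrow> 'w \<Rightarrow> enat) \<Rightarrow> bool" where
  "boundary_random_walk \<pp> i M X \<longleftrightarrow> prob_space M \<and>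
     (\<forall>k. X k \<in> M \<rightarrow>\<^sub>M count_space UNIV) \<and>
     (AE \<omega> in M. X 0 \<omega> = enat i) \<and>
     (\<forall>k x. measure M {\<omega> \<in> space M. \<forall>l\<le>Suc k. X l \<omega> = x l} =
        measure M {\<omega> \<in> space M. \<forall>l\<le>k. X l \<omega> = x l} * pmf (brw_step \<pp> (x k)) (x (Suc k)))"

text \<open>The weights of the jumping measure, first for positive integers, then for all of \<open>\<nat> \<union> {\<Delta>}\<close>.\<close>

definition jump_weight_pos :: "real \<Rightarrow> real \<Rightarrow> real measure \<Rightarrow> nat \<Rightarrow> nat \<Rightarrow> real" where
  "jump_weight_pos p2 p3 p4 n j =
     (if j = 1 then p2 / (real n * p3)
      else if 2 \<le> j \<and> j < n\<^sup>2
        then measure p4 {real j / real n <.. real (j + 1) / real n} / ((real n)\<^sup>2 * p3)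
      else 0)"

definition jump_weight :: "real \<Rightarrow> real \<Rightarrow> real \<Rightarrow> real measure \<Rightarrow> nat \<Rightarrow> enat \<Rightarrow> real" where
  "jump_weight p1 p2 p3 p4 n x = (case x of
       \<infinity> \<Rightarrow> p1 / ((real n)\<^sup>2 * p3)
     | enat j \<Rightarrow> if j = 0
         then 1 - p1 / ((real n)\<^sup>2 * p3) - (\<Sum>j. jump_weight_pos p2 p3 p4 n (Suc j))
         else jump_weight_pos p2 p3 p4 n j)"

definition jumping_measure :: "real \<Rightarrow> real \<Rightarrow> real \<Rightarrow> real measure \<Rightarrow> nat \<Rightarrow> enat pmf" where
  "jumping_measure p1 p2 p3 p4 n = embed_pmf (jump_weight p1 p2 p3 p4 n)"

lemma pmf_jumping_measure:
  assumes p: "0 \<le> p1" "0 \<le> p2" "0 < p3" and n: "2 \<le> n"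
    and p0: "0 \<le> jump_weight p1 p2 p3 p4 n 0"
  shows "pmf (jumping_measure p1 p2 p3 p4 n) x = jump_weight p1 p2 p3 p4 n x"
proof -
  let ?w = "jump_weight p1 p2 p3 p4 n" and ?v = "jump_weight_pos p2 p3 p4 n"
  have v: "0 \<le> ?v j" for j
    using p by (simp add: jump_weight_pos_def)
  have w: "0 \<le> ?w x" for x
    using p p0 v by (auto simp: jump_weight_def zero_enat_def split: enat.splits)
  have "2\<^sup>2 \<le> n\<^sup>2"
    using n by (intro power_mono) auto
  then have big: "?v j = 0" if "n\<^sup>2 \<le> j" for j
    using that by (auto simp: jump_weight_pos_def)
  define A where "A = insert \<infinity> (enat ` {..n\<^sup>2})"
  have out: "?w x = 0" if "x \<notin> A" for x
  proof (cases x)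
    case (enat j)
    then have "n\<^sup>2 < j"
      using that by (force simp: A_def)
    then show ?thesis
      using enat big[of j] by (simp add: jump_weight_def)
  qed (use that in \<open>simp add: A_def\<close>)
  have s: "(\<Sum>j. ?v (Suc j)) = (\<Sum>j<n\<^sup>2. ?v (Suc j))"
    by (intro suminf_finite) (auto intro: big)
  have "sum ?w A = ?w \<infinity> + (\<Sum>j\<le>n\<^sup>2. ?w (enat j))"
    unfolding A_def by (subst sum.insert) (auto simp: sum.reindex inj_on_def)
  also have "(\<Sum>j\<le>n\<^sup>2. ?w (enat j)) = ?w (enat 0) + (\<Sum>j<n\<^sup>2. ?w (enat (Suc j)))"
    by (simp add: sum.atMost_shift)
  also have "?w \<infinity> + \<dots> = 1"
    by (simp add: jump_weight_def s)
  finally have "sum ?w A = 1" .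
  moreover have "(\<integral>\<^sup>+x. ennreal (?w x) \<partial>count_space UNIV) = (\<Sum>x\<in>A. ennreal (?w x))"
    by (intro nn_integral_count_space') (auto simp: A_def[symmetric] out, auto simp: A_def)
  ultimately have "(\<integral>\<^sup>+x. ennreal (?w x) \<partial>count_space UNIV) = 1"
    using w by simp
  with w show ?thesis
    unfolding jumping_measure_def by (intro pmf_embed_pmf)
qed

text \<open>The rescaling \<open>B\<^sup>n\<^sub>t = X\<^bsub>\<lfloor>n\<^sup>2 t\<rfloor>\<^esub> / n\<close>; division in \<^typ>\<open>ennreal\<close> gives \<open>\<Delta> / n = \<Delta>\<close>.\<close>

definition rescale :: "nat \<Rightarrow> (nat \<Rightarrow> 'w \<Rightarrow> enat) \<Rightarrow> real \<Rightarrow> 'w \<Rightarrow> ennreal" where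
  "rescale n X t \<omega> = ennreal_of_enat (X (nat \<lfloor>(real n)\<^sup>2 * t\<rfloor>) \<omega>) / of_nat n"

end

theory Submission
  imports Defs "HOL-Real_Asymp.Real_Asymp"
begin

text \<open>
  Let \<open>A\<^sub>n = n\<^sup>2 (P\<^sub>n - 1)\<close> be the generator of the rescaled walk.  For \<open>f\<close> in the domain of the generator \<open>L\<close> of
  Feller's Brownian motion \<open>A\<^sub>n f \<rightarrow> L f\<close> uniformly: at \<open>i \<ge> 1\<close> this is a second difference quotient, at \<open>0\<close> it is
  the boundary condition divided by \<open>p\<^sub>3\<close>.  A telescoping sum along the orbit of the semigroup and the density of the
  domain give uniform convergence of the semigroups on all of \<open>C([0,\<infinity>])\<close>, and the Markov property gives convergence of the
  finite-dimensional distributions.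
  
  For paths it suffices to test Lipschitz functionals for the Skorokhod metric and to compare each path with its
  restriction to a grid of mesh \<open>1/m\<close>.  For the limit process the comparison holds path by path.  For the walk,
  \<open>A\<^sub>n\<close> applied to the squared distance to a fixed point, measured after \<open>x \<mapsto> 1 / (1 + x)\<close>, is bounded uniformly in \<open>n\<close>; hence
  exits from \<open>\<epsilon>\<close>-balls are unlikely to follow each other quickly, and if they do not, a time change moving the exit times
  to the grid shows that path and sampled path are close.
\<close>

section \<open>The Skorokhod metric\<close>

text \<open>Two limits compete: the mesh tends to 0 and \<open>n\<close> to infinity. For a fixed
  mesh the sampled paths depend, up to a small error, on finitely many times, so convergence of the
  semigroups suffices; the mesh therefore has to be chosen before \<open>n\<close>, and the sampling
  error of the walk must be bounded uniformly in \<open>n\<close>. With such a bound neither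
  relative compactness of the laws nor separability or completeness of the path space enters.

  Sampling sees a jump with a delay of up to \<open>1 / m\<close>, so it need not be uniformly close
  to a path with jumps. The Skorokhod distance forgives the delay only if the time change has slopes
  near 1, which asks for consecutive exits much further apart than \<open>1 / m\<close>. This is why
  the frequency of exits has to be controlled, and not merely the oscillation at fixed times.

  On the compact space \<open>[0,\<infinity>]\<close> the cemetery is an ordinary absorbing point:
  mass is conserved, constants belong to the function space, and no escape of mass to infinity has
  to be excluded. Distances are measured in the coordinate \<open>psi\<close>, in which the cemetery
  sits at 0.\<close>

definition psi :: "ennreal \<Rightarrow> real" where
  "psi x = enn2real (inverse (1 + x))"

lemma compact_dist_psi: "compact_dist x y = \<bar>psi x - psi y\<bar>"
  by (simp add: compact_dist_def psi_def)

lemma psi_top [simp]: "psi \<top> = 0"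
  by (simp add: psi_def)

lemma psi_ennreal: "0 \<le> x \<Longrightarrow> psi (ennreal x) = 1 / (1 + x)"
  by (simp add: psi_def inverse_ennreal inverse_eq_divide flip: ennreal_1 ennreal_plus)

lemma psi_nonneg: "0 \<le> psi x"
  by (simp add: psi_def)

lemma psi_le_1: "psi x \<le> 1"
proof (cases x)
  case (real r)
  then show ?thesis using psi_ennreal[of r] by simp
qed simp

lemma inj_psi: "psi x = psi y \<longleftrightarrow> x = y"
proof (cases x)
  case (real r)
  show ?thesis
  proof (cases y)
    case (real s)
    then show ?thesis using \<open>x = ennreal r\<close> \<open>0 \<le> r\<close>
      by (auto simp: psi_ennreal divide_simps)
  next
    case top
    then show ?thesis using real psi_ennreal[of r] by (auto simp: divide_simps)
  qed
next
  case top
  then show ?thesis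
    by (cases y) (auto simp: psi_ennreal divide_simps)
qed

lemma tendsto_psi_iff: "(f \<longlongrightarrow> l) F \<longleftrightarrow> ((\<lambda>x. psi (f x)) \<longlongrightarrow> psi l) F"
  unfolding tendsto_iff_compact_dist compact_dist_psi
  by (subst (2) tendsto_dist_iff) (simp add: dist_real_def)

lemma continuous_on_psi [continuous_intros]: "continuous_on A psi"
proof -
  have "(psi \<longlongrightarrow> psi x) (at x within A)" for x
    using tendsto_psi_iff[of "\<lambda>x. x" x "at x within A"] by (simp add: tendsto_ident_at)
  then show ?thesis by (simp add: continuous_on_def)
qed

lemma borel_measurable_psi [measurable]: "psi \<in> borel_measurable borel"
  using continuous_on_psi by (rule borel_measurable_continuous_onI)

lemma compact_dist_le_1: "compact_dist x y \<le> 1"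
  using psi_nonneg[of x] psi_nonneg[of y] psi_le_1[of x] psi_le_1[of y]
  by (auto simp: compact_dist_psi)

lemma compact_dist_triangle: "compact_dist x z \<le> compact_dist x y + compact_dist y z"
  by (simp add: compact_dist_psi)

lemma compact_dist_commute: "compact_dist x y = compact_dist y x"
  by (simp add: compact_dist_psi abs_minus_commute)

lemma compact_dist_self [simp]: "compact_dist x x = 0"
  by (simp add: compact_dist_psi)

lemma compact_dist_nonneg [simp]: "0 \<le> compact_dist x y"
  by (simp add: compact_dist_psi)

section \<open>Right-continuity and left limits in terms of \<open>compact_dist\<close>\<close>

lemma cadlag_right:
  assumes "cadlag x" "0 \<le> t" "0 < e"
  obtains d where "0 < d" "\<And>v. t \<le> v \<Longrightarrow> v < t + d \<Longrightarrow> compact_dist (x v) (x t) < e"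
proof -
  have "(x \<longlongrightarrow> x t) (at_right t)" using assms by (auto simp: cadlag_def)
  then have "((\<lambda>v. compact_dist (x v) (x t)) \<longlongrightarrow> 0) (at_right t)"
    by (simp add: tendsto_iff_compact_dist)
  then have "\<forall>\<^sub>F v in at_right t. compact_dist (x v) (x t) < e"
    using \<open>0 < e\<close> by (rule order_tendstoD)
  then obtain b where "t < b" "\<And>v. t < v \<Longrightarrow> v < b \<Longrightarrow> compact_dist (x v) (x t) < e"
    by (auto simp: eventually_at_right_field)
  then show ?thesis
    using \<open>0 < e\<close> by (intro that[of "b - t"]) (auto simp: le_less)
qed

lemma cadlag_left:
  assumes "cadlag x" "0 < t"
  obtains l where "\<And>e. 0 < e \<Longrightarrow> \<exists>d>0. \<forall>v. t - d < v \<and> v < t \<longrightarrow> compact_dist (x v) l < e"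
proof -
  obtain l where "(x \<longlongrightarrow> l) (at_left t)" using assms by (auto simp: cadlag_def)
  then have *: "((\<lambda>v. compact_dist (x v) l) \<longlongrightarrow> 0) (at_left t)"
    by (simp add: tendsto_iff_compact_dist)
  show ?thesis
  proof (rule that)
    fix e :: real assume "0 < e"
    with * have "\<forall>\<^sub>F v in at_left t. compact_dist (x v) l < e"
      by (rule order_tendstoD)
    then obtain b where "b < t" "\<And>v. b < v \<Longrightarrow> v < t \<Longrightarrow> compact_dist (x v) l < e"
      by (auto simp: eventually_at_left_field)
    then show "\<exists>d>0. \<forall>v. t - d < v \<and> v < t \<longrightarrow> compact_dist (x v) l < e"
      by (intro exI[of _ "t - b"]) auto
  qed
qed

text \<open>By right-continuity the path is the pointwise limit of its values at the next grid point
  strictly to the right, which depend on the time only through an integer. The limit is taken in the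
  real coordinate \<open>psi\<close>, which is inverted at the end; \<open>max 0\<close> extends the
  path to negative times.\<close>

lemma cadlag_measurable:
  assumes "cadlag x"
  shows "(\<lambda>u. x (max 0 u)) \<in> borel_measurable (borel :: real measure)"
proof -
  define g where "g m u = psi (x ((real_of_int \<lfloor>real (Suc m) * max 0 u\<rfloor> + 1) / real (Suc m)))" for m u
  have g: "g m \<in> borel_measurable borel" for m
    unfolding g_def
    by (rule measurable_compose[where f = "\<lambda>u. \<lfloor>real (Suc m) * max 0 u\<rfloor>" and N = "count_space UNIV"]) simp_all
  have "(\<lambda>m. g m u) \<longlonglongrightarrow> psi (x (max 0 u))" for u
  proof (rule LIMSEQ_I)
    fix r :: real assume "0 < r"
    obtain d where d: "0 < d" "\<And>v. max 0 u \<le> v \<Longrightarrow> v < max 0 u + d \<Longrightarrow> compact_dist (x v) (x (max 0 u)) < r"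
      using cadlag_right[OF assms _ \<open>0 < r\<close>, of "max 0 u"] by auto
    obtain n0 where n0: "inverse (real (Suc n0)) < d"
      using reals_Archimedean[OF \<open>0 < d\<close>] by auto
    show "\<exists>no. \<forall>n\<ge>no. norm (g n u - psi (x (max 0 u))) < r"
    proof (intro exI[of _ n0] allI impI)
      fix n assume "n0 \<le> n"
      then have "inverse (real (Suc n)) \<le> inverse (real (Suc n0))" by simp
      then have n: "1 / real (Suc n) < d" using n0 by (simp add: inverse_eq_divide)
      define k where "k = real_of_int \<lfloor>real (Suc n) * max 0 u\<rfloor>"
      have k: "k \<le> real (Suc n) * max 0 u" "real (Suc n) * max 0 u < k + 1"
        by (auto simp: k_def)
      have "max 0 u \<le> (k + 1) / real (Suc n)"
        using k by (subst pos_le_divide_eq) (auto simp: mult.commute simp del: of_nat_Suc)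
      moreover have "k / real (Suc n) \<le> max 0 u"
        using k by (subst pos_divide_le_eq) (auto simp: mult.commute simp del: of_nat_Suc)
      then have "(k + 1) / real (Suc n) < max 0 u + d"
        using n by (simp add: add_divide_distrib del: of_nat_Suc)
      ultimately show "norm (g n u - psi (x (max 0 u))) < r"
        using d(2)[of "(k + 1) / real (Suc n)"] by (simp add: g_def k_def compact_dist_psi)
    qed
  qed
  then have psi_meas: "(\<lambda>u. psi (x (max 0 u))) \<in> borel_measurable borel"
    by (rule borel_measurable_LIMSEQ_real) (rule g)
  have inv: "y = inverse (ennreal (psi y)) - 1" for y :: ennreal
  proof -
    have "inverse (inverse (1 + y)) = 1 + y"
      by (cases y) (simp_all add: inverse_ennreal add_pos_nonneg flip: ennreal_1 ennreal_plus)
    then show ?thesis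
      by (simp add: psi_def enn2real_inverse_bounds(2))
  qed
  have "(\<lambda>u. inverse (ennreal (psi (x (max 0 u)))) - 1) \<in> borel_measurable borel"
    using psi_meas by (intro borel_measurable_minus_ennreal borel_measurable_inverse_ennreal) simp_all
  moreover have "(\<lambda>u. inverse (ennreal (psi (x (max 0 u)))) - 1) = (\<lambda>u. x (max 0 u))"
    by (rule ext) (rule inv[symmetric])
  ultimately show ?thesis by simp
qed

section \<open>Time changes and their logarithmic distortion\<close>

lemma time_change_id: "(\<lambda>t. t) \<in> time_changes"
  by (auto simp: time_changes_def strict_mono_on_def)

lemma time_change_less:
  assumes "l \<in> time_changes" "0 \<le> s" "0 \<le> t"
  shows "l s < l t \<longleftrightarrow> s < t" "l s \<le> l t \<longleftrightarrow> s \<le> t" "0 \<le> l s"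
proof -
  have "strict_mono_on {0..} l" using assms by (auto simp: time_changes_def)
  then show "l s < l t \<longleftrightarrow> s < t" "l s \<le> l t \<longleftrightarrow> s \<le> t"
    using assms by (auto simp: strict_mono_on_less strict_mono_on_less_eq)
  show "0 \<le> l s" using assms by (auto simp: time_changes_def)
qed

lemma time_change_onto:
  assumes "l \<in> time_changes" "0 \<le> s"
  obtains t where "0 \<le> t" "l t = s"
  using assms by (force simp: time_changes_def)

lemma time_change_0: "l \<in> time_changes \<Longrightarrow> l 0 = 0"
  by (metis order.refl order_antisym time_change_less(2,3) time_change_onto)

lemma time_change_comp:
  assumes "l \<in> time_changes" "k \<in> time_changes"
  shows "k \<circ> l \<in> time_changes"
proof -
  have "(k \<circ> l) ` {0..} = {0..}"
    using assms by (simp only: image_comp[symmetric]) (simp add: time_changes_def)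
  moreover have "strict_mono_on {0..} (k \<circ> l)"
    using time_change_less[OF assms(1)] time_change_less[OF assms(2)]
    by (intro strict_mono_onI) auto
  ultimately show ?thesis by (simp add: time_changes_def)
qed

definition time_inv :: "(real \<Rightarrow> real) \<Rightarrow> real \<Rightarrow> real" where
  "time_inv l = inv_into {0..} l"

lemma time_inv:
  assumes "l \<in> time_changes" "0 \<le> s"
  shows "l (time_inv l s) = s" "0 \<le> time_inv l s" "time_inv l (l s) = s"
proof -
  have "s \<in> l ` {0..}" using assms by (auto simp: time_changes_def)
  then show "l (time_inv l s) = s" "0 \<le> time_inv l s"
    using f_inv_into_f[of s l "{0..}"] inv_into_into[of s l "{0..}"] by (auto simp: time_inv_def)
  have "inj_on l {0..}"
    using assms strict_mono_on_imp_inj_on by (auto simp: time_changes_def)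
  then show "time_inv l (l s) = s" using assms by (simp add: time_inv_def)
qed

lemma time_inv_change:
  assumes "l \<in> time_changes"
  shows "time_inv l \<in> time_changes"
proof -
  have "strict_mono_on {0..} (time_inv l)"
  proof (rule strict_mono_onI)
    fix r s :: real assume "r \<in> {0..}" "s \<in> {0..}" "r < s"
    then show "time_inv l r < time_inv l s"
      using time_inv[OF assms] time_change_less(1)[OF assms, of "time_inv l r" "time_inv l s"] by auto
  qed
  moreover have "time_inv l ` {0..} = {0..}"
  proof
    show "{0..} \<subseteq> time_inv l ` {0..}"
    proof
      fix s :: real assume "s \<in> {0..}"
      then show "s \<in> time_inv l ` {0..}"
        using time_inv[OF assms, of s] time_change_less(3)[OF assms, of s]
        by (intro image_eqI[of _ _ "l s"]) auto
    qed
  qed (use time_inv[OF assms] in auto)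
  ultimately show ?thesis by (simp add: time_changes_def)
qed

lemma time_distortion_le:
  assumes "\<And>s t. 0 \<le> t \<Longrightarrow> t < s \<Longrightarrow> ennreal \<bar>ln ((l s - l t) / (s - t))\<bar> \<le> c"
  shows "time_distortion l \<le> c"
  unfolding time_distortion_def by (rule SUP_least) (use assms in auto)

lemma time_distortion_ge:
  assumes "0 \<le> t" "t < s"
  shows "ennreal \<bar>ln ((l s - l t) / (s - t))\<bar> \<le> time_distortion l"
proof -
  have "(case (s, t) of (s, t) \<Rightarrow> ennreal \<bar>ln ((l s - l t) / (s - t))\<bar>) \<le> time_distortion l"
    unfolding time_distortion_def by (rule SUP_upper) (use assms in auto)
  then show ?thesis by simp
qed

lemma time_distortion_id [simp]: "time_distortion (\<lambda>t. t) = 0"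
proof -
  have "time_distortion (\<lambda>t. t) \<le> 0"
    by (rule time_distortion_le) simp
  then show ?thesis by simp
qed

text \<open>Difference quotients multiply under composition, so their logarithms add; this is the
  reason for measuring slopes logarithmically.\<close>

lemma time_distortion_comp:
  assumes "l \<in> time_changes" "k \<in> time_changes"
  shows "time_distortion (k \<circ> l) \<le> time_distortion l + time_distortion k"
proof (rule time_distortion_le)
  fix s t :: real assume st: "0 \<le> t" "t < s"
  have l: "0 \<le> l t" "l t < l s"
    using time_change_less[OF assms(1), of t s] st by auto
  have k: "k (l t) < k (l s)"
    using time_change_less[OF assms(2), of "l t" "l s"] l by auto
  have "((k \<circ> l) s - (k \<circ> l) t) / (s - t) = ((k (l s) - k (l t)) / (l s - l t)) * ((l s - l t) / (s - t))"
    using l by simp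
  also have "ln \<dots> = ln ((k (l s) - k (l t)) / (l s - l t)) + ln ((l s - l t) / (s - t))"
    using l k st by (intro ln_mult_pos divide_pos_pos) auto
  finally have "ennreal \<bar>ln (((k \<circ> l) s - (k \<circ> l) t) / (s - t))\<bar>
      \<le> ennreal (\<bar>ln ((l s - l t) / (s - t))\<bar> + \<bar>ln ((k (l s) - k (l t)) / (l s - l t))\<bar>)"
    by (intro ennreal_leI) linarith
  also have "\<dots> = ennreal \<bar>ln ((l s - l t) / (s - t))\<bar> + ennreal \<bar>ln ((k (l s) - k (l t)) / (l s - l t))\<bar>"
    by simp
  also have "\<dots> \<le> time_distortion l + time_distortion k"
    using st l by (intro add_mono time_distortion_ge) auto
  finally show "ennreal \<bar>ln (((k \<circ> l) s - (k \<circ> l) t) / (s - t))\<bar> \<le> time_distortion l + time_distortion k" .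
qed

text \<open>The difference quotients of the inverse are the reciprocals, so the logarithm only
  changes its sign.\<close>

lemma time_distortion_inv:
  assumes "l \<in> time_changes"
  shows "time_distortion (time_inv l) \<le> time_distortion l"
proof (rule time_distortion_le)
  fix s t :: real assume st: "0 \<le> t" "t < s"
  define a b where "a = time_inv l t" "b = time_inv l s"
  have ab: "l a = t" "l b = s" "0 \<le> a" "0 \<le> b"
    using st time_inv[OF assms] by (auto simp: a_b_def)
  then have "a < b" using time_change_less(1)[OF assms, of a b] st by auto
  have "ln ((b - a) / (s - t)) = - ln ((l b - l a) / (b - a))"
    using \<open>a < b\<close> st ab by (simp add: ln_div)
  then show "ennreal \<bar>ln ((time_inv l s - time_inv l t) / (s - t))\<bar> \<le> time_distortion l"
    using time_distortion_ge[OF \<open>0 \<le> a\<close> \<open>a < b\<close>, of l] by (simp add: a_b_def)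
qed

section \<open>The cost of a single time change and the axioms of a metric\<close>

definition path_osc :: "(real \<Rightarrow> ennreal) \<Rightarrow> (real \<Rightarrow> ennreal) \<Rightarrow> (real \<Rightarrow> real) \<Rightarrow> real \<Rightarrow> ennreal" where
  "path_osc x y l u = (SUP t \<in> {0..}. ennreal (compact_dist (x (min t u)) (y (min (l t) u))))"

definition change_cost :: "(real \<Rightarrow> ennreal) \<Rightarrow> (real \<Rightarrow> ennreal) \<Rightarrow> (real \<Rightarrow> real) \<Rightarrow> ennreal" where
  "change_cost x y l = max (time_distortion l) (\<integral>\<^sup>+ u\<in>{0..}. ennreal (exp (- u)) * path_osc x y l u \<partial>lborel)"

lemma skorokhod_dist_change_cost: "skorokhod_dist x y = enn2real (INF l \<in> time_changes. change_cost x y l)"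
  by (simp add: skorokhod_dist_def change_cost_def path_osc_def)

lemma nn_integral_exp: "(\<integral>\<^sup>+ u\<in>{0..}. ennreal (exp (- u)) \<partial>lborel) = 1"
  using nn_intergal_power_times_exp_Ici[of 0] by simp

lemma path_osc_le_1: "path_osc x y l u \<le> 1"
  unfolding path_osc_def by (rule SUP_least) (metis compact_dist_le_1 ennreal_1 ennreal_leI)

lemma path_osc_ge: "0 \<le> t \<Longrightarrow> ennreal (compact_dist (x (min t u)) (y (min (l t) u))) \<le> path_osc x y l u"
  unfolding path_osc_def by (rule SUP_upper) simp

text \<open>The identity has no distortion, \<open>compact_dist\<close> is at most 1 and the
  exponential weight has total mass 1. Hence the infimum is finite and \<open>enn2real\<close> in
  the definition of the distance loses nothing.\<close>

lemma INF_change_cost_le_1: "(INF l \<in> time_changes. change_cost x y l) \<le> 1"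
proof (rule INF_lower2[OF time_change_id])
  have "(\<integral>\<^sup>+ u\<in>{0..}. ennreal (exp (- u)) * path_osc x y (\<lambda>t. t) u \<partial>lborel)
    \<le> (\<integral>\<^sup>+ u\<in>{0..}. ennreal (exp (- u)) \<partial>lborel)"
    by (intro nn_integral_mono mult_right_mono) (auto intro: mult_left_le path_osc_le_1)
  then show "change_cost x y (\<lambda>t. t) \<le> 1"
    by (simp add: change_cost_def nn_integral_exp)
qed

lemma ennreal_skorokhod_dist: "ennreal (skorokhod_dist x y) = (INF l \<in> time_changes. change_cost x y l)"
proof -
  have "(INF l \<in> time_changes. change_cost x y l) < \<top>"
    using INF_change_cost_le_1[of x y] by (rule le_less_trans) simp
  then show ?thesis
    unfolding skorokhod_dist_change_cost by simp
qed

lemma skorokhod_dist_nonneg [simp]: "0 \<le> skorokhod_dist x y"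
  by (simp add: skorokhod_dist_change_cost)

lemma skorokhod_dist_leI:
  assumes "l \<in> time_changes" "change_cost x y l \<le> ennreal c" "0 \<le> c"
  shows "skorokhod_dist x y \<le> c"
proof -
  have "ennreal (skorokhod_dist x y) \<le> ennreal c"
    unfolding ennreal_skorokhod_dist using assms by (auto intro: INF_lower2)
  then show ?thesis using assms by simp
qed

lemma skorokhod_dist_lessE:
  assumes "skorokhod_dist x y < c"
  obtains l where "l \<in> time_changes" "change_cost x y l < ennreal c"
proof -
  have "ennreal (skorokhod_dist x y) < ennreal c"
    using assms by (simp add: ennreal_less_iff)
  then show ?thesis
    using that unfolding ennreal_skorokhod_dist INF_less_iff by auto
qed

lemma skorokhod_dist_self [simp]: "skorokhod_dist x x = 0"
proof -
  have "path_osc x x (\<lambda>t. t) u = 0" for u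
    by (simp add: path_osc_def)
  then have "change_cost x x (\<lambda>t. t) = 0"
    by (simp add: change_cost_def)
  then have "skorokhod_dist x x \<le> 0"
    by (intro skorokhod_dist_leI[OF time_change_id]) auto
  then show ?thesis using skorokhod_dist_nonneg[of x x] by linarith
qed

lemma path_osc_inv:
  assumes "l \<in> time_changes"
  shows "path_osc y x (time_inv l) u \<le> path_osc x y l u"
  unfolding path_osc_def[of y x]
proof (rule SUP_least)
  fix t :: real assume "t \<in> {0..}"
  then show "ennreal (compact_dist (y (min t u)) (x (min (time_inv l t) u))) \<le> path_osc x y l u"
    using path_osc_ge[of "time_inv l t" x u y l] time_inv[OF assms, of t]
    by (simp add: compact_dist_commute)
qed

lemma skorokhod_dist_commute_le: "skorokhod_dist y x \<le> skorokhod_dist x y"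
proof (rule ccontr)
  assume "\<not> skorokhod_dist y x \<le> skorokhod_dist x y"
  then obtain c where c: "skorokhod_dist x y < c" "c < skorokhod_dist y x"
    using dense by (metis not_le)
  obtain l where l: "l \<in> time_changes" "change_cost x y l < ennreal c"
    using skorokhod_dist_lessE[OF c(1)] .
  have "(\<integral>\<^sup>+ u\<in>{0..}. ennreal (exp (- u)) * path_osc y x (time_inv l) u \<partial>lborel)
      \<le> (\<integral>\<^sup>+ u\<in>{0..}. ennreal (exp (- u)) * path_osc x y l u \<partial>lborel)"
    using path_osc_inv[OF l(1)] by (intro nn_integral_mono mult_right_mono mult_left_mono) auto
  then have "change_cost y x (time_inv l) \<le> change_cost x y l"
    unfolding change_cost_def using time_distortion_inv[OF l(1)] by (intro max.mono)
  also have "\<dots> \<le> ennreal c" using l by simp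
  finally have "skorokhod_dist y x \<le> c"
    using c(1) order_trans[OF skorokhod_dist_nonneg less_imp_le]
    by (intro skorokhod_dist_leI[OF time_inv_change[OF l(1)]]) auto
  then show False using c by simp
qed

lemma skorokhod_dist_commute: "skorokhod_dist x y = skorokhod_dist y x"
  by (intro order_antisym skorokhod_dist_commute_le)

lemma path_osc_comp:
  assumes "l \<in> time_changes"
  shows "path_osc x z (k \<circ> l) u \<le> path_osc x y l u + path_osc y z k u"
  unfolding path_osc_def[of x z]
proof (rule SUP_least)
  fix t :: real assume "t \<in> {0..}"
  then have "0 \<le> t" "0 \<le> l t"
    using time_change_less(3)[OF assms, of t] by auto
  have "ennreal (compact_dist (x (min t u)) (z (min ((k \<circ> l) t) u)))
     \<le> ennreal (compact_dist (x (min t u)) (y (min (l t) u)) + compact_dist (y (min (l t) u)) (z (min (k (l t)) u)))"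
    by (intro ennreal_leI) (simp add: compact_dist_triangle)
  also have "\<dots> = ennreal (compact_dist (x (min t u)) (y (min (l t) u))) + ennreal (compact_dist (y (min (l t) u)) (z (min (k (l t)) u)))"
    by simp
  also have "\<dots> \<le> path_osc x y l u + path_osc y z k u"
    using \<open>0 \<le> t\<close> \<open>0 \<le> l t\<close> by (intro add_mono path_osc_ge) auto
  finally show "ennreal (compact_dist (x (min t u)) (z (min ((k \<circ> l) t) u))) \<le> path_osc x y l u + path_osc y z k u" .
qed

lemma cadlag_compose_right:
  assumes "cadlag y" "l \<in> time_changes" "0 \<le> t" "0 \<le> u" "0 < e"
  obtains d where "0 < d" "\<And>v. t \<le> v \<Longrightarrow> v < t + d \<Longrightarrow> compact_dist (y (min (l v) u)) (y (min (l t) u)) < e"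
proof -
  have "0 \<le> l t" using time_change_less(3)[OF assms(2,3)] assms by auto
  then obtain d where d: "0 < d" "\<And>v. min (l t) u \<le> v \<Longrightarrow> v < min (l t) u + d \<Longrightarrow> compact_dist (y v) (y (min (l t) u)) < e"
    using assms(4) by (rule_tac cadlag_right[OF assms(1) _ \<open>0 < e\<close>, of "min (l t) u"]) auto
  obtain b where b: "0 \<le> b" "l b = l t + d"
    using time_change_onto[OF assms(2), of "l t + d"] \<open>0 \<le> l t\<close> d by auto
  have "t < b" using time_change_less(1)[OF assms(2,3) b(1)] b d by auto
  show ?thesis
  proof (rule that[of "b - t"])
    fix v assume v: "t \<le> v" "v < t + (b - t)"
    then have "l t \<le> l v" "l v < l b"
      using time_change_less(2)[OF assms(2), of t v] time_change_less(1)[OF assms(2), of v b] assms(3) b(1) by auto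
    then show "compact_dist (y (min (l v) u)) (y (min (l t) u)) < e"
      using b(2) d(1) by (intro d(2)) linarith+
  qed (use \<open>t < b\<close> in auto)
qed

text \<open>Right-continuity of the paths and bijectivity of the time change reduce the supremum to
  countably many times. This makes the integrand measurable in \<open>u\<close>, without which the
  integral of the sum in the triangle inequality could not be split.\<close>

lemma path_osc_rational:
  assumes "cadlag x" "cadlag y" "l \<in> time_changes" "0 \<le> u"
  shows "path_osc x y l u = (SUP t \<in> \<rat> \<inter> {0..}. ennreal (compact_dist (x (min t u)) (y (min (l t) u))))" (is "_ = ?S")
proof (rule order_antisym)
  show "?S \<le> path_osc x y l u"
    unfolding path_osc_def by (rule SUP_subset_mono) auto
  show "path_osc x y l u \<le> ?S"
    unfolding path_osc_def
  proof (rule SUP_least, rule ennreal_le_epsilon)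
    fix t e :: real assume t: "t \<in> {0..}" and "0 < e"
    then have t0: "0 \<le> t" and e2: "0 < e/2" by auto
    obtain d1 where d1: "0 < d1" "\<And>v. t \<le> v \<Longrightarrow> v < t + d1 \<Longrightarrow> compact_dist (x (min v u)) (x (min t u)) < e/2"
      by (rule cadlag_compose_right[OF assms(1) time_change_id t0 assms(4) e2]) (rule that)
    obtain d2 where d2: "0 < d2" "\<And>v. t \<le> v \<Longrightarrow> v < t + d2 \<Longrightarrow> compact_dist (y (min (l v) u)) (y (min (l t) u)) < e/2"
      by (rule cadlag_compose_right[OF assms(2,3) t0 assms(4) e2]) (rule that)
    obtain q where q: "q \<in> \<rat>" "t < q" "q < t + min d1 d2"
      using Rats_dense_in_real[of t "t + min d1 d2"] d1 d2 by auto
    have "compact_dist (x (min t u)) (y (min (l t) u)) \<le> compact_dist (x (min q u)) (y (min (l q) u)) + e"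
    proof -
      have "q < t + d1" "q < t + d2" using q by auto
      then have "compact_dist (x (min q u)) (x (min t u)) < e/2" "compact_dist (y (min (l q) u)) (y (min (l t) u)) < e/2"
        using d1(2)[OF less_imp_le[OF q(2)]] d2(2)[OF less_imp_le[OF q(2)]] by blast+
      then show ?thesis
        using compact_dist_triangle[of "x (min t u)" "y (min (l t) u)" "x (min q u)"]
          compact_dist_triangle[of "x (min q u)" "y (min (l t) u)" "y (min (l q) u)"]
          compact_dist_commute[of "x (min t u)" "x (min q u)"] by linarith
    qed
    then have "ennreal (compact_dist (x (min t u)) (y (min (l t) u)))
       \<le> ennreal (compact_dist (x (min q u)) (y (min (l q) u)) + e)"
      by (intro ennreal_leI)
    also have "\<dots> = ennreal (compact_dist (x (min q u)) (y (min (l q) u))) + ennreal e"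
      using \<open>0 < e\<close> by simp
    also have "\<dots> \<le> ?S + ennreal e"
      using q t0 by (intro add_right_mono SUP_upper) auto
    finally show "ennreal (compact_dist (x (min t u)) (y (min (l t) u))) \<le> ?S + ennreal e" .
  qed
qed

lemma path_osc_measurable:
  assumes "cadlag x" "cadlag y" "l \<in> time_changes"
  shows "(\<lambda>u. path_osc x y l u * indicator {0..} u) \<in> borel_measurable borel"
proof -
  have m: "(\<lambda>u. psi (z (max 0 (f u)))) \<in> borel_measurable borel"
    if "cadlag z" "f \<in> borel_measurable borel" for z and f :: "real \<Rightarrow> real"
    using measurable_compose[OF that(2) measurable_compose[OF cadlag_measurable[OF that(1)] borel_measurable_psi]] .
  have *: "path_osc x y l u * indicator {0..} u =
     (SUP t \<in> \<rat> \<inter> {0..}. ennreal \<bar>psi (x (max 0 (min t u))) - psi (y (max 0 (min (l t) u)))\<bar>) * indicator {0..} u" for u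
  proof (cases "0 \<le> u")
    case True
    have "0 \<le> l t" if "0 \<le> t" for t using time_change_less(3)[OF assms(3) that that] .
    with True show ?thesis
      unfolding path_osc_rational[OF assms True] compact_dist_psi by (auto intro!: SUP_cong)
  qed simp
  have "countable (\<rat> \<inter> {0::real..})" by (rule countable_Int1) (rule countable_rat)
  moreover have "(\<lambda>u. ennreal \<bar>psi (x (max 0 (min t u))) - psi (y (max 0 (min (l t) u)))\<bar>) \<in> borel_measurable borel" for t
    using m[OF assms(1), of "\<lambda>u. min t u"] m[OF assms(2), of "\<lambda>u. min (l t) u"] by simp
  ultimately have "(\<lambda>u. SUP t \<in> \<rat> \<inter> {0..}. ennreal \<bar>psi (x (max 0 (min t u))) - psi (y (max 0 (min (l t) u)))\<bar>) \<in> borel_measurable borel"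
    by (rule borel_measurable_SUP)
  then show ?thesis
    unfolding * by (rule borel_measurable_times_ennreal) simp
qed

lemma skorokhod_dist_triangle:
  assumes "cadlag x" "cadlag y" "cadlag z"
  shows "skorokhod_dist x z \<le> skorokhod_dist x y + skorokhod_dist y z"
proof (rule field_le_epsilon)
  fix e :: real assume "0 < e"
  obtain l where l: "l \<in> time_changes" "change_cost x y l < ennreal (skorokhod_dist x y + e/2)"
    using skorokhod_dist_lessE[of x y "skorokhod_dist x y + e/2"] \<open>0 < e\<close> by auto
  obtain k where k: "k \<in> time_changes" "change_cost y z k < ennreal (skorokhod_dist y z + e/2)"
    using skorokhod_dist_lessE[of y z "skorokhod_dist y z + e/2"] \<open>0 < e\<close> by auto
  have m: "(\<lambda>u. ennreal (exp (- u)) * path_osc a b c u * indicator {0..} u) \<in> borel_measurable lborel"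
    if "cadlag a" "cadlag b" "c \<in> time_changes" for a b c
    unfolding mult.assoc measurable_lborel2
    by (rule borel_measurable_times_ennreal[OF _ path_osc_measurable[OF that]]) simp
  have "(\<integral>\<^sup>+ u\<in>{0..}. ennreal (exp (- u)) * path_osc x z (k \<circ> l) u \<partial>lborel)
      \<le> (\<integral>\<^sup>+ u. ennreal (exp (- u)) * path_osc x y l u * indicator {0..} u + ennreal (exp (- u)) * path_osc y z k u * indicator {0..} u \<partial>lborel)"
  proof (rule nn_integral_mono)
    fix u :: real
    have "ennreal (exp (- u)) * path_osc x z (k \<circ> l) u * indicator {0..} u
       \<le> ennreal (exp (- u)) * (path_osc x y l u + path_osc y z k u) * indicator {0..} u"
      using path_osc_comp[OF l(1)] by (intro mult_left_mono mult_right_mono) auto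
    then show "ennreal (exp (- u)) * path_osc x z (k \<circ> l) u * indicator {0..} u
       \<le> ennreal (exp (- u)) * path_osc x y l u * indicator {0..} u + ennreal (exp (- u)) * path_osc y z k u * indicator {0..} u"
      by (simp only: distrib_left distrib_right)
  qed
  also have "\<dots> = (\<integral>\<^sup>+ u\<in>{0..}. ennreal (exp (- u)) * path_osc x y l u \<partial>lborel) + (\<integral>\<^sup>+ u\<in>{0..}. ennreal (exp (- u)) * path_osc y z k u \<partial>lborel)"
    using assms l k by (intro nn_integral_add m) auto
  also have "\<dots> \<le> change_cost x y l + change_cost y z k"
    by (auto simp: change_cost_def intro!: add_mono)
  finally have *: "(\<integral>\<^sup>+ u\<in>{0..}. ennreal (exp (- u)) * path_osc x z (k \<circ> l) u \<partial>lborel) \<le> change_cost x y l + change_cost y z k" .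
  have "change_cost x z (k \<circ> l) \<le> change_cost x y l + change_cost y z k"
  proof -
    have "time_distortion (k \<circ> l) \<le> change_cost x y l + change_cost y z k"
      by (rule order_trans[OF time_distortion_comp[OF l(1) k(1)]]) (intro add_mono, simp_all add: change_cost_def)
    then show ?thesis using * by (simp add: change_cost_def[of x z])
  qed
  also have "\<dots> \<le> ennreal (skorokhod_dist x y + e/2) + ennreal (skorokhod_dist y z + e/2)"
    using l k by (intro add_mono) auto
  also have "\<dots> = ennreal (skorokhod_dist x y + e/2 + (skorokhod_dist y z + e/2))"
    using \<open>0 < e\<close> by (intro ennreal_plus[symmetric]) auto
  finally have "skorokhod_dist x z \<le> skorokhod_dist x y + e/2 + (skorokhod_dist y z + e/2)"
    using \<open>0 < e\<close> by (intro skorokhod_dist_leI[OF time_change_comp[OF l(1) k(1)]]) auto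
  then show "skorokhod_dist x z \<le> skorokhod_dist x y + skorokhod_dist y z + e" by simp
qed

text \<open>A time change of small cost moves \<open>t\<close> only slightly and puts
  \<open>x t\<close> close to \<open>y (l t)\<close>. The image \<open>l t\<close> may lie on either
  side of \<open>t\<close>: on the right \<open>y (l t)\<close> is near \<open>y t\<close>, on the
  left it is near the left limit.\<close>

lemma skorokhod_dist_0_left_limit:
  assumes "cadlag y" "skorokhod_dist x y = 0" "0 < t"
    and L: "\<And>e. 0 < e \<Longrightarrow> \<exists>d>0. \<forall>v. t - d < v \<and> v < t \<longrightarrow> compact_dist (y v) L < e"
  shows "x t = L \<or> x t = y t"
proof (rule ccontr)
  assume neq: "\<not> (x t = L \<or> x t = y t)"
  define e where "e = min (compact_dist (x t) L) (compact_dist (x t) (y t)) / 2"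
  have "0 < e" using neq by (auto simp: e_def compact_dist_psi inj_psi)
  have e2: "e + e \<le> compact_dist (x t) L" "e + e \<le> compact_dist (x t) (y t)"
    by (simp_all add: e_def)
  obtain d1 where d1: "0 < d1" "\<And>v. t \<le> v \<Longrightarrow> v < t + d1 \<Longrightarrow> compact_dist (y v) (y t) < e"
    using assms(3) by (rule_tac cadlag_right[OF assms(1) _ \<open>0 < e\<close>, of t]) auto
  obtain d2 where d2: "0 < d2" "\<And>v. t - d2 < v \<Longrightarrow> v < t \<Longrightarrow> compact_dist (y v) L < e"
    using L[OF \<open>0 < e\<close>] by auto
  define dd where "dd = min 1 (min t (min d1 d2))"
  have dd: "0 < dd" "dd \<le> 1" "dd \<le> t" "dd \<le> d1" "dd \<le> d2"
    using d1(1) d2(1) assms(3) by (auto simp: dd_def)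
  \<comment> \<open>Since \<open>l 0 = 0\<close>, the distortion bounds the logarithm of
    \<open>l t / t\<close>. Below \<open>c1\<close> it keeps this quotient within
    \<open>dd / (2 * t)\<close> of 1, hence \<open>l t\<close> within \<open>dd\<close> of
    \<open>t\<close>.\<close>
  define c1 where "c1 = min (ln (1 + dd / (2 * t))) (- ln (1 - dd / (2 * t)))"
  have r: "0 < dd / (2 * t)" "dd / (2 * t) < 1"
    using dd assms(3) by (auto simp: divide_simps)
  then have "0 < c1" by (auto simp: c1_def)
  define c where "c = min c1 (exp (- (t + 2)) * e)"
  have c: "0 < c" "c \<le> c1" "c \<le> exp (- (t + 2)) * e"
    using \<open>0 < c1\<close> \<open>0 < e\<close> by (auto simp: c_def)
  obtain l where l: "l \<in> time_changes" "change_cost x y l < ennreal c"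
    using skorokhod_dist_lessE[of x y c] assms(2) c(1) by auto
  have l0: "l 0 = 0" by (rule time_change_0[OF l(1)])
  have "0 < l t" using time_change_less(1)[OF l(1), of 0 t] assms(3) l0 by auto
  have "ennreal \<bar>ln ((l t - l 0) / (t - 0))\<bar> \<le> change_cost x y l"
    using time_distortion_ge[of 0 t l] assms(3) by (auto simp: change_cost_def max.coboundedI1)
  also have "\<dots> < ennreal c" by (rule l(2))
  finally have lnl: "\<bar>ln (l t / t)\<bar> < c"
    by (simp add: l0 ennreal_less_iff)
  have "ln (l t / t) < ln (1 + dd / (2 * t))"
    using lnl c(2) by (auto simp: c1_def)
  then have "l t / t < 1 + dd / (2 * t)"
    using r \<open>0 < l t\<close> assms(3) by (subst (asm) ln_less_cancel_iff) auto
  then have "l t / t * t < (1 + dd / (2 * t)) * t"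
    using assms(3) by (rule mult_strict_right_mono)
  then have up: "l t < t + dd"
    using assms(3) dd(1) by (simp add: distrib_right)
  have "ln (1 - dd / (2 * t)) < ln (l t / t)"
    using lnl c(2) by (auto simp: c1_def)
  then have "1 - dd / (2 * t) < l t / t"
    using r \<open>0 < l t\<close> assms(3) by (subst (asm) ln_less_cancel_iff) auto
  then have "(1 - dd / (2 * t)) * t < l t / t * t"
    using assms(3) by (rule mult_strict_right_mono)
  then have lo: "t - dd < l t"
    using assms(3) dd(1) by (simp add: left_diff_distrib)
  \<comment> \<open>Otherwise this unit interval alone would contribute at least
    \<open>exp (- (t + 2)) * e\<close> to the integral, which is not below \<open>c\<close>. The
    interval starts at \<open>t + 1\<close> so that truncation at \<open>u\<close> changes neither
    \<open>t\<close> nor \<open>l t\<close>, which is below \<open>t + dd\<close>.\<close>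
  have "\<exists>u\<in>{t+1..t+2}. path_osc x y l u < ennreal e"
  proof (rule ccontr)
    assume "\<not> ?thesis"
    then have *: "ennreal e \<le> path_osc x y l u" if "u \<in> {t+1..t+2}" for u
      using that by (auto simp: not_less)
    have "ennreal (exp (- (t + 2)) * e) = (\<integral>\<^sup>+u. ennreal (exp (- (t + 2)) * e) * indicator {t+1..t+2} u \<partial>lborel)"
      by (subst nn_integral_cmult_indicator) auto
    also have "\<dots> \<le> (\<integral>\<^sup>+ u\<in>{0..}. ennreal (exp (- u)) * path_osc x y l u \<partial>lborel)"
    proof (rule nn_integral_mono)
      fix u :: real
      show "ennreal (exp (- (t + 2)) * e) * indicator {t+1..t+2} u \<le> ennreal (exp (- u)) * path_osc x y l u * indicator {0..} u"
      proof (cases "u \<in> {t+1..t+2}")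
        case True
        then have "ennreal (exp (- (t + 2))) * ennreal e \<le> ennreal (exp (- u)) * path_osc x y l u"
          by (intro mult_mono * ennreal_leI) auto
        then show ?thesis
          using True assms(3) \<open>0 < e\<close> by (simp add: ennreal_mult)
      qed simp
    qed
    also have "\<dots> \<le> change_cost x y l" by (simp add: change_cost_def)
    also have "\<dots> < ennreal c" by (rule l(2))
    finally show False using c(1,3) by (simp add: ennreal_less_iff)
  qed
  then obtain u where u: "u \<in> {t+1..t+2}" "path_osc x y l u < ennreal e" by auto
  have "ennreal (compact_dist (x (min t u)) (y (min (l t) u))) < ennreal e"
    using path_osc_ge[of t x u y l] u(2) assms(3) by (auto intro: le_less_trans)
  moreover have "min t u = t" "min (l t) u = l t"
    using u(1) up dd(2) by auto
  ultimately have xl: "compact_dist (x t) (y (l t)) < e"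
    by (simp add: ennreal_less_iff)
  show False
  proof (cases "t \<le> l t")
    case True
    then have "compact_dist (y (l t)) (y t) < e" using up dd by (intro d1(2)) auto
    then show False using e2(2) xl compact_dist_triangle[of "x t" "y t" "y (l t)"] by linarith
  next
    case False
    then have "compact_dist (y (l t)) L < e" using lo dd by (intro d2(2)) auto
    then show False using e2(1) xl compact_dist_triangle[of "x t" L "y (l t)"] by linarith
  qed
qed

text \<open>The left limit has to be excluded as a value of \<open>x\<close>. At a time
  \<open>v\<close> shortly after \<open>t\<close> it is itself close to \<open>y t\<close>, being
  approached along times \<open>w\<close> between \<open>t\<close> and \<open>v\<close>; so both
  alternatives at \<open>v\<close> put \<open>x v\<close>, and with it \<open>x t\<close>, close to
  \<open>y t\<close>.\<close>

lemma skorokhod_dist_0_imp_eq: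
  assumes "cadlag x" "cadlag y" "skorokhod_dist x y = 0" "0 \<le> t"
  shows "x t = y t"
proof (rule ccontr)
  assume "x t \<noteq> y t"
  define e where "e = compact_dist (x t) (y t) / 3"
  have "0 < e" using \<open>x t \<noteq> y t\<close> by (simp add: e_def compact_dist_psi inj_psi)
  obtain d1 where d1: "0 < d1" "\<And>v. t \<le> v \<Longrightarrow> v < t + d1 \<Longrightarrow> compact_dist (x v) (x t) < e"
    by (rule cadlag_right[OF assms(1,4) \<open>0 < e\<close>]) (rule that)
  obtain d2 where d2: "0 < d2" "\<And>v. t \<le> v \<Longrightarrow> v < t + d2 \<Longrightarrow> compact_dist (y v) (y t) < e"
    by (rule cadlag_right[OF assms(2,4) \<open>0 < e\<close>]) (rule that)
  define v where "v = t + min d1 d2 / 2"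
  have v: "t < v" "v < t + d1" "v < t + d2" "0 < v"
    using d1(1) d2(1) assms(4) by (auto simp: v_def min_def)
  obtain L where L: "\<And>e. 0 < e \<Longrightarrow> \<exists>d>0. \<forall>w. v - d < w \<and> w < v \<longrightarrow> compact_dist (y w) L < e"
    by (rule cadlag_left[OF assms(2) v(4)]) (rule that)
  obtain d where d: "0 < d" "\<And>w. v - d < w \<Longrightarrow> w < v \<Longrightarrow> compact_dist (y w) L < e"
    using L[OF \<open>0 < e\<close>] by auto
  define w where "w = max ((t + v) / 2) (v - d / 2)"
  have w: "t \<le> w" "w < v" "v - d < w" using v(1) d(1) by (auto simp: w_def max_def)
  have a: "compact_dist (x v) (x t) < e" by (rule d1(2)) (use v in auto)
  have b: "compact_dist (y v) (y t) < e" by (rule d2(2)) (use v in auto)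
  have b': "compact_dist (y w) (y t) < e" by (rule d2(2)) (use v w in auto)
  have b'': "compact_dist (y w) L < e" by (rule d(2)) (use w in auto)
  have "compact_dist (x v) (y t) < 2 * e"
    using skorokhod_dist_0_left_limit[OF assms(2,3) v(4) L]
  proof
    assume "x v = L"
    then show ?thesis
      using b' b'' compact_dist_triangle[of L "y t" "y w"] compact_dist_commute[of L] by simp
  next
    assume "x v = y v" then show ?thesis using b \<open>0 < e\<close> by simp
  qed
  then have "compact_dist (x t) (y t) < 3 * e"
    using a compact_dist_triangle[of "x t" "y t" "x v"] compact_dist_commute[of "x t" "x v"] by linarith
  then show False by (simp add: e_def)
qed

lemma Metric_space_skorokhod: "Metric_space skorokhod_space skorokhod_dist"
proof
  fix x y :: "real \<Rightarrow> ennreal" assume xy: "x \<in> skorokhod_space" "y \<in> skorokhod_space"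
  show "skorokhod_dist x y = 0 \<longleftrightarrow> x = y"
  proof
    assume "skorokhod_dist x y = 0"
    then have "x t = y t" if "0 \<le> t" for t
      using xy skorokhod_dist_0_imp_eq[of x y t] that by (auto simp: skorokhod_space_def)
    then show "x = y"
      using xy by (intro extensionalityI[of x "{0..}" y]) (auto simp: skorokhod_space_def)
  qed simp
qed (auto simp: skorokhod_dist_commute skorokhod_space_def intro: skorokhod_dist_triangle)

section \<open>The topology of the path space, step paths and distance estimates\<close>

lemma topspace_skorokhod: "topspace skorokhod_topology = skorokhod_space"
  unfolding skorokhod_topology_def
  by (rule Metric_space.topspace_mtopology[OF Metric_space_skorokhod])

lemma openin_skorokhod:
  "openin skorokhod_topology U \<longleftrightarrow> U \<subseteq> skorokhod_space \<and>
     (\<forall>x\<in>U. \<exists>r>0. \<forall>y\<in>skorokhod_space. skorokhod_dist x y < r \<longrightarrow> y \<in> U)"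
proof -
  have "Metric_space.mball skorokhod_space skorokhod_dist x r \<subseteq> U \<longleftrightarrow>
      (\<forall>y\<in>skorokhod_space. skorokhod_dist x y < r \<longrightarrow> y \<in> U)" if "x \<in> skorokhod_space" for x r
    using that unfolding Metric_space.mball_def[OF Metric_space_skorokhod] by blast
  then show ?thesis
    unfolding skorokhod_topology_def Metric_space.openin_mtopology[OF Metric_space_skorokhod]
    by (intro conj_cong refl) (simp only: Ball_def subset_iff cong: imp_cong)
qed

text \<open>The rate \<open>m\<close> is real because the construction serves both the rescaled
  walk, with rate \<open>n^2\<close>, and paths sampled with an arbitrary mesh
  \<open>1 / m\<close>.\<close>

definition step_path :: "real \<Rightarrow> (nat \<Rightarrow> ennreal) \<Rightarrow> real \<Rightarrow> ennreal" where
  "step_path m y = restrict (\<lambda>t. y (nat \<lfloor>m * t\<rfloor>)) {0..}"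

lemma step_path_in_skorokhod_space:
  assumes "0 < m"
  shows "step_path m y \<in> skorokhod_space"
proof -
  have "(step_path m y \<longlongrightarrow> step_path m y t) (at_right t)" if "0 \<le> t" for t
  proof (rule tendsto_eventually)
    have "t < (\<lfloor>m * t\<rfloor> + 1) / m"
      using assms by (simp add: field_simps) linarith
    then show "\<forall>\<^sub>F v in at_right t. step_path m y v = step_path m y t"
      unfolding eventually_at_right_field
    proof (intro exI[of _ "(\<lfloor>m * t\<rfloor> + 1) / m"] conjI allI impI)
      fix v assume v: "t < v" "v < (\<lfloor>m * t\<rfloor> + 1) / m"
      have "m * v < \<lfloor>m * t\<rfloor> + 1" using v(2) assms by (simp add: field_simps)
      moreover have "m * t < m * v" using v(1) assms by simp
      ultimately have "\<lfloor>m * v\<rfloor> = \<lfloor>m * t\<rfloor>" by linarith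
      then show "step_path m y v = step_path m y t" using v(1) that by (simp add: step_path_def)
    qed
  qed
  moreover have "\<exists>l. (step_path m y \<longlongrightarrow> l) (at_left t)" if "0 < t" for t
  proof (rule exI, rule tendsto_eventually)
    \<comment> \<open>At a grid time the left limit is the previous value; the ceiling minus 1
      covers this case together with the times between grid points.\<close>
    have "(\<lceil>m * t\<rceil> - 1) / m < t"
      using assms by (simp add: field_simps) linarith
    then have "max 0 ((\<lceil>m * t\<rceil> - 1) / m) < t" using that by simp
    then show "\<forall>\<^sub>F v in at_left t. step_path m y v = y (nat (\<lceil>m * t\<rceil> - 1))"
      unfolding eventually_at_left_field
    proof (intro exI[of _ "max 0 ((\<lceil>m * t\<rceil> - 1) / m)"] conjI allI impI)
      fix v assume v: "max 0 ((\<lceil>m * t\<rceil> - 1) / m) < v" "v < t"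
      have "\<lceil>m * t\<rceil> - 1 < m * v" using v(1) assms by (simp add: field_simps)
      moreover have "m * v < m * t" using v(2) assms by simp
      ultimately have "\<lfloor>m * v\<rfloor> = \<lceil>m * t\<rceil> - 1" by linarith
      then show "step_path m y v = y (nat (\<lceil>m * t\<rceil> - 1))" using v(1) by (simp add: step_path_def)
    qed
  qed
  ultimately show ?thesis
    by (auto simp: skorokhod_space_def cadlag_def step_path_def)
qed

lemma nn_integral_exp_tail:
  "(\<integral>\<^sup>+ u\<in>{T..}. ennreal (exp (- u)) \<partial>lborel) = ennreal (exp (- T))"
proof -
  have "((\<lambda>u::real. - exp (- u)) \<longlongrightarrow> - 0) at_top"
    by (intro tendsto_minus filterlim_compose[OF exp_at_bot filterlim_uminus_at_bot_at_top])
  then have "(\<integral>\<^sup>+ u\<in>{T..}. ennreal (exp (- u)) \<partial>lborel) = ennreal (0 - - exp (- T))"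
    by (intro nn_integral_FTC_atLeast) (auto intro!: derivative_eq_intros)
  then show ?thesis by simp
qed

text \<open>The oscillation and the weight are at most 1 on \<open>[0,\<infinity>)\<close>, so
  truncation times in \<open>bad\<close> cost no more than their Lebesgue measure and those after
  \<open>T\<close> no more than the exponential tail. A uniform estimate is needed only at the
  remaining times.\<close>

lemma nn_integral_path_osc_le:
  assumes "0 \<le> e" "bad \<in> sets borel" "emeasure lborel bad \<le> ennreal b" "0 \<le> b"
    and "\<And>u. 0 \<le> u \<Longrightarrow> u < T \<Longrightarrow> u \<notin> bad \<Longrightarrow> path_osc x y l u \<le> ennreal e"
  shows "(\<integral>\<^sup>+ u\<in>{0..}. ennreal (exp (- u)) * path_osc x y l u \<partial>lborel) \<le> ennreal (e + b + exp (- T))"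
proof -
  have "(\<integral>\<^sup>+ u\<in>{0..}. ennreal (exp (- u)) * path_osc x y l u \<partial>lborel)
     \<le> (\<integral>\<^sup>+ u. ennreal e * (ennreal (exp (- u)) * indicator {0..} u) + indicator bad u + ennreal (exp (- u)) * indicator {T..} u \<partial>lborel)"
  proof (rule nn_integral_mono)
    fix u :: real
    have E: "ennreal (exp (- u)) * path_osc x y l u \<le> ennreal (exp (- u))"
      by (intro mult_left_le path_osc_le_1) simp
    consider "u < 0" | "0 \<le> u" "u < T" "u \<notin> bad" | "0 \<le> u" "u \<in> bad" | "T \<le> u" "0 \<le> u"
      by linarith
    then show "ennreal (exp (- u)) * path_osc x y l u * indicator {0..} u \<le> 
       ennreal e * (ennreal (exp (- u)) * indicator {0..} u) + indicator bad u + ennreal (exp (- u)) * indicator {T..} u"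
    proof cases
      case 2
      then show ?thesis
        using mult_left_mono[OF assms(5)[OF 2], of "ennreal (exp (- u))"] by (simp add: mult.commute)
    next
      case 3
      have "ennreal (exp (- u)) * path_osc x y l u \<le> 1"
        using 3(1) by (rule_tac order_trans[OF E]) simp
      moreover have "1 \<le> ennreal e * (ennreal (exp (- u)) * indicator {0..} u) + 1 + ennreal (exp (- u)) * indicator {T..} u"
        by (intro add_increasing2 add_increasing) auto
      ultimately show ?thesis using 3 by (simp add: order_trans)
    next
      case 4
      have "ennreal (exp (- u)) * path_osc x y l u \<le> ennreal e * ennreal (exp (- u)) + indicator bad u + ennreal (exp (- u))"
        by (rule add_increasing[OF _ E]) simp
      then show ?thesis using 4 by simp
    qed simp
  qed
  also have "\<dots> = ennreal e * 1 + emeasure lborel bad + ennreal (exp (- T))"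
    using assms(2) nn_integral_exp nn_integral_exp_tail[of T]
    by (simp add: nn_integral_add nn_integral_cmult)
  also have "\<dots> \<le> ennreal e + ennreal b + ennreal (exp (- T))"
    using assms(3) by (intro add_mono) auto
  also have "\<dots> = ennreal (e + b + exp (- T))"
    using assms by simp
  finally show ?thesis .
qed

text \<open>The first \<open>I + 1\<close> values determine a step path before time
  \<open>(I + 1) / m\<close>, and later truncation times enter only with the exponential tail. Thus
  a Lipschitz functional of a step path depends, up to a small error, on finitely many
  values.\<close>

lemma skorokhod_dist_step_paths:
  assumes "0 < m" "0 \<le> c" and "\<And>i. i \<le> I \<Longrightarrow> compact_dist (y i) (z i) \<le> c"
  shows "skorokhod_dist (step_path m y) (step_path m z) \<le> c + exp (- ((real I + 1) / m))"
proof (rule skorokhod_dist_leI[OF time_change_id])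
  have "path_osc (step_path m y) (step_path m z) (\<lambda>t. t) u \<le> ennreal c"
    if u: "0 \<le> u" "u < (real I + 1) / m" for u
    unfolding path_osc_def
  proof (intro SUP_least ennreal_leI)
    fix t :: real assume t: "t \<in> {0..}"
    have "m * min t u \<le> m * u" using assms(1) by simp
    also have "\<dots> < real I + 1" using u(2) assms(1) by (simp add: field_simps)
    finally have "nat \<lfloor>m * min t u\<rfloor> \<le> I" by linarith
    then show "compact_dist (step_path m y (min t u)) (step_path m z (min t u)) \<le> c"
      using t u(1) by (simp add: step_path_def assms(3))
  qed
  then have "(\<integral>\<^sup>+ w\<in>{0..}. ennreal (exp (- w)) * path_osc (step_path m y) (step_path m z) (\<lambda>t. t) w \<partial>lborel)
     \<le> ennreal (c + 0 + exp (- ((real I + 1) / m)))"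
    using assms(2) by (intro nn_integral_path_osc_le[where bad = "{}"]) auto
  then show "change_cost (step_path m y) (step_path m z) (\<lambda>t. t) \<le> ennreal (c + exp (- ((real I + 1) / m)))"
    by (simp add: change_cost_def)
qed (use assms in simp)

section \<open>Sampling a path on a grid\<close>

text \<open>
  The time change is \<open>t + g t\<close>, where \<open>g\<close> is the McShane extension, with Lipschitz constant \<open>\<eta>\<close>, of the
  rounding error \<open>s \<mapsto> \<lceil>m s\<rceil> / m - s\<close> on \<open>S\<close>; so every \<open>s \<in> S\<close> moves to the next grid point.  Cutting the paths
  at a time \<open>u\<close> only does harm if \<open>u\<close> lies between some \<open>s \<in> S\<close> and its image.
\<close>

lemma skorokhod_dist_sampled_le:
  assumes m: "0 < m" and S: "finite S" "0 \<in> S" "S \<subseteq> {0..}"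
    and sep: "\<And>s s'. s \<in> S \<Longrightarrow> s' \<in> S \<Longrightarrow> s \<noteq> s' \<Longrightarrow> d \<le> \<bar>s - s'\<bar>"
    and eta: "0 < \<eta>" "\<eta> \<le> 1/2" "1 / m \<le> \<eta> * d" and e: "0 \<le> e"
    and osc: "\<And>t t'. 0 \<le> t \<Longrightarrow> t < t' \<Longrightarrow> t' < T \<Longrightarrow> S \<inter> {t<..t'} = {} \<Longrightarrow> compact_dist (x t) (x t') \<le> e"
  shows "skorokhod_dist x (step_path m (\<lambda>i. x (real i / m))) \<le> 2 * \<eta> + e + card S / m + exp (- T)"
proof -
  define c where "c s = real_of_int \<lceil>m * s\<rceil> / m" for s
  define g where "g t = Min ((\<lambda>s. (c s - s) + \<eta> * \<bar>t - s\<bar>) ` S)" for t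
  define l where "l t = t + g t" for t
  define w where "w v = real_of_int \<lfloor>m * v\<rfloor> / m" for v
  have c_ge: "s \<le> c s" for s
    using m by (simp add: c_def pos_le_divide_eq mult.commute)
  have c_le: "c s < s + 1 / m" for s
  proof -
    have "real_of_int \<lceil>m * s\<rceil> < m * s + 1" by linarith
    then have "real_of_int \<lceil>m * s\<rceil> / m < (m * s + 1) / m" using m by (rule divide_strict_right_mono)
    then show ?thesis using m by (simp add: c_def add_divide_distrib)
  qed
  have w_le: "w v \<le> v" for v
    using m by (simp add: w_def pos_divide_le_eq mult.commute)
  \<comment> \<open>\<open>c\<close> rounds up to the grid and \<open>w\<close> rounds down.
    Together \<open>G1\<close> and \<open>G2\<close> say that a rounded-down time has passed
    \<open>s\<close> exactly when the time itself has passed the image \<open>c s\<close>.\<close>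
  have G1: "c s \<le> w v" if "s \<le> w v" for s v
  proof -
    have "m * s \<le> \<lfloor>m * v\<rfloor>" using that m by (simp add: w_def pos_le_divide_eq mult.commute)
    then have "\<lceil>m * s\<rceil> \<le> \<lfloor>m * v\<rfloor>" by linarith
    then show ?thesis using m by (simp add: c_def w_def divide_right_mono)
  qed
  have G2: "s \<le> w v" if "c s \<le> v" for s v
  proof -
    have "real_of_int \<lceil>m * s\<rceil> \<le> m * v" using that m by (simp add: c_def pos_divide_le_eq mult.commute)
    then have "\<lceil>m * s\<rceil> \<le> \<lfloor>m * v\<rfloor>" by (simp add: le_floor_iff)
    then have "m * s \<le> \<lfloor>m * v\<rfloor>" by linarith
    then show ?thesis using m by (simp add: w_def pos_le_divide_eq mult.commute)
  qed
  have Sne: "S \<noteq> {}" using S by auto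
  have g_s: "g s = c s - s" if "s \<in> S" for s
    unfolding g_def
  proof (rule Min_eqI)
    fix y assume "y \<in> (\<lambda>s'. (c s' - s') + \<eta> * \<bar>s - s'\<bar>) ` S"
    then obtain s' where s': "s' \<in> S" "y = (c s' - s') + \<eta> * \<bar>s - s'\<bar>" by auto
    show "c s - s \<le> y"
    proof (cases "s = s'")
      case False
      \<comment> \<open>The term of any other point of \<open>S\<close> is at least
        \<open>\<eta> * d\<close>, which is at least \<open>1 / m\<close> and so exceeds the
        rounding error at \<open>s\<close>: the minimum is attained at \<open>s\<close>
        itself.\<close>
      then have "d \<le> \<bar>s - s'\<bar>" using sep that s' by auto
      then have "\<eta> * d \<le> \<eta> * \<bar>s - s'\<bar>" using eta by (intro mult_left_mono) auto
      then show ?thesis using s' c_le[of s] c_ge[of s'] eta(3) by linarith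
    qed (use s' in simp)
  next
    show "c s - s \<in> (\<lambda>s'. (c s' - s') + \<eta> * \<bar>s - s'\<bar>) ` S"
      using that by (intro image_eqI[of _ _ s]) auto
  qed (use S in auto)
  have g_lip: "g t \<le> g t' + \<eta> * \<bar>t - t'\<bar>" for t t'
  proof -
    have "g t' \<in> (\<lambda>s. (c s - s) + \<eta> * \<bar>t' - s\<bar>) ` S"
      unfolding g_def using S Sne by (intro Min_in) auto
    then obtain s where s: "s \<in> S" "g t' = (c s - s) + \<eta> * \<bar>t' - s\<bar>" by auto
    have "g t \<le> (c s - s) + \<eta> * \<bar>t - s\<bar>"
      unfolding g_def using S s by (intro Min_le) auto
    also have "\<dots> \<le> (c s - s) + (\<eta> * \<bar>t' - s\<bar> + \<eta> * \<bar>t - t'\<bar>)"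
      unfolding distrib_left[symmetric] using eta by (intro add_left_mono mult_left_mono) auto
    finally show ?thesis using s by simp
  qed
  have slope: "(1 - \<eta>) * (t' - t) \<le> l t' - l t" "l t' - l t \<le> (1 + \<eta>) * (t' - t)" if "t \<le> t'" for t t'
    using g_lip[of t t'] g_lip[of t' t] that by (auto simp: l_def algebra_simps abs_if split: if_splits)
  have less: "l t < l t'" if "t < t'" for t t'
  proof -
    have "0 < (1 - \<eta>) * (t' - t)" using that eta by simp
    then show ?thesis using slope[of t t'] that by simp
  qed
  have "l 0 = 0"
    using g_s[OF S(2)] by (simp add: l_def c_def)
  have l_s: "l s = c s" if "s \<in> S" for s
    using g_s[OF that] by (simp add: l_def)
  have contl: "continuous_on {0..b} l" for b
  proof (rule lipschitz_on_continuous_on[of "1 + \<eta>"], rule lipschitz_onI)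
    fix t t' :: real
    show "dist (l t) (l t') \<le> (1 + \<eta>) * dist t t'"
      using slope(2)[of t t'] slope(2)[of t' t] less[of t t'] less[of t' t]
      by (cases t t' rule: linorder_cases) (auto simp: dist_real_def abs_if)
  qed (use eta in simp)
  have l_tc: "l \<in> time_changes"
    unfolding time_changes_def
  proof (intro CollectI conjI strict_mono_onI equalityI subsetI)
    fix s assume "s \<in> {0::real..}"
    \<comment> \<open>The slopes of \<open>l\<close> are at least
      \<open>1 - \<eta> \<ge> 1/2\<close>, so \<open>s\<close> is reached before time
      \<open>2 * s\<close> and the intermediate value theorem gives surjectivity.\<close>
    then have "s \<le> l (2 * s)"
      using slope(1)[of 0 "2 * s"] \<open>l 0 = 0\<close> eta mult_right_mono[of "1/2" "1 - \<eta>" "2 * s"] by auto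
    then obtain t where "0 \<le> t" "t \<le> 2 * s" "l t = s"
      using IVT'[of l 0 s "2 * s"] contl \<open>l 0 = 0\<close> \<open>s \<in> {0..}\<close> by auto
    then show "s \<in> l ` {0..}" by auto
  next
    fix s assume "s \<in> l ` {0..}"
    then obtain t where "0 \<le> t" "s = l t" by auto
    then show "s \<in> {0..}" using less[of 0 t] \<open>l 0 = 0\<close> by (cases "t = 0") auto
  qed (use less in auto)
  define bad where "bad = (\<Union>s\<in>S. {s..<c s})"
  \<comment> \<open>All slopes lie between \<open>1 - \<eta>\<close> and \<open>1 + \<eta>\<close>;
    the factor 2 is due to the lower one, whose reciprocal is at most \<open>1 + 2 * \<eta>\<close>
    when \<open>\<eta> \<le> 1/2\<close>.\<close>
  have dist_l: "time_distortion l \<le> ennreal (2 * \<eta>)"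
  proof (intro time_distortion_le ennreal_leI)
    fix s t :: real assume st: "0 \<le> t" "t < s"
    define q where "q = (l s - l t) / (s - t)"
    have q: "1 - \<eta> \<le> q" "q \<le> 1 + \<eta>"
      using slope[of t s] st by (auto simp: q_def pos_le_divide_eq pos_divide_le_eq)
    have "0 < q" using q eta by linarith
    have "ln q \<le> q - 1" using \<open>0 < q\<close> by (rule ln_le_minus_one)
    moreover have "ln (1 / q) \<le> 1 / q - 1" using \<open>0 < q\<close> by (intro ln_le_minus_one) simp
    moreover have "1 / q \<le> 1 + 2 * \<eta>"
    proof -
      have "1 \<le> (1 + 2 * \<eta>) * (1 - \<eta>)"
        using eta mult_right_mono[of \<eta> "1/2" \<eta>] by (simp add: algebra_simps)
      also have "\<dots> \<le> (1 + 2 * \<eta>) * q" using q eta by (intro mult_left_mono) auto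
      finally show ?thesis using \<open>0 < q\<close> by (simp add: pos_divide_le_eq)
    qed
    ultimately show "\<bar>ln ((l s - l t) / (s - t))\<bar> \<le> 2 * \<eta>"
      using q eta \<open>0 < q\<close> unfolding q_def[symmetric] by (simp add: ln_div abs_if)
  qed
  have "emeasure lborel bad \<le> (\<Sum>s\<in>S. emeasure lborel {s..<c s})"
    unfolding bad_def using S by (intro emeasure_subadditive_finite) auto
  also have "\<dots> \<le> (\<Sum>s\<in>S. ennreal (1 / m))"
    using c_ge c_le by (intro sum_mono) (auto intro!: ennreal_leI simp: less_imp_le algebra_simps)
  also have "\<dots> = ennreal (card S / m)"
    using m by (simp add: ennreal_of_nat_eq_real_of_nat flip: ennreal_mult)
  finally have bad: "emeasure lborel bad \<le> ennreal (card S / m)" .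
  have "path_osc x (step_path m (\<lambda>i. x (real i / m))) l u \<le> ennreal e" if u: "0 \<le> u" "u < T" "u \<notin> bad" for u
    unfolding path_osc_def
  proof (intro SUP_least ennreal_leI)
    fix t :: real assume "t \<in> {0..}"
    then have t: "0 \<le> t" "0 \<le> l t" using time_change_less(3)[OF l_tc] by auto
    define a b where "a = min t u" and "b = w (min (l t) u)"
    have b0: "0 \<le> b" using t u m by (simp add: b_def w_def)
    have "step_path m (\<lambda>i. x (real i / m)) (min (l t) u) = x b"
      using t u m by (simp add: step_path_def b_def w_def)
    \<comment> \<open>No point \<open>s\<close> of \<open>S\<close> separates the truncated time
      \<open>a\<close> from the sampled time \<open>b\<close>. If \<open>a < s \<le> b\<close>, then
      \<open>t < s\<close>, although \<open>l t\<close> has already passed \<open>c s\<close>. If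
      \<open>b < s \<le> a\<close>, then \<open>u\<close> has passed \<open>s\<close> and, not being
      in \<open>bad\<close>, also \<open>c s\<close>, so that \<open>b\<close> has passed
      \<open>s\<close>.\<close>
    moreover have "compact_dist (x a) (x b) \<le> e"
    proof -
      have "S \<inter> {a<..b} = {}"
      proof (rule ccontr)
        assume "S \<inter> {a<..b} \<noteq> {}"
        then obtain s where s: "s \<in> S" "a < s" "s \<le> b" by auto
        have "b \<le> u" "b \<le> l t" using w_le[of "min (l t) u"] by (auto simp: b_def)
        then have "t < s" using s by (auto simp: a_def min_def split: if_splits)
        then have "l t < c s" using less l_s s by metis
        moreover have "c s \<le> b" using G1 s by (simp add: b_def)
        ultimately show False using \<open>b \<le> l t\<close> by simp
      qed
      moreover have "S \<inter> {b<..a} = {}"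
      proof (rule ccontr)
        assume "S \<inter> {b<..a} \<noteq> {}"
        then obtain s where s: "s \<in> S" "b < s" "s \<le> t" "s \<le> u" by (auto simp: a_def)
        have "c s \<le> l t" using less[of s t] s l_s[of s] by (cases "s = t") auto
        moreover have "c s \<le> u" using s u(3) by (auto simp: bad_def)
        ultimately have "s \<le> b" unfolding b_def by (intro G2) simp
        then show False using s by simp
      qed
      moreover have "a < T" "b < T" using u w_le[of "min (l t) u"] by (auto simp: a_def b_def)
      ultimately show ?thesis
        using osc[of a b] osc[of b a] t u b0 e compact_dist_commute[of "x a" "x b"]
        by (cases a b rule: linorder_cases) (auto simp: a_def)
    qed
    ultimately show "compact_dist (x (min t u)) (step_path m (\<lambda>i. x (real i / m)) (min (l t) u)) \<le> e"
      by (simp add: a_def)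
  qed
  then have "(\<integral>\<^sup>+ u\<in>{0..}. ennreal (exp (- u)) * path_osc x (step_path m (\<lambda>i. x (real i / m))) l u \<partial>lborel)
      \<le> ennreal (e + card S / m + exp (- T))"
    using S m e by (intro nn_integral_path_osc_le[where bad = bad] bad) (auto simp: bad_def)
  also have "\<dots> \<le> ennreal (2 * \<eta> + e + card S / m + exp (- T))"
    using eta by (intro ennreal_leI) auto
  finally have "change_cost x (step_path m (\<lambda>i. x (real i / m))) l \<le> ennreal (2 * \<eta> + e + card S / m + exp (- T))"
    unfolding change_cost_def using dist_l e m by (auto intro!: order_trans[OF dist_l] ennreal_leI add_nonneg_nonneg)
  then show ?thesis
    using eta e m by (intro skorokhod_dist_leI[OF l_tc]) (auto intro!: add_nonneg_nonneg)
qed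

text \<open>Bisection: the property passes to concatenated intervals, with their common endpoint
  added to \<open>S\<close>, and holds near every \<open>v\<close> with \<open>S = {v}\<close>,
  where the one-sided limits control either side.\<close>

lemma cadlag_partition:
  assumes "cadlag x" "0 < e" "0 \<le> T"
  obtains S where "finite S" "0 \<in> S" "S \<subseteq> {0..}"
    "\<And>t t'. 0 \<le> t \<Longrightarrow> t < t' \<Longrightarrow> t' < T \<Longrightarrow> S \<inter> {t<..t'} = {} \<Longrightarrow> compact_dist (x t) (x t') \<le> e"
proof -
  define P where "P a b \<longleftrightarrow> (\<exists>S. finite S \<and> (\<forall>t t'. 0 \<le> t \<longrightarrow> a \<le> t \<longrightarrow> t < t' \<longrightarrow> t' < b \<longrightarrow>
      S \<inter> {t<..t'} = {} \<longrightarrow> compact_dist (x t) (x t') \<le> e))" for a b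
  have "P 0 T"
  proof (rule Bolzano[OF assms(3)])
    fix a b c :: real assume "P a b" "P b c"
    then obtain S1 S2 where S: "finite S1" "finite S2"
      "\<And>t t'. 0 \<le> t \<Longrightarrow> a \<le> t \<Longrightarrow> t < t' \<Longrightarrow> t' < b \<Longrightarrow> S1 \<inter> {t<..t'} = {} \<Longrightarrow> compact_dist (x t) (x t') \<le> e"
      "\<And>t t'. 0 \<le> t \<Longrightarrow> b \<le> t \<Longrightarrow> t < t' \<Longrightarrow> t' < c \<Longrightarrow> S2 \<inter> {t<..t'} = {} \<Longrightarrow> compact_dist (x t) (x t') \<le> e"
      unfolding P_def by metis
    show "P a c"
      unfolding P_def
    proof (intro exI[of _ "insert b (S1 \<union> S2)"] conjI allI impI)
      fix t t' assume t: "0 \<le> t" "a \<le> t" "t < t'" "t' < c" "insert b (S1 \<union> S2) \<inter> {t<..t'} = {}"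
      then have "S1 \<inter> {t<..t'} = {}" "S2 \<inter> {t<..t'} = {}" "t' < b \<or> b \<le> t" by auto
      then show "compact_dist (x t) (x t') \<le> e"
        using S(3)[of t t'] S(4)[of t t'] t by auto
    qed (use S in auto)
  next
    fix v :: real assume v: "0 \<le> v" "v \<le> T"
    have e2: "0 < e / 2" using assms by simp
    obtain d1 where d1: "0 < d1" "\<And>w. v \<le> w \<Longrightarrow> w < v + d1 \<Longrightarrow> compact_dist (x w) (x v) < e / 2"
      by (rule cadlag_right[OF assms(1) v(1) e2]) (rule that)
    obtain L d2 where d2: "0 < d2" "\<And>w. 0 \<le> w \<Longrightarrow> v - d2 < w \<Longrightarrow> w < v \<Longrightarrow> compact_dist (x w) L < e / 2"
    proof (cases "v = 0")
      case True
      then show ?thesis using that[of 1] by auto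
    next
      case False
      then have "0 < v" using v by simp
      obtain L where L: "\<And>e. 0 < e \<Longrightarrow> \<exists>d>0. \<forall>w. v - d < w \<and> w < v \<longrightarrow> compact_dist (x w) L < e"
        by (rule cadlag_left[OF assms(1) \<open>0 < v\<close>]) (rule that)
      then show ?thesis using that L[OF e2] by blast
    qed
    show "\<exists>d>0. \<forall>a b. a \<le> v \<and> v \<le> b \<and> b - a < d \<longrightarrow> P a b"
    proof (intro exI[of _ "min d1 d2"] conjI allI impI)
      fix a b assume ab: "a \<le> v \<and> v \<le> b \<and> b - a < min d1 d2"
      show "P a b"
        unfolding P_def
      proof (intro exI[of _ "{v}"] conjI allI impI)
        fix t t' assume t: "0 \<le> t" "a \<le> t" "t < t'" "t' < b" "{v} \<inter> {t<..t'} = {}"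
        \<comment> \<open>The time \<open>v\<close> itself belongs to the right-hand side, in
          accordance with right-continuity and with the half-open interval in the hypothesis on
          \<open>S\<close>.\<close>
        then consider "v \<le> t" | "t' < v" by force
        then show "compact_dist (x t) (x t') \<le> e"
        proof cases
          case 1
          then have "compact_dist (x t) (x v) < e / 2" "compact_dist (x t') (x v) < e / 2"
            using t ab by (auto intro!: d1(2) simp del: less_divide_eq_numeral1)
          then show ?thesis
            using compact_dist_triangle[of "x t" "x t'" "x v"] compact_dist_commute[of "x v" "x t'"] by simp
        next
          case 2
          then have "compact_dist (x t) L < e / 2" "compact_dist (x t') L < e / 2"
            using t ab by (auto intro!: d2(2) simp del: less_divide_eq_numeral1)
          then show ?thesis
            using compact_dist_triangle[of "x t" "x t'" L] compact_dist_commute[of L "x t'"] by simp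
        qed
      qed simp
    qed (use d1 d2 in auto)
  qed
  then obtain S where S: "finite S"
    "\<And>t t'. 0 \<le> t \<Longrightarrow> t < t' \<Longrightarrow> t' < T \<Longrightarrow> S \<inter> {t<..t'} = {} \<Longrightarrow> compact_dist (x t) (x t') \<le> e"
    unfolding P_def by auto
  show ?thesis
  proof (rule that[of "insert 0 (S \<inter> {0..})"])
    fix t t' :: real assume t: "0 \<le> t" "t < t'" "t' < T" "insert 0 (S \<inter> {0..}) \<inter> {t<..t'} = {}"
    then have "S \<inter> {t<..t'} = {}" by force
    then show "compact_dist (x t) (x t') \<le> e" using S(2) t by blast
  qed (use S in auto)
qed

lemma finite_set_separated:
  fixes S :: "real set"
  assumes "finite S"
  obtains d where "0 < d" "\<And>s s'. s \<in> S \<Longrightarrow> s' \<in> S \<Longrightarrow> s \<noteq> s' \<Longrightarrow> d \<le> \<bar>s - s'\<bar>"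
proof -
  define D where "D = insert 1 ((\<lambda>(s, s'). \<bar>s - s'\<bar>) ` {(s, s'). s \<in> S \<and> s' \<in> S \<and> s \<noteq> s'})"
  have "{(s, s'). s \<in> S \<and> s' \<in> S \<and> s \<noteq> s'} \<subseteq> S \<times> S" by auto
  then have "finite {(s, s'). s \<in> S \<and> s' \<in> S \<and> s \<noteq> s'}"
    by (rule finite_subset) (use assms in simp)
  then have "finite D" by (simp add: D_def)
  show ?thesis
  proof (rule that[of "Min D"])
    show "0 < Min D" using \<open>finite D\<close> by (subst Min_gr_iff) (auto simp: D_def)
    show "Min D \<le> \<bar>s - s'\<bar>" if "s \<in> S" "s' \<in> S" "s \<noteq> s'" for s s'
      using \<open>finite D\<close> that by (intro Min_le) (auto simp: D_def)
  qed
qed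

lemma skorokhod_dist_sampled_tendsto_0:
  assumes "cadlag x"
  shows "(\<lambda>m. skorokhod_dist x (step_path (real m) (\<lambda>i. x (real i / real m)))) \<longlonglongrightarrow> 0"
proof (rule LIMSEQ_I)
  fix r :: real assume r: "0 < r"
  define T where "T = max 0 (- ln (r / 5))"
  have T: "0 \<le> T" "exp (- T) \<le> r / 5"
    using r by (auto simp: T_def max_def ln_ge_iff simp flip: ln_ge_iff) 
  obtain S where S: "finite S" "0 \<in> S" "S \<subseteq> {0..}"
    "\<And>t t'. 0 \<le> t \<Longrightarrow> t < t' \<Longrightarrow> t' < T \<Longrightarrow> S \<inter> {t<..t'} = {} \<Longrightarrow> compact_dist (x t) (x t') \<le> r / 5"
    using r by (rule_tac cadlag_partition[OF assms _ T(1), of "r / 5"]) auto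
  obtain d where d: "0 < d" "\<And>s s'. s \<in> S \<Longrightarrow> s' \<in> S \<Longrightarrow> s \<noteq> s' \<Longrightarrow> d \<le> \<bar>s - s'\<bar>"
    using finite_set_separated[OF S(1)] by metis
  define \<eta> where "\<eta> = min (1/2) (r / 10)"
  have eta: "0 < \<eta>" "\<eta> \<le> 1/2" "\<eta> \<le> r / 10" using r by (auto simp: \<eta>_def)
  define m0 where "m0 = max 1 (max (1 / (\<eta> * d)) (5 * card S / r))"
  obtain N where N: "m0 < real N" using reals_Archimedean2 by blast
  show "\<exists>no. \<forall>n\<ge>no. norm (skorokhod_dist x (step_path (real n) (\<lambda>i. x (real i / real n))) - 0) < r"
  proof (intro exI[of _ N] allI impI)
    fix n assume "N \<le> n"
    then have n: "m0 < real n" using N by linarith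
    then have n0: "0 < real n" by (simp add: m0_def)
    have "1 / (\<eta> * d) < real n" using n by (simp add: m0_def)
    then have 1: "1 / real n \<le> \<eta> * d" using n0 eta d by (simp add: field_simps)
    have "5 * card S / r < real n" using n by (simp add: m0_def)
    then have 2: "card S / real n < r / 5" using n0 r by (simp add: field_simps)
    have "skorokhod_dist x (step_path (real n) (\<lambda>i. x (real i / real n))) \<le> 2 * \<eta> + r / 5 + card S / real n + exp (- T)"
      using n0 S d eta 1 r by (intro skorokhod_dist_sampled_le[where d = d]) auto
    also have "\<dots> < r" using eta 2 T r by linarith
    finally show "norm (skorokhod_dist x (step_path (real n) (\<lambda>i. x (real i / real n))) - 0) < r"
      by simp
  qed
qed

section \<open>Lipschitz functionals of paths\<close>

definition skorokhod_lipschitz :: "real \<Rightarrow> ((real \<Rightarrow> ennreal) \<Rightarrow> real) \<Rightarrow> bool" where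
  "skorokhod_lipschitz K h \<longleftrightarrow> 0 \<le> K \<and>
     (\<forall>x\<in>skorokhod_space. \<forall>y\<in>skorokhod_space. \<bar>h x - h y\<bar> \<le> K * skorokhod_dist x y)"

lemma skorokhod_lipschitzD:
  "skorokhod_lipschitz K h \<Longrightarrow> x \<in> skorokhod_space \<Longrightarrow> y \<in> skorokhod_space \<Longrightarrow> \<bar>h x - h y\<bar> \<le> K * skorokhod_dist x y"
  "skorokhod_lipschitz K h \<Longrightarrow> 0 \<le> K"
  by (auto simp: skorokhod_lipschitz_def)

lemma continuous_map_skorokhod_lipschitz:
  assumes "skorokhod_lipschitz K h"
  shows "continuous_map skorokhod_topology euclideanreal h"
  unfolding continuous_map_def
proof (intro conjI allI impI)
  fix U :: "real set" assume "openin euclidean U"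
  then have "open U" by simp
  show "openin skorokhod_topology {x \<in> topspace skorokhod_topology. h x \<in> U}"
    unfolding openin_skorokhod topspace_skorokhod
  proof (intro conjI ballI)
    fix x assume x: "x \<in> {x \<in> skorokhod_space. h x \<in> U}"
    then obtain e where e: "0 < e" "\<And>v. \<bar>v - h x\<bar> < e \<Longrightarrow> v \<in> U"
      using \<open>open U\<close> by (auto simp: open_dist dist_real_def)
    show "\<exists>r>0. \<forall>y\<in>skorokhod_space. skorokhod_dist x y < r \<longrightarrow> y \<in> {x \<in> skorokhod_space. h x \<in> U}"
    proof (intro exI[of _ "e / (K + 1)"] conjI ballI impI)
      have K: "0 \<le> K" using assms by (rule skorokhod_lipschitzD)
      then show "0 < e / (K + 1)" using e by simp
      fix y assume y: "y \<in> skorokhod_space" "skorokhod_dist x y < e / (K + 1)"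
      have "\<bar>h y - h x\<bar> \<le> K * skorokhod_dist x y"
        using skorokhod_lipschitzD(1)[OF assms, of x y] x y by simp
      also have "\<dots> \<le> (K + 1) * skorokhod_dist x y" by (simp add: distrib_right)
      also have "\<dots> < e" using y K by (simp add: pos_less_divide_eq mult.commute)
      finally show "y \<in> {x \<in> skorokhod_space. h x \<in> U}" using e(2) y by simp
    qed
  qed auto
qed auto

section \<open>Borel sets of a topology, and functionals of finitely many values\<close>

lemma space_borel_of: "space (borel_of T) = topspace T"
  by (simp add: borel_of_def space_measure_of_conv)

lemma sets_borel_of: "sets (borel_of T) = sigma_sets (topspace T) {U. openin T U}"
  unfolding borel_of_def by (rule sets_measure_of) (auto dest: openin_subset)

lemma borel_measurable_continuous_map:
  assumes "continuous_map T euclideanreal h"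
  shows "h \<in> borel_measurable (borel_of T)"
proof (rule borel_measurableI)
  fix U :: "real set" assume "open U"
  then have "openin T {x \<in> topspace T. h x \<in> U}"
    using assms by (auto simp: continuous_map_def)
  moreover have "h -` U \<inter> space (borel_of T) = {x \<in> topspace T. h x \<in> U}"
    by (auto simp: space_borel_of)
  ultimately show "h -` U \<inter> space (borel_of T) \<in> sets (borel_of T)"
    by (auto simp: sets_borel_of intro: sigma_sets.Basic)
qed

lemma psi_surj:
  assumes "0 \<le> r" "r \<le> 1"
  obtains x where "psi x = r"
proof (cases "r = 0")
  case True
  then show ?thesis using that[of \<top>] by simp
next
  case False
  then have "psi (ennreal (1 / r - 1)) = r"
    using assms by (subst psi_ennreal) (auto simp: field_simps)
  then show ?thesis by (rule that)
qed

text \<open>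
  A partition of unity: it reduces functionals of the sampled path to finite sums of products of
  functions of one time each.
\<close>

definition hat :: "nat \<Rightarrow> nat \<Rightarrow> ennreal \<Rightarrow> real" where
  "hat L j x = max 0 (1 - \<bar>real L * psi x - real j\<bar>)"

lemma continuous_on_hat: "continuous_on UNIV (hat L j)"
  unfolding hat_def by (intro continuous_intros)

lemma hat_nonneg: "0 \<le> hat L j x"
  by (simp add: hat_def)

lemma sum_hat:
  shows "(\<Sum>j\<le>L. hat L j x) = 1"
proof -
  define v where "v = real L * psi x"
  have v: "0 \<le> v" "v \<le> real L"
    using psi_nonneg[of x] psi_le_1[of x] by (auto simp: v_def mult_left_le)
  define k where "k = nat \<lfloor>v\<rfloor>"
  have k: "real k \<le> v" "v < real k + 1"
    using v by (auto simp: k_def)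
  have "k \<le> L" using v k by linarith
  have zero: "hat L j x = 0" if "j \<noteq> k" "j \<noteq> Suc k" for j
  proof -
    have "j < k \<or> Suc (Suc k) \<le> j" using that by linarith
    then have "1 \<le> \<bar>v - real j\<bar>" using k by auto
    then show ?thesis by (simp add: hat_def v_def)
  qed
  show ?thesis
  proof (cases "k < L")
    case True
    have "(\<Sum>j\<le>L. hat L j x) = (\<Sum>j\<in>{k, Suc k}. hat L j x)"
      using True by (intro sum.mono_neutral_right) (auto intro: zero)
    also have "\<dots> = 1"
      using k by (simp add: hat_def flip: v_def)
    finally show ?thesis .
  next
    case False
    then have "v = real k" "k = L" using \<open>k \<le> L\<close> v k by auto
    have "(\<Sum>j\<le>L. hat L j x) = (\<Sum>j\<in>{k}. hat L j x)"
      using \<open>k = L\<close> by (intro sum.mono_neutral_right) (auto intro: zero)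
    also have "\<dots> = 1" using \<open>v = real k\<close> by (simp add: hat_def flip: v_def)
    finally show ?thesis .
  qed
qed

text \<open>A partition of unity in each of the first \<open>I + 1\<close> coordinates replaces the
  values by nodes \<open>pt\<close>. A product of hats that does not vanish forces every value to be
  close to its node, so the weighted sum of the values of \<open>h\<close> at nodes approximates
  \<open>h\<close> uniformly in \<open>y\<close>. Sums of products are what finite-dimensional
  distributions evaluate.\<close>

lemma lipschitz_step_path_approx:
  assumes h: "skorokhod_lipschitz K h" and m: "0 < m" and r: "0 < r"
  obtains A :: "(nat \<Rightarrow> nat) set" and w I and \<phi> :: "nat \<Rightarrow> ennreal \<Rightarrow> real" where
    "finite A" "\<And>j. continuous_on UNIV (\<phi> j)"
    "\<And>y. \<bar>h (step_path m y) - (\<Sum>a\<in>A. w a * (\<Prod>i\<le>I. \<phi> (a i) (y i)))\<bar> \<le> r"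
proof -
  have K: "0 \<le> K" using h by (rule skorokhod_lipschitzD)
  \<comment> \<open>\<open>c\<close> bounds both the distance to the nodes, through the choice of
    \<open>L\<close>, and the weight of the neglected coordinates, through that of \<open>I\<close>;
    even \<open>(K + 1) * (c + c)\<close> is just \<open>r\<close>.\<close>
  define c where "c = r / (2 * (K + 1))"
  have c: "0 < c" using K r by (simp add: c_def)
  obtain L :: nat where L: "1 / c < real L" using reals_Archimedean2 by blast
  then have "0 < L" using c by (cases L) (auto simp: divide_less_0_iff)
  then have L': "1 / real L \<le> c" using L c by (simp add: field_simps)
  obtain I :: nat where I: "m * (- ln c) < real I" using reals_Archimedean2 by blast
  have "- ln c \<le> (real I + 1) / m" using I m by (simp add: pos_le_divide_eq mult.commute)
  then have "exp (- ((real I + 1) / m)) \<le> exp (ln c)" by simp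
  then have I': "exp (- ((real I + 1) / m)) \<le> c" using c by simp
  define pt where "pt j = (SOME x. psi x = real j / real L)" for j
  have pt: "psi (pt j) = real j / real L" if "j \<le> L" for j
  proof -
    have "0 \<le> real j / real L" "real j / real L \<le> 1" using that \<open>0 < L\<close> by auto
    then obtain x where "psi x = real j / real L" by (rule psi_surj)
    then show ?thesis unfolding pt_def by (rule someI)
  qed
  define A where "A = Pi\<^sub>E {..I} (\<lambda>_. {..L})"
  define w where "w a = h (step_path m (\<lambda>i. pt (a i)))" for a
  have "\<bar>h (step_path m y) - (\<Sum>a\<in>A. w a * (\<Prod>i\<le>I. hat L (a i) (y i)))\<bar> \<le> r" for y
  proof -
    define p where "p a = (\<Prod>i\<le>I. hat L (a i) (y i))" for a
    have p0: "0 \<le> p a" for a unfolding p_def by (intro prod_nonneg) (auto simp: hat_nonneg)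
    have "(\<Prod>i\<le>I. \<Sum>j\<le>L. hat L j (y i)) = (\<Sum>a\<in>A. p a)"
      unfolding p_def A_def by (rule prod_sum_PiE) auto
    then have p1: "(\<Sum>a\<in>A. p a) = 1" by (simp add: sum_hat)
    have bnd: "\<bar>h (step_path m y) - w a\<bar> * p a \<le> r * p a" if "a \<in> A" for a
    proof (cases "p a = 0")
      case False
      have near: "compact_dist (y i) (pt (a i)) \<le> c" if "i \<le> I" for i
      proof -
        have "hat L (a i) (y i) \<noteq> 0" using False that by (auto simp: p_def)
        then have "\<bar>real L * psi (y i) - real (a i)\<bar> \<le> 1" by (auto simp: hat_def max_def split: if_splits)
        moreover have "real L * psi (y i) - real (a i) = real L * (psi (y i) - psi (pt (a i)))"
          using \<open>0 < L\<close> pt[of "a i"] PiE_mem[of a "{..I}" "\<lambda>_. {..L}" i] \<open>a \<in> A\<close> that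
          by (auto simp: A_def right_diff_distrib)
        ultimately have "real L * \<bar>psi (y i) - psi (pt (a i))\<bar> \<le> 1" by (simp add: abs_mult)
        then have "\<bar>psi (y i) - psi (pt (a i))\<bar> \<le> 1 / real L"
          using \<open>0 < L\<close> by (simp add: pos_le_divide_eq mult.commute)
        then show ?thesis using L' by (simp add: compact_dist_psi)
      qed
      have "\<bar>h (step_path m y) - w a\<bar> \<le> K * skorokhod_dist (step_path m y) (step_path m (\<lambda>i. pt (a i)))"
        unfolding w_def using m by (intro skorokhod_lipschitzD[OF h] step_path_in_skorokhod_space)
      also have "\<dots> \<le> K * (c + exp (- ((real I + 1) / m)))"
        using m c near K by (intro mult_left_mono skorokhod_dist_step_paths) auto
      also have "\<dots> \<le> (K + 1) * (c + c)" using I' K c by (intro mult_mono) auto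
      also have "\<dots> = 2 * (K + 1) * c" by algebra
      also have "\<dots> = r" using K unfolding c_def by simp
      finally show ?thesis using p0[of a] by (intro mult_right_mono) auto
    qed simp
    have "h (step_path m y) - (\<Sum>a\<in>A. w a * p a) = (\<Sum>a\<in>A. (h (step_path m y) - w a) * p a)"
      using p1 by (simp add: left_diff_distrib sum_subtractf flip: sum_distrib_left)
    also have "\<bar>\<dots>\<bar> \<le> (\<Sum>a\<in>A. \<bar>h (step_path m y) - w a\<bar> * p a)"
      using p0 by (intro order_trans[OF sum_abs] sum_mono) (simp add: abs_mult)
    also have "\<dots> \<le> (\<Sum>a\<in>A. r * p a)" by (intro sum_mono bnd)
    also have "\<dots> = r" using p1 by (simp flip: sum_distrib_left)
    finally show ?thesis by (simp add: p_def)
  qed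
  moreover have "finite A" unfolding A_def by (intro finite_PiE) auto
  ultimately show ?thesis using that[of A "hat L" w I] continuous_on_hat by blast
qed

text \<open>A uniform limit of finite sums of products, each measurable coordinate by coordinate. No
  description of the Borel sets of the path space is involved.\<close>

lemma step_path_measurable:
  assumes h: "skorokhod_lipschitz K h" and m: "0 < m" and Y: "\<And>i. Y i \<in> borel_measurable M"
  shows "(\<lambda>\<omega>. h (step_path m (\<lambda>i. Y i \<omega>))) \<in> borel_measurable M"
proof -
  have "\<exists>f. f \<in> borel_measurable M \<and> (\<forall>\<omega>. \<bar>h (step_path m (\<lambda>i. Y i \<omega>)) - f \<omega>\<bar> \<le> inverse (real (Suc k)))" for k
  proof -
    obtain A :: "(nat \<Rightarrow> nat) set" and w I and \<phi> :: "nat \<Rightarrow> ennreal \<Rightarrow> real" where *: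
      "finite A" "\<And>j. continuous_on UNIV (\<phi> j)"
      "\<And>y. \<bar>h (step_path m y) - (\<Sum>a\<in>A. w a * (\<Prod>i\<le>I. \<phi> (a i) (y i)))\<bar> \<le> inverse (real (Suc k))"
      by (rule lipschitz_step_path_approx[OF h m, of "inverse (real (Suc k))"]) auto
    have "\<phi> j \<in> borel_measurable borel" for j
      by (rule borel_measurable_continuous_onI[OF *(2)])
    then have "(\<lambda>\<omega>. \<phi> j (Y i \<omega>)) \<in> borel_measurable M" for i j
      using Y by (rule measurable_compose[rotated])
    then have "(\<lambda>\<omega>. \<Sum>a\<in>A. w a * (\<Prod>i\<le>I. \<phi> (a i) (Y i \<omega>))) \<in> borel_measurable M"
      by measurable
    then show ?thesis using *(3) by blast
  qed
  then obtain f where f: "\<And>k. f k \<in> borel_measurable M"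
    "\<And>k \<omega>. \<bar>h (step_path m (\<lambda>i. Y i \<omega>)) - f k \<omega>\<bar> \<le> inverse (real (Suc k))" by metis
  show ?thesis
  proof (rule borel_measurable_LIMSEQ_real)
    show "(\<lambda>k. f k \<omega>) \<longlonglongrightarrow> h (step_path m (\<lambda>i. Y i \<omega>))" for \<omega>
    proof -
      have "(\<lambda>k. f k \<omega> - h (step_path m (\<lambda>i. Y i \<omega>))) \<longlonglongrightarrow> 0"
        using f(2) by (intro Lim_null_comparison[OF _ LIMSEQ_inverse_real_of_nat] always_eventually)
          (simp add: abs_minus_commute)
      then show ?thesis by (simp add: LIM_zero_iff)
    qed
  qed (rule f)
qed

lemma cadlag_cong:
  assumes "cadlag x" "\<And>t. 0 \<le> t \<Longrightarrow> y t = x t"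
  shows "cadlag y"
  unfolding cadlag_def
proof (intro conjI allI impI)
  fix t :: real assume t: "0 \<le> t"
  have "\<forall>\<^sub>F v in at_right t. x v = y v"
    using eventually_at_right_less[of t] by eventually_elim (use t assms(2) in auto)
  moreover have "(x \<longlongrightarrow> x t) (at_right t)" using assms(1) t by (simp add: cadlag_def)
  ultimately have "(y \<longlongrightarrow> x t) (at_right t)" by (rule Lim_transform_eventually[rotated])
  then show "(y \<longlongrightarrow> y t) (at_right t)" using t assms(2) by simp
next
  fix t :: real assume t: "0 < t"
  have "\<forall>\<^sub>F v in at_left t. x v = y v"
    unfolding eventually_at_left_field using t assms(2) by (intro exI[of _ 0]) auto
  moreover obtain l where "(x \<longlongrightarrow> l) (at_left t)" using assms(1) t by (auto simp: cadlag_def)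
  ultimately have "(y \<longlongrightarrow> l) (at_left t)" by (rule Lim_transform_eventually[rotated])
  then show "\<exists>l. (y \<longlongrightarrow> l) (at_left t)" by (rule exI)
qed

lemma path_in_skorokhod_space:
  assumes "cadlag x" shows "restrict x {0..} \<in> skorokhod_space"
  using cadlag_cong[OF assms, of "restrict x {0..}"] by (simp add: skorokhod_space_def)

lemma lipschitz_sampled_tendsto:
  assumes h: "skorokhod_lipschitz K h" and x: "cadlag x"
  shows "(\<lambda>m. h (step_path (real (Suc m)) (\<lambda>i. x (real i / real (Suc m))))) \<longlonglongrightarrow> h (restrict x {0..})"
proof -
  have D: "restrict x {0..} \<in> skorokhod_space" using x by (rule path_in_skorokhod_space)
  then have "cadlag (restrict x {0..})" by (simp add: skorokhod_space_def)
  have lim: "(\<lambda>m. K * skorokhod_dist (restrict x {0..}) (step_path (real (Suc m)) (\<lambda>i. x (real i / real (Suc m))))) \<longlonglongrightarrow> K * 0"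
    using LIMSEQ_Suc[OF skorokhod_dist_sampled_tendsto_0[OF \<open>cadlag (restrict x {0..})\<close>]]
    by (intro tendsto_mult_left) (simp del: of_nat_Suc)
  have "(\<lambda>m. h (step_path (real (Suc m)) (\<lambda>i. x (real i / real (Suc m)))) - h (restrict x {0..})) \<longlonglongrightarrow> 0"
  proof (rule Lim_null_comparison)
    show "\<forall>\<^sub>F m in sequentially. norm (h (step_path (real (Suc m)) (\<lambda>i. x (real i / real (Suc m)))) - h (restrict x {0..}))
       \<le> K * skorokhod_dist (restrict x {0..}) (step_path (real (Suc m)) (\<lambda>i. x (real i / real (Suc m))))"
    proof (intro always_eventually allI)
      fix m
      show "norm (h (step_path (real (Suc m)) (\<lambda>i. x (real i / real (Suc m)))) - h (restrict x {0..}))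
         \<le> K * skorokhod_dist (restrict x {0..}) (step_path (real (Suc m)) (\<lambda>i. x (real i / real (Suc m))))"
        using skorokhod_lipschitzD(1)[OF h D step_path_in_skorokhod_space[of "real (Suc m)" "\<lambda>i. x (real i / real (Suc m))"]]
        by (simp add: abs_minus_commute[of "h (restrict x {0..})"] del: of_nat_Suc)
    qed
  qed (use lim in simp)
  then show ?thesis by (simp add: LIM_zero_iff)
qed

lemma lipschitz_path_measurable:
  assumes h: "skorokhod_lipschitz K h" and Y: "\<And>t. 0 \<le> t \<Longrightarrow> Y t \<in> borel_measurable M"
    and c: "\<And>\<omega>. \<omega> \<in> space M \<Longrightarrow> cadlag (\<lambda>t. Y t \<omega>)"
  shows "(\<lambda>\<omega>. h (restrict (\<lambda>t. Y t \<omega>) {0..})) \<in> borel_measurable M"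
proof (rule borel_measurable_LIMSEQ_real)
  show "(\<lambda>\<omega>. h (step_path (real (Suc m)) (\<lambda>i. Y (real i / real (Suc m)) \<omega>))) \<in> borel_measurable M" for m
    by (rule step_path_measurable[OF h]) (auto intro: Y)
qed (rule lipschitz_sampled_tendsto[OF h c])

lemma lipschitz_infdist:
  assumes "F \<subseteq> skorokhod_space" "F \<noteq> {}"
  shows "skorokhod_lipschitz 1 (\<lambda>x. INF y\<in>F. skorokhod_dist x y)"
proof -
  have *: "(INF y\<in>F. skorokhod_dist x y) \<le> skorokhod_dist x z + (INF y\<in>F. skorokhod_dist z y)"
    if "x \<in> skorokhod_space" "z \<in> skorokhod_space" for x z
  proof -
    have "(INF y\<in>F. skorokhod_dist x y) - skorokhod_dist x z \<le> (INF y\<in>F. skorokhod_dist z y)"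
    proof (rule cINF_greatest[OF assms(2)])
      fix y assume "y \<in> F"
      then have "(INF y\<in>F. skorokhod_dist x y) \<le> skorokhod_dist x y"
        by (intro cINF_lower bdd_belowI2[of _ 0]) auto
      also have "\<dots> \<le> skorokhod_dist x z + skorokhod_dist z y"
        using that assms \<open>y \<in> F\<close> by (intro skorokhod_dist_triangle) (auto simp: skorokhod_space_def)
      finally show "(INF y\<in>F. skorokhod_dist x y) - skorokhod_dist x z \<le> skorokhod_dist z y" by simp
    qed
    then show ?thesis by simp
  qed
  show ?thesis
    unfolding skorokhod_lipschitz_def
  proof (intro conjI ballI)
    fix x z assume xz: "x \<in> skorokhod_space" "z \<in> skorokhod_space"
    show "\<bar>(INF y\<in>F. skorokhod_dist x y) - (INF y\<in>F. skorokhod_dist z y)\<bar> \<le> 1 * skorokhod_dist x z"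
      using *[OF xz] *[OF xz(2,1)] skorokhod_dist_commute[of x z] by linarith
  qed simp
qed

text \<open>An open set is where the distance to its complement is positive. That distance is a
  Lipschitz functional, and Lipschitz functionals of the path are measurable as limits of
  functionals of sampled paths.\<close>

lemma path_measurable:
  assumes Y: "\<And>t. 0 \<le> t \<Longrightarrow> Y t \<in> borel_measurable M"
    and c: "\<And>\<omega>. \<omega> \<in> space M \<Longrightarrow> cadlag (\<lambda>t. Y t \<omega>)"
  shows "(\<lambda>\<omega>. restrict (\<lambda>t. Y t \<omega>) {0..}) \<in> measurable M (borel_of skorokhod_topology)"
proof (rule measurable_sigma_sets[OF sets_borel_of])
  fix U assume "U \<in> {U. openin skorokhod_topology U}"
  then have U: "U \<subseteq> skorokhod_space" "\<And>x. x \<in> U \<Longrightarrow> \<exists>r>0. \<forall>y\<in>skorokhod_space. skorokhod_dist x y < r \<longrightarrow> y \<in> U"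
    by (auto simp: openin_skorokhod)
  define F where "F = skorokhod_space - U"
  have D: "restrict (\<lambda>t. Y t \<omega>) {0..} \<in> skorokhod_space" if "\<omega> \<in> space M" for \<omega>
    using c[OF that] by (rule path_in_skorokhod_space)
  show "(\<lambda>\<omega>. restrict (\<lambda>t. Y t \<omega>) {0..}) -` U \<inter> space M \<in> sets M"
  proof (cases "F = {}")
    case True
    then have "(\<lambda>\<omega>. restrict (\<lambda>t. Y t \<omega>) {0..}) -` U \<inter> space M = space M"
      using D by (auto simp: F_def)
    then show ?thesis by simp
  next
    case False
    have lip: "skorokhod_lipschitz 1 (\<lambda>x. INF y\<in>F. skorokhod_dist x y)"
      using False by (intro lipschitz_infdist) (auto simp: F_def)
    have "x \<in> U \<longleftrightarrow> 0 < (INF y\<in>F. skorokhod_dist x y)" if "x \<in> skorokhod_space" for x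
    proof
      assume "x \<in> U"
      then obtain r where r: "0 < r" "\<forall>y\<in>skorokhod_space. skorokhod_dist x y < r \<longrightarrow> y \<in> U"
        using U(2)[OF \<open>x \<in> U\<close>] by auto
      then have "r \<le> (INF y\<in>F. skorokhod_dist x y)"
        using False by (intro cINF_greatest) (auto simp: F_def not_less[symmetric])
      then show "0 < (INF y\<in>F. skorokhod_dist x y)" using r by simp
    next
      assume pos: "0 < (INF y\<in>F. skorokhod_dist x y)"
      show "x \<in> U"
      proof (rule ccontr)
        assume "x \<notin> U"
        then have "x \<in> F" using that by (simp add: F_def)
        then have "(INF y\<in>F. skorokhod_dist x y) \<le> skorokhod_dist x x"
          by (intro cINF_lower bdd_belowI2[of _ 0]) auto
        then show False using pos by simp
      qed
    qed
    then have "(\<lambda>\<omega>. restrict (\<lambda>t. Y t \<omega>) {0..}) -` U \<inter> space M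
       = {\<omega> \<in> space M. 0 < (INF y\<in>F. skorokhod_dist (restrict (\<lambda>t. Y t \<omega>) {0..}) y)}"
      using D by auto
    also have "\<dots> \<in> sets M"
      using lipschitz_path_measurable[OF lip Y c] by (intro borel_measurable_less) auto
    finally show ?thesis .
  qed
next
  show "{U. openin skorokhod_topology U} \<subseteq> Pow (topspace skorokhod_topology)"
    by (blast dest: openin_subset)
qed (use path_in_skorokhod_space[OF c] in \<open>simp add: topspace_skorokhod\<close>)

lemma path_law_in_prob_algebra:
  assumes "prob_space M" and "\<And>t. 0 \<le> t \<Longrightarrow> Y t \<in> borel_measurable M"
    and "\<And>\<omega>. \<omega> \<in> space M \<Longrightarrow> cadlag (\<lambda>t. Y t \<omega>)"
  shows "path_law M Y \<in> space (prob_algebra (borel_of skorokhod_topology))"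
  using prob_space.prob_space_distr[OF assms(1) path_measurable[of Y M, OF assms(2,3)]]
  by (simp add: path_law_def space_prob_algebra)

lemma integral_path_law:
  fixes h :: "(real \<Rightarrow> ennreal) \<Rightarrow> real"
  assumes "\<And>t. 0 \<le> t \<Longrightarrow> Y t \<in> borel_measurable M"
    and "\<And>\<omega>. \<omega> \<in> space M \<Longrightarrow> cadlag (\<lambda>t. Y t \<omega>)"
    and "skorokhod_lipschitz K h"
  shows "(\<integral>x. h x \<partial>path_law M Y) = (\<integral>\<omega>. h (restrict (\<lambda>t. Y t \<omega>) {0..}) \<partial>M)"
  unfolding path_law_def
  by (rule integral_distr[OF path_measurable[of Y M, OF assms(1,2)]
      borel_measurable_continuous_map[OF continuous_map_skorokhod_lipschitz[OF assms(3)]]])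

text \<open>
  Bounded continuous functionals are increasing limits of Lipschitz ones, so that weak convergence
  can be tested on the latter without any compactness of the laws.
\<close>

lemma lipschitz_inf_convolution:
  assumes h: "\<And>x. x \<in> skorokhod_space \<Longrightarrow> \<bar>h x\<bar> \<le> C" and K: "0 \<le> K"
  defines "g \<equiv> \<lambda>x. INF y\<in>skorokhod_space. h y + K * skorokhod_dist x y"
  shows "skorokhod_lipschitz K g"
    and "\<And>x. x \<in> skorokhod_space \<Longrightarrow> g x \<le> h x"
    and "\<And>x. x \<in> skorokhod_space \<Longrightarrow> \<bar>g x\<bar> \<le> C"
proof -
  have ne: "skorokhod_space \<noteq> {}" using step_path_in_skorokhod_space[of 1 "\<lambda>_. 0"] by auto
  have low: "- C \<le> h y + K * skorokhod_dist x y" if "y \<in> skorokhod_space" for x y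
    using h[OF that] K mult_nonneg_nonneg[OF K skorokhod_dist_nonneg[of x y]] by linarith
  then have bdd: "bdd_below ((\<lambda>y. h y + K * skorokhod_dist x y) ` skorokhod_space)" for x
    by (intro bdd_belowI2[of _ "- C"])
  have *: "g x \<le> K * skorokhod_dist x z + g z" if "x \<in> skorokhod_space" "z \<in> skorokhod_space" for x z
  proof -
    have "g x - K * skorokhod_dist x z \<le> g z"
      unfolding g_def
    proof (rule cINF_greatest[OF ne])
      fix y assume y: "y \<in> skorokhod_space"
      have "(INF y\<in>skorokhod_space. h y + K * skorokhod_dist x y) \<le> h y + K * skorokhod_dist x y"
        by (rule cINF_lower[OF bdd y])
      also have "\<dots> \<le> h y + K * (skorokhod_dist x z + skorokhod_dist z y)"
        using that y K by (intro add_left_mono mult_left_mono skorokhod_dist_triangle) (auto simp: skorokhod_space_def)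
      finally show "(INF y\<in>skorokhod_space. h y + K * skorokhod_dist x y) - K * skorokhod_dist x z \<le> h y + K * skorokhod_dist z y"
        by (simp add: distrib_left)
    qed
    then show ?thesis by simp
  qed
  show "skorokhod_lipschitz K g"
    unfolding skorokhod_lipschitz_def
  proof (intro conjI ballI K)
    fix x z assume xz: "x \<in> skorokhod_space" "z \<in> skorokhod_space"
    show "\<bar>g x - g z\<bar> \<le> K * skorokhod_dist x z"
      using *[OF xz] *[OF xz(2,1)] unfolding skorokhod_dist_commute[of z x] by linarith
  qed
  show le: "g x \<le> h x" if "x \<in> skorokhod_space" for x
    using cINF_lower[OF bdd that, of x] by (simp add: g_def)
  show "\<bar>g x\<bar> \<le> C" if "x \<in> skorokhod_space" for x
  proof -
    have "- C \<le> g x" unfolding g_def by (rule cINF_greatest[OF ne]) (rule low)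
    then show ?thesis using le[OF that] h[OF that] by linarith
  qed
qed

text \<open>Points at distance at least \<open>d\<close> from \<open>x\<close> are penalized by at
  least \<open>2 * C\<close> once \<open>k\<close> is large, so only points near \<open>x\<close>
  can compete, and there continuity keeps \<open>h\<close> above \<open>h x - r / 2\<close>.\<close>

lemma inf_convolution_tendsto:
  assumes h: "\<And>x. x \<in> skorokhod_space \<Longrightarrow> \<bar>h x\<bar> \<le> C" 
    and cont: "continuous_map skorokhod_topology euclideanreal h" and x: "x \<in> skorokhod_space"
  shows "(\<lambda>k. INF y\<in>skorokhod_space. h y + real k * skorokhod_dist x y) \<longlonglongrightarrow> h x"
proof (rule LIMSEQ_I)
  fix r :: real assume r: "0 < r"
  have ne: "skorokhod_space \<noteq> {}" using x by blast
  have "openin skorokhod_topology {y \<in> topspace skorokhod_topology. h y \<in> {h x - r / 2 <..}}"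
    using openin_continuous_map_preimage[OF cont, of "{h x - r / 2 <..}"] by simp
  moreover have "x \<in> {y \<in> topspace skorokhod_topology. h y \<in> {h x - r / 2 <..}}"
    using x r by (simp add: topspace_skorokhod)
  ultimately obtain d where d: "0 < d" "\<And>y. y \<in> skorokhod_space \<Longrightarrow> skorokhod_dist x y < d \<Longrightarrow> h x - r / 2 < h y"
    unfolding openin_skorokhod by auto
  obtain N :: nat where N: "2 * C / d < real N" using reals_Archimedean2 by blast
  show "\<exists>no. \<forall>k\<ge>no. norm ((INF y\<in>skorokhod_space. h y + real k * skorokhod_dist x y) - h x) < r"
  proof (intro exI[of _ N] allI impI)
    fix k assume k: "N \<le> k"
    have "h x - r / 2 \<le> (INF y\<in>skorokhod_space. h y + real k * skorokhod_dist x y)"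
    proof (rule cINF_greatest[OF ne])
      fix y assume y: "y \<in> skorokhod_space"
      show "h x - r / 2 \<le> h y + real k * skorokhod_dist x y"
      proof (cases "skorokhod_dist x y < d")
        case True
        then show ?thesis using d(2)[OF y] by (auto intro: order_trans[OF less_imp_le])
      next
        case False
        have "2 * C \<le> real N * d" using N d by (simp add: field_simps)
        also have "\<dots> \<le> real k * skorokhod_dist x y" using False k d by (intro mult_mono) auto
        finally show ?thesis using h[OF x] h[OF y] r by linarith
      qed
    qed
    moreover have "(INF y\<in>skorokhod_space. h y + real k * skorokhod_dist x y) \<le> h x"
      by (rule lipschitz_inf_convolution(2)[OF h _ x]) auto
    ultimately show "norm ((INF y\<in>skorokhod_space. h y + real k * skorokhod_dist x y) - h x) < r"
      using r by (simp add: abs_if)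
  qed
qed

text \<open>The Lipschitz minorants of a bounded continuous \<open>h\<close> bound the integrals
  under \<open>\<mu> n\<close> from below, eventually up to any \<open>r\<close>; applied to
  \<open>- h\<close> as well, this gives convergence.\<close>

lemma weakly_converges_to_lipschitzI:
  assumes \<mu>: "\<forall>\<^sub>F n in sequentially. \<mu> n \<in> space (prob_algebra (borel_of skorokhod_topology))"
    and \<nu>: "\<nu> \<in> space (prob_algebra (borel_of skorokhod_topology))"
    and lim: "\<And>h K C. skorokhod_lipschitz K h \<Longrightarrow> (\<And>x. x \<in> skorokhod_space \<Longrightarrow> \<bar>h x\<bar> \<le> C) \<Longrightarrow>
        (\<lambda>n. \<integral>x. h x \<partial>\<mu> n) \<longlonglongrightarrow> (\<integral>x. h x \<partial>\<nu>)"
  shows "weakly_converges_to skorokhod_topology \<mu> \<nu>"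
proof -
  have sp: "space m = skorokhod_space" "sets m = sets (borel_of skorokhod_topology)" "prob_space m"
    if "m \<in> space (prob_algebra (borel_of skorokhod_topology))" for m
  proof -
    show "sets m = sets (borel_of skorokhod_topology)" "prob_space m"
      using that by (auto simp: space_prob_algebra)
    then show "space m = skorokhod_space"
      using sets_eq_imp_space_eq[of m "borel_of skorokhod_topology"] by (simp add: space_borel_of topspace_skorokhod)
  qed
  have int: "integrable m h"
    if m: "m \<in> space (prob_algebra (borel_of skorokhod_topology))" and "continuous_map skorokhod_topology euclideanreal h"
      and "\<And>x. x \<in> skorokhod_space \<Longrightarrow> \<bar>h x\<bar> \<le> C" for m h C
  proof -
    interpret prob_space m by (rule sp(3)[OF m])
    show ?thesis
      using that sp[OF m] borel_measurable_continuous_map[OF that(2)]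
      by (intro integrable_const_bound[of _ C]) (auto cong: measurable_cong_sets)
  qed
  have lower: "\<forall>\<^sub>F n in sequentially. (\<integral>x. h x \<partial>\<nu>) - r < (\<integral>x. h x \<partial>\<mu> n)"
    if cont: "continuous_map skorokhod_topology euclideanreal h" and C: "\<And>x. x \<in> skorokhod_space \<Longrightarrow> \<bar>h x\<bar> \<le> C"
      and r: "0 < r" for h C r
  proof -
    define g where "g k x = (INF y\<in>skorokhod_space. h y + real k * skorokhod_dist x y)" for k :: nat and x
    have g: "skorokhod_lipschitz (real k) (g k)" "\<And>x. x \<in> skorokhod_space \<Longrightarrow> g k x \<le> h x"
      "\<And>x. x \<in> skorokhod_space \<Longrightarrow> \<bar>g k x\<bar> \<le> C" for k
      unfolding g_def using lipschitz_inf_convolution[OF C, where K = "real k"] by auto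
    have gc: "continuous_map skorokhod_topology euclideanreal (g k)" for k
      by (rule continuous_map_skorokhod_lipschitz[OF g(1)])
    interpret \<nu>: prob_space \<nu> by (rule sp(3)[OF \<nu>])
    have meas: "f \<in> borel_measurable \<nu>" if "continuous_map skorokhod_topology euclideanreal f" for f
      using borel_measurable_continuous_map[OF that] sp(2)[OF \<nu>] by (simp cong: measurable_cong_sets)
    have "(\<lambda>k. \<integral>x. g k x \<partial>\<nu>) \<longlonglongrightarrow> (\<integral>x. h x \<partial>\<nu>)"
    proof (rule integral_dominated_convergence[where w = "\<lambda>_. C"])
      show "AE x in \<nu>. (\<lambda>k. g k x) \<longlonglongrightarrow> h x"
        unfolding g_def using sp(1)[OF \<nu>] by (intro AE_I2 inf_convolution_tendsto[OF C cont]) auto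
      show "AE x in \<nu>. norm (g k x) \<le> C" for k
        using sp(1)[OF \<nu>] g(3) by (intro AE_I2) auto
    qed (use meas[OF cont] meas[OF gc] in auto)
    then have "\<forall>\<^sub>F k in sequentially. (\<integral>x. h x \<partial>\<nu>) - r / 2 < (\<integral>x. g k x \<partial>\<nu>)"
      using r by (intro order_tendstoD) auto
    then obtain k where k: "(\<integral>x. h x \<partial>\<nu>) - r / 2 < (\<integral>x. g k x \<partial>\<nu>)"
      by (auto simp: eventually_sequentially)
    have "(\<lambda>n. \<integral>x. g k x \<partial>\<mu> n) \<longlonglongrightarrow> (\<integral>x. g k x \<partial>\<nu>)"
      by (rule lim[OF g(1,3)])
    then have "\<forall>\<^sub>F n in sequentially. (\<integral>x. g k x \<partial>\<nu>) - r / 2 < (\<integral>x. g k x \<partial>\<mu> n)"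
      using r by (intro order_tendstoD) auto
    then show ?thesis
      using \<mu>
    proof eventually_elim
      case (elim n)
      have "(\<integral>x. g k x \<partial>\<mu> n) \<le> (\<integral>x. h x \<partial>\<mu> n)"
        using int[OF elim(2) gc g(3)] int[OF elim(2) cont C] g(2) sp(1)[OF elim(2)]
        by (intro integral_mono) auto
      then show ?case using elim(1) k by linarith
    qed
  qed
  have "(\<lambda>n. \<integral>x. h x \<partial>\<mu> n) \<longlonglongrightarrow> (\<integral>x. h x \<partial>\<nu>)"
    if cont: "continuous_map skorokhod_topology euclideanreal h" and b: "bounded (h ` topspace skorokhod_topology)" for h
  proof (rule order_tendstoI)
    obtain C where C: "\<And>x. x \<in> skorokhod_space \<Longrightarrow> \<bar>h x\<bar> \<le> C"
      using b by (auto simp: bounded_iff topspace_skorokhod)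
    {
      fix a assume "a < (\<integral>x. h x \<partial>\<nu>)"
      then show "\<forall>\<^sub>F n in sequentially. a < (\<integral>x. h x \<partial>\<mu> n)"
        using lower[OF cont C, of "(\<integral>x. h x \<partial>\<nu>) - a"] by simp
    next
      fix a assume "(\<integral>x. h x \<partial>\<nu>) < a"
      moreover have "continuous_map skorokhod_topology euclideanreal (\<lambda>x. - h x)"
        using cont by (rule continuous_map_minus)
      ultimately show "\<forall>\<^sub>F n in sequentially. (\<integral>x. h x \<partial>\<mu> n) < a"
        using lower[of "\<lambda>x. - h x" C "a - (\<integral>x. h x \<partial>\<nu>)"] C by simp
    }
  qed
  then show ?thesis
    using \<mu> \<nu> by (simp add: weakly_converges_to_def)
qed

section \<open>Contraction semigroups and Feller semigroups\<close>

text \<open>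
  The library has completeness only for metric domains; \<^typ>\<open>ennreal\<close> is not in class \<^class>\<open>metric_space\<close>.
\<close>

instance bcontfun :: (topological_space, complete_space) complete_space
proof
  fix f :: "nat \<Rightarrow> 'a \<Rightarrow>\<^sub>C 'b" assume "Cauchy f"
  then have "uniformly_Cauchy_on UNIV (\<lambda>n. apply_bcontfun (f n))"
    unfolding uniformly_Cauchy_on_def Cauchy_def by (meson dist_fun_lt_imp_dist_val_lt)
  then obtain g where "uniform_limit UNIV (\<lambda>n. apply_bcontfun (f n)) g sequentially"
    using Cauchy_uniformly_convergent uniformly_convergent_on_def by blast
  then obtain l where "f \<longlonglongrightarrow> l"
    by (rule uniform_limit_bcontfunE) auto
  then show "convergent f" by (rule convergentI)
qed

instance bcontfun :: (topological_space, banach) banach ..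

locale contraction_semigroup =
  fixes T :: "real \<Rightarrow> 'v::banach \<Rightarrow> 'v"
  assumes linear: "0 \<le> t \<Longrightarrow> linear (T t)"
    and contraction: "0 \<le> t \<Longrightarrow> norm (T t f) \<le> norm f"
    and zero: "T 0 f = f"
    and add: "0 \<le> s \<Longrightarrow> 0 \<le> t \<Longrightarrow> T (s + t) f = T s (T t f)"
    and strong_continuity: "0 < e \<Longrightarrow> \<exists>d>0. \<forall>h. 0 \<le> h \<and> h < d \<longrightarrow> norm (T h f - f) < e"
begin

definition gen :: "'v \<Rightarrow> 'v \<Rightarrow> bool" where
  "gen f g \<longleftrightarrow> (\<forall>e>0. \<exists>d>0. \<forall>h. 0 < h \<and> h < d \<longrightarrow> norm (T h f - f - h *\<^sub>R g) \<le> h * e)"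

lemma diff: "0 \<le> t \<Longrightarrow> T t (f - g) = T t f - T t g"
  by (rule linear_diff[OF linear])

lemma scale: "0 \<le> t \<Longrightarrow> T t (c *\<^sub>R f) = c *\<^sub>R T t f"
  by (rule linear_cmul[OF linear])

lemma bounded_linear: "0 \<le> t \<Longrightarrow> bounded_linear (T t)"
  by (rule bounded_linear_intro[where K = 1]) (simp_all add: linear_add[OF linear] scale contraction)

lemma orbit_dist:
  assumes "0 \<le> s" "s \<le> t"
  shows "norm (T t f - T s f) \<le> norm (T (t - s) f - f)"
proof -
  have "T t f = T s (T (t - s) f)" using add[of s "t - s" f] assms by simp
  then have "T t f - T s f = T s (T (t - s) f - f)" using assms by (simp add: diff)
  then show ?thesis using contraction[OF assms(1)] by simp
qed

text \<open>Contraction transports the modulus of continuity at time 0 along the whole orbit, so a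
  single step width serves for all times.\<close>

lemma orbit_uniform:
  assumes "0 < e"
  obtains d where "0 < d" "\<And>s t. 0 \<le> s \<Longrightarrow> s \<le> t \<Longrightarrow> t < s + d \<Longrightarrow> norm (T t f - T s f) < e"
proof -
  obtain d where d: "0 < d" "\<And>h. 0 \<le> h \<Longrightarrow> h < d \<Longrightarrow> norm (T h f - f) < e"
    using strong_continuity[OF assms, of f] by auto
  show ?thesis
  proof (rule that[OF d(1)])
    fix s t assume st: "0 \<le> s" "s \<le> t" "t < s + d"
    have "norm (T (t - s) f - f) < e" by (rule d(2)) (use st in auto)
    then show "norm (T t f - T s f) < e" using orbit_dist[OF st(1,2), of f] by linarith
  qed
qed

lemma continuous_on_orbit: "continuous_on {0..} (\<lambda>t. T t f)"
  unfolding continuous_on_iff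
proof (intro ballI allI impI)
  fix s e :: real assume s: "s \<in> {0..}" and "0 < e"
  obtain d where d: "0 < d" "\<And>s t. 0 \<le> s \<Longrightarrow> s \<le> t \<Longrightarrow> t < s + d \<Longrightarrow> norm (T t f - T s f) < e"
    by (rule orbit_uniform[OF \<open>0 < e\<close>, of f]) (rule that)
  show "\<exists>d>0. \<forall>t\<in>{0..}. dist t s < d \<longrightarrow> dist (T t f) (T s f) < e"
  proof (intro exI[of _ d] conjI ballI impI d(1))
    fix t assume t: "t \<in> {0..}" "dist t s < d"
    show "dist (T t f) (T s f) < e"
      using d(2)[of s t] d(2)[of t s] s t by (cases "s \<le> t") (auto simp: dist_norm norm_minus_commute)
  qed
qed

text \<open>\<open>T s\<close> commutes with \<open>T h\<close> and is a contraction, so the error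
  of the difference quotient does not grow. Hence an orbit that starts in the domain stays there,
  and the convergence of generators is available at all its times.\<close>

lemma gen_T:
  assumes "gen f g" "0 \<le> s"
  shows "gen (T s f) (T s g)"
proof -
  have "norm (T h (T s f) - T s f - h *\<^sub>R T s g) \<le> norm (T h f - f - h *\<^sub>R g)" if "0 < h" for h
  proof -
    have "T h (T s f) = T s (T h f)"
      using add[of h s f] add[of s h f] that assms by (simp add: add.commute)
    then have "T h (T s f) - T s f - h *\<^sub>R T s g = T s (T h f - f - h *\<^sub>R g)"
      using assms by (simp add: diff scale)
    then show ?thesis using contraction[OF assms(2)] by simp
  qed
  then show ?thesis
    using assms(1) unfolding gen_def by (meson order_trans)
qed

lemma gen_diff:
  assumes "gen f g" "gen f' g'"
  shows "gen (f - f') (g - g')"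
  unfolding gen_def
proof (intro allI impI)
  fix e :: real assume "0 < e"
  then have e2: "0 < e / 2" by simp
  obtain d where d: "0 < d" "\<And>h. 0 < h \<Longrightarrow> h < d \<Longrightarrow> norm (T h f - f - h *\<^sub>R g) \<le> h * (e / 2)"
    using assms(1) e2 unfolding gen_def by metis
  obtain d' where d': "0 < d'" "\<And>h. 0 < h \<Longrightarrow> h < d' \<Longrightarrow> norm (T h f' - f' - h *\<^sub>R g') \<le> h * (e / 2)"
    using assms(2) e2 unfolding gen_def by metis
  show "\<exists>d>0. \<forall>h. 0 < h \<and> h < d \<longrightarrow> norm (T h (f - f') - (f - f') - h *\<^sub>R (g - g')) \<le> h * e"
  proof (intro exI[of _ "min d d'"] conjI allI impI)
    fix h assume h: "0 < h \<and> h < min d d'"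
    have eq: "T h (f - f') - (f - f') - h *\<^sub>R (g - g') = (T h f - f - h *\<^sub>R g) - (T h f' - f' - h *\<^sub>R g')"
      using h by (simp add: diff scaleR_diff_right)
    have "norm (T h f - f - h *\<^sub>R g) \<le> h * (e / 2)" "norm (T h f' - f' - h *\<^sub>R g') \<le> h * (e / 2)"
      using d(2)[of h] d'(2)[of h] h by auto
    then have "norm (T h (f - f') - (f - f') - h *\<^sub>R (g - g')) \<le> h * (e / 2) + h * (e / 2)"
      unfolding eq using norm_triangle_ineq4[of "T h f - f - h *\<^sub>R g" "T h f' - f' - h *\<^sub>R g'"] by linarith
    then show "norm (T h (f - f') - (f - f') - h *\<^sub>R (g - g')) \<le> h * e" by (simp add: mult.commute)
  qed (use d d' in auto)
qed

lemma integral_close: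
  fixes f :: "real \<Rightarrow> 'v"
  assumes "0 \<le> h" "continuous_on {a..a+h} f" "\<And>x. a \<le> x \<Longrightarrow> x \<le> a + h \<Longrightarrow> norm (f x - v) \<le> e"
  shows "norm (integral {a..a+h} f - h *\<^sub>R v) \<le> h * e"
proof -
  have "integral {a..a+h} (\<lambda>x. f x - v) = integral {a..a+h} f - h *\<^sub>R v"
    using assms by (subst integral_diff) (auto intro: integrable_continuous_real)
  moreover have "norm (integral {a..a+h} (\<lambda>x. f x - v)) \<le> e * (a + h - a)"
    using assms by (intro integral_bound continuous_intros) auto
  ultimately show ?thesis by (simp add: mult.commute)
qed

text \<open>The time average of the orbit over \<open>[0, b]\<close> lies in the domain, its image
  under the generator being \<open>(T b f - f) / b\<close>, and it tends to \<open>f\<close> as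
  \<open>b\<close> tends to 0.\<close>

lemma gen_dense:
  assumes "0 < e"
  obtains f' g' where "gen f' g'" "norm (f - f') < e"
proof -
  have aux: "B - D = E - A" if "A + B = C" "D + E = C" for A B C D E :: 'v
  proof -
    have "B = C - A" "E = C - D" using that by (auto simp: eq_diff_eq add.commute)
    then show ?thesis by simp
  qed
  have e2: "0 < e / 2" using assms by simp
  obtain d where d: "0 < d" "\<And>h. 0 \<le> h \<Longrightarrow> h < d \<Longrightarrow> norm (T h f - f) < e / 2"
    using strong_continuity[OF e2, of f] by auto
  define b where "b = d / 2"
  have b: "0 < b" "b < d" using d by (auto simp: b_def)
  define u where "u t = T t f" for t
  have cont: "continuous_on S u" if "S \<subseteq> {0..}" for S
    unfolding u_def using continuous_on_orbit that by (rule continuous_on_subset)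
  have ui: "u integrable_on {s..t}" if "0 \<le> s" for s t
    using that by (intro integrable_continuous_real cont) auto
  define f' where "f' = (1 / b) *\<^sub>R integral {0..b} u"
  define g' where "g' = (1 / b) *\<^sub>R (u b - f)"
  have "norm (integral {0..0+b} u - b *\<^sub>R f) \<le> b * (e / 2)"
  proof (rule integral_close)
    show "norm (u x - f) \<le> e / 2" if "0 \<le> x" "x \<le> 0 + b" for x
      using d(2)[of x] that b by (simp add: u_def)
  qed (use b cont in auto)
  moreover have "f' - f = (1 / b) *\<^sub>R (integral {0..b} u - b *\<^sub>R f)"
    using b by (simp add: f'_def scaleR_diff_right)
  ultimately have "norm (f' - f) \<le> e / 2"
    using b by (simp add: pos_divide_le_eq mult.commute)
  then have close: "norm (f - f') < e" using assms by (simp add: norm_minus_commute)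
  have "gen f' g'"
    unfolding gen_def
  proof (intro allI impI)
    fix r :: real assume "0 < r"
    define r' where "r' = r * b / 2"
    have "0 < r'" using \<open>0 < r\<close> b by (simp add: r'_def)
    obtain q where q: "0 < q" "\<And>s t. 0 \<le> s \<Longrightarrow> s \<le> t \<Longrightarrow> t < s + q \<Longrightarrow> norm (T t f - T s f) < r'"
      by (rule orbit_uniform[OF \<open>0 < r'\<close>, of f]) (rule that)
    show "\<exists>d>0. \<forall>h. 0 < h \<and> h < d \<longrightarrow> norm (T h f' - f' - h *\<^sub>R g') \<le> h * r"
    proof (intro exI[of _ q] conjI allI impI q(1))
      fix h assume h: "0 < h \<and> h < q"
      have "T h (integral {0..b} u) = integral {0..b} (\<lambda>s. T h (u s))"
        using integral_linear[OF ui bounded_linear, of 0 h b] h by (simp add: o_def)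
      also have "\<dots> = integral {0..b} (u \<circ> (+) h)"
        using h by (intro integral_cong) (auto simp: u_def add)
      also have "\<dots> = integral {0+h..b+h} u"
        using has_integral_shift_Icc_real[of u h _ 0 b] ui[of h "b + h"] h
        by (intro integral_unique) (simp add: has_integral_integral[symmetric])
      finally have 1: "T h (integral {0..b} u) = integral {h..b+h} u" by simp
      \<comment> \<open>Both decompositions are those of the integral over
        \<open>[0, b + h]\<close>, so the overlap cancels whichever of \<open>b\<close> and
        \<open>h\<close> is larger.\<close>
      have "integral {0..h} u + integral {h..b+h} u = integral {0..b+h} u"
        using h b by (intro Henstock_Kurzweil_Integration.integral_combine ui) auto
      moreover have "integral {0..b} u + integral {b..b+h} u = integral {0..b+h} u"
        using h b by (intro Henstock_Kurzweil_Integration.integral_combine ui) auto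
      ultimately have 2: "T h (integral {0..b} u) - integral {0..b} u = integral {b..b+h} u - integral {0..h} u"
        unfolding 1 by (rule aux)
      have A: "norm (integral {b..b+h} u - h *\<^sub>R u b) \<le> h * r'"
        using q(2)[of b] h b by (intro integral_close cont) (auto simp: u_def intro!: less_imp_le)
      have B: "norm (integral {0..0+h} u - h *\<^sub>R u 0) \<le> h * r'"
        using q(2)[of 0] h by (intro integral_close cont) (auto simp: u_def intro!: less_imp_le)
      have "T h f' - f' - h *\<^sub>R g' = (1 / b) *\<^sub>R ((T h (integral {0..b} u) - integral {0..b} u) - h *\<^sub>R (u b - f))"
        using h by (simp add: f'_def g'_def scale scaleR_diff_right mult.commute)
      also have "\<dots> = (1 / b) *\<^sub>R ((integral {b..b+h} u - h *\<^sub>R u b) - (integral {0..0+h} u - h *\<^sub>R u 0))"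
        unfolding 2 by (simp add: u_def zero scaleR_diff_right)
      also have "norm \<dots> \<le> (1 / b) * (h * r' + h * r')"
        using A B b norm_triangle_ineq4[of "integral {b..b+h} u - h *\<^sub>R u b" "integral {0..0+h} u - h *\<^sub>R u 0"]
        by (simp add: divide_right_mono)
      also have "\<dots> = h * r" using b by (simp add: r'_def)
      finally show "norm (T h f' - f' - h *\<^sub>R g') \<le> h * r" .
    qed
  qed
  then show ?thesis using close by (rule that)
qed

end

section \<open>From \<open>C_0(E)\<close> to the continuous functions on
  \<open>[0,\<infinity>]\<close>\<close>

lemma C0D:
  assumes "g \<in> C0"
  shows "continuous_on {0..} g" "(g \<longlongrightarrow> 0) at_top"
  using assms by (auto simp: C0_def)

lemma extend_by_zero_simps [simp]:
  "extend_by_zero g \<top> = 0"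
  "0 \<le> x \<Longrightarrow> extend_by_zero g (ennreal x) = g x"
  by (simp_all add: extend_by_zero_def)

lemma continuous_on_extend_by_zero:
  assumes "g \<in> C0"
  shows "continuous_on UNIV (extend_by_zero g)"
  unfolding continuous_on_def
proof
  fix z :: ennreal
  show "(extend_by_zero g \<longlongrightarrow> extend_by_zero g z) (at z within UNIV)"
  proof (cases z)
    case (real x)
    have "(enn2real \<longlongrightarrow> x) (at z)"
      using tendsto_enn2real[of "\<lambda>z. z" x "at z"] real by simp
    then have "((\<lambda>y. g (enn2real y)) \<longlongrightarrow> g x) (at z)"
      using real by (intro continuous_on_tendsto_compose[OF C0D(1)[OF assms]]) auto
    moreover have "\<forall>\<^sub>F y in at z. g (enn2real y) = extend_by_zero g y"
    proof -
      have "\<forall>\<^sub>F y in at z. y < \<top>"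
        using order_tendstoD(2)[OF tendsto_ident_at, of z \<top> UNIV] real by simp
      then show ?thesis by eventually_elim (auto simp: extend_by_zero_def)
    qed
    ultimately have "(extend_by_zero g \<longlongrightarrow> g x) (at z)"
      by (rule Lim_transform_eventually)
    then show ?thesis using real by simp
  next
    case top
    show ?thesis
    proof (rule tendstoI)
      fix e :: real assume "0 < e"
      have "\<forall>\<^sub>F x in at_top. dist (g x) 0 < e"
        using C0D(2)[OF assms] \<open>0 < e\<close> by (rule tendstoD)
      then obtain m where m: "\<And>x. m \<le> x \<Longrightarrow> dist (g x) 0 < e"
        by (auto simp: eventually_at_top_linorder)
      have "\<forall>\<^sub>F y in at z. ennreal (max 0 m) < y"
        using order_tendstoD(1)[OF tendsto_ident_at, of "ennreal (max 0 m)" z UNIV] top by simp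
      then have "\<forall>\<^sub>F y in at z. dist (extend_by_zero g y) 0 < e"
      proof eventually_elim
        case (elim y)
        then show ?case
        proof (cases y)
          case (real r)
          then have "m \<le> r" using elim ennreal_leI[of r "max 0 m"] by (cases "m \<le> r") (auto simp: not_le[symmetric])
          then show ?thesis using m[of r] real by simp
        qed (use \<open>0 < e\<close> in simp)
      qed
      then show "\<forall>\<^sub>F y in at z within UNIV. dist (extend_by_zero g y) (extend_by_zero g z) < e"
        using top by simp
    qed
  qed
qed

lemma tendsto_ennreal_at_top: "(ennreal \<longlongrightarrow> \<top>) at_top"
proof -
  have "((\<lambda>x::real. 1 / (1 + x)) \<longlongrightarrow> 0) at_top" by real_asymp
  moreover have "\<forall>\<^sub>F x in at_top. 1 / (1 + x) = psi (ennreal x)"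
    using eventually_ge_at_top[of 0] by eventually_elim (simp add: psi_ennreal)
  ultimately have "((\<lambda>x. psi (ennreal x)) \<longlongrightarrow> 0) at_top" by (rule Lim_transform_eventually)
  then show ?thesis by (simp add: tendsto_psi_iff)
qed

lemma compact_UNIV_ennreal: "compact (UNIV :: ennreal set)"
  by (rule Extended_Real_Limits.compact_UNIV)

lemma bcontfun_ennreal:
  fixes f :: "ennreal \<Rightarrow> real"
  assumes "continuous_on UNIV f"
  shows "f \<in> bcontfun"
  using assms compact_imp_bounded[OF compact_continuous_image[OF assms compact_UNIV_ennreal]]
  by (simp add: bcontfun_def)

text \<open>The semigroup is given on \<open>C_0(E)\<close>, while the path functionals also see the
  cemetery. Subtracting the value there splits a continuous function on
  \<open>[0,\<infinity>]\<close> into a constant and an element of \<open>C_0(E)\<close>.\<close>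

definition centered :: "(ennreal \<Rightarrow>\<^sub>C real) \<Rightarrow> real \<Rightarrow> real" where
  "centered F x = F (ennreal x) - F \<top>"

lemma centered_C0: "centered F \<in> C0"
proof -
  have "continuous_on {0..} (\<lambda>x. F (ennreal x))"
    by (rule continuous_on_compose2[OF continuous_on_apply_bcontfun[of UNIV F] continuous_on_ennreal[OF continuous_on_id]]) auto
  moreover have "((\<lambda>x. F (ennreal x)) \<longlongrightarrow> F \<top>) at_top"
    by (rule continuous_on_tendsto_compose[OF continuous_on_apply_bcontfun[of UNIV F] tendsto_ennreal_at_top]) auto
  ultimately show ?thesis
    unfolding C0_def centered_def by (auto intro!: continuous_intros simp: LIM_zero)
qed

lemma extend_centered:
  fixes F :: "ennreal \<Rightarrow>\<^sub>C real"
  shows "F z = F \<top> + extend_by_zero (centered F) z"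
  by (cases z) (auto simp: centered_def)

locale feller =
  fixes \<kappa> :: "real \<Rightarrow> ennreal \<Rightarrow> ennreal measure"
  assumes feller: "feller_transition \<kappa>"
begin

lemma kernel: "0 \<le> t \<Longrightarrow> \<kappa> t \<in> borel \<rightarrow>\<^sub>M prob_algebra borel"
  using feller by (simp add: feller_transition_def)

lemma prob_kernel: "0 \<le> t \<Longrightarrow> prob_space (\<kappa> t z)"
  and sets_kernel: "0 \<le> t \<Longrightarrow> sets (\<kappa> t z) = sets borel"
  using measurable_space[OF kernel, of t z] by (auto simp: space_prob_algebra)

lemma apply_bcontfun_measurable [measurable]:
  fixes F :: "ennreal \<Rightarrow>\<^sub>C real"
  shows "apply_bcontfun F \<in> borel_measurable borel"
  by (rule borel_measurable_continuous_onI) simp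

lemma kernel_measurable: "0 \<le> t \<Longrightarrow> f \<in> borel_measurable borel \<Longrightarrow> f \<in> borel_measurable (\<kappa> t z)"
  using sets_kernel by (simp cong: measurable_cong_sets)

lemma integrable_kernel:
  fixes F :: "ennreal \<Rightarrow>\<^sub>C real"
  assumes "0 \<le> t"
  shows "integrable (\<kappa> t z) F"
proof -
  interpret prob_space "\<kappa> t z" using prob_kernel[OF assms] .
  show ?thesis
    using assms norm_bounded[of F] by (intro integrable_const_bound[of _ "norm F"] kernel_measurable) auto
qed

text \<open>The kernels are probability measures on \<open>[0,\<infinity>]\<close>, so the constant
  is preserved and only the part in \<open>C_0(E)\<close> is moved. This extends the Feller property
  to functions that do not vanish at the cemetery.\<close>

lemma kernel_integral_eq:
  fixes F :: "ennreal \<Rightarrow>\<^sub>C real"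
  assumes "0 \<le> t"
  shows "(\<integral>y. F y \<partial>\<kappa> t z) = F \<top> + extend_by_zero (semigroup_op \<kappa> t (centered F)) z"
proof -
  interpret prob_space "\<kappa> t z" using prob_kernel[OF assms] .
  have "extend_by_zero (centered F) y = F y - F \<top>" for y
    using extend_centered[of F y] by linarith
  then have "(\<integral>y. extend_by_zero (centered F) y \<partial>\<kappa> t z) = (\<integral>y. F y - F \<top> \<partial>\<kappa> t z)"
    by simp
  also have "\<dots> = (\<integral>y. F y \<partial>\<kappa> t z) - F \<top>"
    using integrable_kernel[OF assms] by (subst Bochner_Integration.integral_diff) (auto simp: prob_space)
  finally have *: "(\<integral>y. F y \<partial>\<kappa> t z) = F \<top> + (\<integral>y. extend_by_zero (centered F) y \<partial>\<kappa> t z)" by simp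
  show ?thesis
  proof (cases z)
    case (real x)
    then show ?thesis using * by (simp add: semigroup_op_def)
  next
    case top
    then have "\<kappa> t z = return borel \<top>" using feller assms by (simp add: feller_transition_def)
    then show ?thesis using top by (simp add: integral_return)
  qed
qed

definition trans_op :: "real \<Rightarrow> (ennreal \<Rightarrow>\<^sub>C real) \<Rightarrow> ennreal \<Rightarrow>\<^sub>C real" where
  "trans_op t F = Bcontfun (\<lambda>z. \<integral>y. F y \<partial>\<kappa> t z)"

lemma trans_op_apply:
  fixes F :: "ennreal \<Rightarrow>\<^sub>C real"
  assumes "0 \<le> t"
  shows "trans_op t F z = (\<integral>y. F y \<partial>\<kappa> t z)"
proof -
  have "semigroup_op \<kappa> t (centered F) \<in> C0"
    using feller centered_C0 assms by (simp add: feller_transition_def)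
  then have "continuous_on UNIV (\<lambda>z. \<integral>y. F y \<partial>\<kappa> t z)"
    unfolding kernel_integral_eq[OF assms] by (intro continuous_intros continuous_on_extend_by_zero)
  then show ?thesis
    unfolding trans_op_def by (subst Bcontfun_inverse) (auto intro: bcontfun_ennreal)
qed

lemma trans_op_eq:
  fixes F :: "ennreal \<Rightarrow>\<^sub>C real"
  shows "0 \<le> t \<Longrightarrow> trans_op t F z = F \<top> + extend_by_zero (semigroup_op \<kappa> t (centered F)) z"
  by (simp add: trans_op_apply kernel_integral_eq)

lemma trans_op_top:
  fixes F :: "ennreal \<Rightarrow>\<^sub>C real"
  shows "0 \<le> t \<Longrightarrow> trans_op t F \<top> = F \<top>"
  by (simp add: trans_op_eq)

lemma trans_op_ennreal:
  fixes F :: "ennreal \<Rightarrow>\<^sub>C real"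
  shows "0 \<le> t \<Longrightarrow> 0 \<le> x \<Longrightarrow> trans_op t F (ennreal x) = F \<top> + semigroup_op \<kappa> t (centered F) x"
  by (simp add: trans_op_eq)

lemma norm_ennreal_le:
  fixes F :: "ennreal \<Rightarrow>\<^sub>C real"
  assumes "\<bar>F \<top>\<bar> \<le> c" "\<And>x. 0 \<le> x \<Longrightarrow> \<bar>F (ennreal x)\<bar> \<le> c"
  shows "norm F \<le> c"
proof (rule norm_bound)
  fix z show "norm (F z) \<le> c" using assms by (cases z) auto
qed

sublocale contraction_semigroup trans_op
proof (rule contraction_semigroup.intro)
  fix t :: real and f :: "ennreal \<Rightarrow>\<^sub>C real" assume t: "0 \<le> t"
  show "norm (trans_op t f) \<le> norm f"
  proof (rule norm_bound)
    fix z
    interpret prob_space "\<kappa> t z" using prob_kernel[OF t] .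
    have "\<bar>\<integral>y. f y \<partial>\<kappa> t z\<bar> \<le> (\<integral>y. \<bar>f y\<bar> \<partial>\<kappa> t z)"
      by (rule integral_abs_bound)
    also have "\<dots> \<le> (\<integral>y. norm f \<partial>\<kappa> t z)"
      using norm_bounded[of f] integrable_kernel[OF t] by (intro integral_mono integrable_abs) auto
    finally have "\<bar>\<integral>y. f y \<partial>\<kappa> t z\<bar> \<le> (\<integral>y. norm f \<partial>\<kappa> t z)" .
    then show "norm (trans_op t f z) \<le> norm f" using t by (simp add: trans_op_apply prob_space)
  qed
next
  fix t :: real assume t: "0 \<le> t"
  show "linear (trans_op t)"
    using integrable_kernel[OF t]
    by (intro linearI bcontfun_eqI) (auto simp: trans_op_apply[OF t])
next
  fix f :: "ennreal \<Rightarrow>\<^sub>C real"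
  have "\<kappa> 0 z = return borel z" for z using feller by (simp add: feller_transition_def)
  then show "trans_op 0 f = f"
    by (intro bcontfun_eqI) (simp add: trans_op_apply integral_return)
next
  fix s t :: real and f :: "ennreal \<Rightarrow>\<^sub>C real" assume st: "0 \<le> s" "0 \<le> t"
  show "trans_op (s + t) f = trans_op s (trans_op t f)"
  proof (rule bcontfun_eqI)
    fix z
    interpret prob_space "\<kappa> s z" using prob_kernel[OF st(1)] .
    have "\<kappa> (s + t) z = \<kappa> s z \<bind> \<kappa> t" using feller st by (simp add: feller_transition_def)
    then have "trans_op (s + t) f z = (\<integral>y. f y \<partial>(\<kappa> s z \<bind> \<kappa> t))"
      using st by (simp add: trans_op_apply)
    also have "\<dots> = (\<integral>w. \<integral>y. f y \<partial>\<kappa> t w \<partial>\<kappa> s z)"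
    proof (rule integral_bind[where K = borel and B = "norm f" and B' = 1])
      show "\<kappa> t \<in> \<kappa> s z \<rightarrow>\<^sub>M subprob_algebra borel"
        using measurable_prob_algebraD[OF kernel[OF st(2)]] sets_kernel[OF st(1)] by (simp cong: measurable_cong_sets)
      show "AE x in \<kappa> s z. emeasure (\<kappa> t x) (space (\<kappa> t x)) \<le> ennreal 1"
        using prob_space.emeasure_space_1[OF prob_kernel[OF st(2)]] by simp
    qed (use norm_bounded[of f] finite_measure_axioms in auto)
    also have "\<dots> = trans_op s (trans_op t f) z" using st by (simp add: trans_op_apply)
    finally show "trans_op (s + t) f z = trans_op s (trans_op t f) z" .
  qed
next
  fix e :: real and f :: "ennreal \<Rightarrow>\<^sub>C real" assume e: "0 < e"
  have "uniform_limit {0..} (\<lambda>t. semigroup_op \<kappa> t (centered f)) (centered f) (at_right 0)"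
    using feller centered_C0 by (simp add: feller_transition_def)
  then have "\<forall>\<^sub>F t in at_right 0. \<forall>x\<in>{0..}. dist (semigroup_op \<kappa> t (centered f) x) (centered f x) < e / 2"
    using e by (intro uniform_limitD) auto
  then obtain d where d: "0 < d" "\<And>t x. 0 < t \<Longrightarrow> t < d \<Longrightarrow> 0 \<le> x \<Longrightarrow> \<bar>semigroup_op \<kappa> t (centered f) x - centered f x\<bar> < e / 2"
    by (auto simp: eventually_at_right_field dist_real_def)
  have T0: "trans_op 0 f = f"
    using feller by (intro bcontfun_eqI) (simp add: trans_op_apply integral_return feller_transition_def)
  show "\<exists>d>0. \<forall>h. 0 \<le> h \<and> h < d \<longrightarrow> norm (trans_op h f - f) < e"
  proof (intro exI[of _ d] conjI allI impI d(1))
    fix h assume h: "0 \<le> h \<and> h < d"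
    show "norm (trans_op h f - f) < e"
    proof (cases "h = 0")
      case False
      have "norm (trans_op h f - f) \<le> e / 2"
      proof (rule norm_ennreal_le)
        show "\<bar>(trans_op h f - f) (ennreal x)\<bar> \<le> e / 2" if "0 \<le> x" for x
          using d(2)[of h x] h False that by (simp add: trans_op_ennreal centered_def algebra_simps)
      qed (use h e in \<open>simp add: trans_op_top\<close>)
      then show ?thesis using e by simp
    qed (use T0 e in simp)
  qed
qed

text \<open>The cemetery is absorbing, so \<open>trans_op h F - F\<close> vanishes there for every
  \<open>h\<close>.\<close>

lemma gen_top:
  fixes F G :: "ennreal \<Rightarrow>\<^sub>C real"
  assumes "gen F G" shows "G \<top> = 0"
proof (rule ccontr)
  assume "G \<top> \<noteq> 0"
  then obtain d where d: "0 < d" "\<And>h. 0 < h \<Longrightarrow> h < d \<Longrightarrow> norm (trans_op h F - F - h *\<^sub>R G) \<le> h * (\<bar>G \<top>\<bar> / 2)"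
    using assms unfolding gen_def by (metis half_gt_zero zero_less_abs_iff)
  have "norm ((trans_op (d/2) F - F - (d/2) *\<^sub>R G) \<top>) \<le> (d/2) * (\<bar>G \<top>\<bar> / 2)"
    using d by (intro order_trans[OF norm_bounded d(2)]) auto
  then show False using d(1) \<open>G \<top> \<noteq> 0\<close> by (simp add: trans_op_top abs_mult)
qed

lemma gen_semigroup_generator:
  assumes "gen F G"
  shows "semigroup_generator \<kappa> (centered F) (centered G)"
proof -
  have "uniform_limit {0..} (\<lambda>t x. (semigroup_op \<kappa> t (centered F) x - centered F x) / t) (centered G) (at_right 0)"
  proof (rule uniform_limitI)
    fix e :: real assume "0 < e"
    then obtain d where d: "0 < d" "\<And>h. 0 < h \<Longrightarrow> h < d \<Longrightarrow> norm (trans_op h F - F - h *\<^sub>R G) \<le> h * (e / 2)"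
      using assms unfolding gen_def by (metis half_gt_zero)
    show "\<forall>\<^sub>F t in at_right 0. \<forall>x\<in>{0..}. dist ((semigroup_op \<kappa> t (centered F) x - centered F x) / t) (centered G x) < e"
      unfolding eventually_at_right_field
    proof (intro exI[of _ d] conjI allI impI ballI d(1))
      fix h x :: real assume h: "0 < h" "h < d" and x: "x \<in> {0..}"
      have "norm ((trans_op h F - F - h *\<^sub>R G) (ennreal x)) \<le> h * (e / 2)"
        using h by (intro order_trans[OF norm_bounded d(2)]) auto
      then have "\<bar>(semigroup_op \<kappa> h (centered F) x - centered F x) - h * centered G x\<bar> \<le> h * (e / 2)"
        using h x gen_top[OF assms] by (simp add: trans_op_ennreal centered_def algebra_simps)
      moreover have "(semigroup_op \<kappa> h (centered F) x - centered F x) - h * centered G x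
          = h * ((semigroup_op \<kappa> h (centered F) x - centered F x) / h - centered G x)"
        using h by (simp add: field_simps)
      ultimately have "h * \<bar>(semigroup_op \<kappa> h (centered F) x - centered F x) / h - centered G x\<bar> \<le> h * (e / 2)"
        using h by (simp add: abs_mult)
      then have "\<bar>(semigroup_op \<kappa> h (centered F) x - centered F x) / h - centered G x\<bar> \<le> e / 2"
        using h by simp
      then show "dist ((semigroup_op \<kappa> h (centered F) x - centered F x) / h) (centered G x) < e"
        using \<open>0 < e\<close> by (simp add: dist_real_def)
    qed
  qed
  then show ?thesis by (simp add: semigroup_generator_def centered_C0)
qed

end

section \<open>The generator of the random walk\<close>

text \<open>At the first site \<open>x - h\<close> is 0, where \<open>f\<close> is merely
  continuous, so derivatives may be used in the open interval only. Cauchy's mean value theorem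
  compares the symmetric difference \<open>\<phi>\<close> with the square of the increment, and the
  mean value theorem for \<open>f1\<close> then produces \<open>f2\<close>.\<close>

lemma second_difference:
  fixes f :: "real \<Rightarrow> real"
  assumes h: "0 < h" "h \<le> x" and cont: "continuous_on UNIV f"
    and f1: "\<And>x. 0 < x \<Longrightarrow> (f has_real_derivative f1 x) (at x)"
    and f2: "\<And>x. 0 < x \<Longrightarrow> (f1 has_real_derivative f2 x) (at x)"
  obtains \<xi> where "0 < \<xi>" "\<bar>\<xi> - x\<bar> < h" "f (x + h) + f (x - h) - 2 * f x = h\<^sup>2 * f2 \<xi>"
proof -
  define \<phi> where "\<phi> s = f (x + s) + f (x - s) - 2 * f x" for s
  have ic: "isCont f z" for z using cont by (simp add: continuous_on_eq_continuous_at)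
  have "\<exists>s>0. s < h \<and> (\<phi> h - \<phi> 0) * (2 * s) = (h\<^sup>2 - 0\<^sup>2) * (f1 (x + s) - f1 (x - s))"
  proof (rule GMVT'[of 0 h \<phi> "\<lambda>s. s\<^sup>2"])
    fix z assume z: "0 < z" "z < h"
    show "((\<lambda>s. s\<^sup>2) has_real_derivative 2 * z) (at z)"
      by (auto intro!: derivative_eq_intros)
    have "((\<lambda>s. f (x + s)) has_real_derivative f1 (x + z) * 1) (at z)"
      using z h by (intro DERIV_chain2[of f "f1 (x + z)" "\<lambda>s. x + s"] f1) (auto intro!: derivative_eq_intros)
    moreover have "((\<lambda>s. f (x - s)) has_real_derivative f1 (x - z) * (- 1)) (at z)"
      using z h by (intro DERIV_chain2[of f "f1 (x - z)" "\<lambda>s. x - s"] f1) (auto intro!: derivative_eq_intros)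
    ultimately show "(\<phi> has_real_derivative f1 (x + z) - f1 (x - z)) (at z)"
      unfolding \<phi>_def by (auto intro!: derivative_eq_intros)
  next
    fix z
    have "isCont (\<lambda>s. f (x + s)) z" by (rule isCont_o2[OF _ ic]) simp
    moreover have "isCont (\<lambda>s. f (x - s)) z" by (rule isCont_o2[OF _ ic]) simp
    ultimately show "isCont \<phi> z" unfolding \<phi>_def by (intro continuous_intros)
  qed (use h in auto)
  then obtain s where s: "0 < s" "s < h" "\<phi> h * (2 * s) = h\<^sup>2 * (f1 (x + s) - f1 (x - s))"
    by (auto simp: \<phi>_def)
  obtain \<xi> where \<xi>: "x - s < \<xi>" "\<xi> < x + s" "f1 (x + s) - f1 (x - s) = (x + s - (x - s)) * f2 \<xi>"
    using MVT2[of "x - s" "x + s" f1 f2] s h f2 by auto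
  have "\<phi> h * (2 * s) = (h\<^sup>2 * f2 \<xi>) * (2 * s)" using s(3) \<xi>(3) by simp
  then have "\<phi> h = h\<^sup>2 * f2 \<xi>" using s(1) by simp
  then show ?thesis
    using \<xi> s h by (intro that[of \<xi>]) (auto simp: \<phi>_def abs_if)
qed

lemma C0_uniformly_continuous:
  assumes "g \<in> C0" "0 < e"
  obtains d where "0 < d" "\<And>x y. 0 \<le> x \<Longrightarrow> 0 \<le> y \<Longrightarrow> \<bar>x - y\<bar> < d \<Longrightarrow> \<bar>g x - g y\<bar> < e"
proof -
  have "\<forall>\<^sub>F x in at_top. dist (g x) 0 < e / 2"
    using C0D(2)[OF assms(1)] assms(2) by (intro tendstoD) auto
  then obtain m where m: "\<And>x. m \<le> x \<Longrightarrow> \<bar>g x\<bar> < e / 2"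
    by (auto simp: eventually_at_top_linorder)
  have "uniformly_continuous_on {0..max 0 m + 1} g"
    by (intro compact_uniformly_continuous continuous_on_subset[OF C0D(1)[OF assms(1)]]) auto
  then obtain d where d: "0 < d" "\<And>x y. x \<in> {0..max 0 m + 1} \<Longrightarrow> y \<in> {0..max 0 m + 1} \<Longrightarrow> dist y x < d \<Longrightarrow> dist (g y) (g x) < e"
    using assms(2) unfolding uniformly_continuous_on_def by metis
  show ?thesis
  proof (rule that[of "min d 1"])
    fix x y :: real assume xy: "0 \<le> x" "0 \<le> y" "\<bar>x - y\<bar> < min d 1"
    show "\<bar>g x - g y\<bar> < e"
    proof (cases "x \<le> max 0 m + 1 \<and> y \<le> max 0 m + 1")
      case True
      then show ?thesis using d(2)[of y x] xy by (auto simp: dist_real_def)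
    next
      case False
      then have "m \<le> x" "m \<le> y" using xy by auto
      then show ?thesis using m[of x] m[of y] by linarith
    qed
  qed (use d in auto)
qed

definition scaled :: "nat \<Rightarrow> enat \<Rightarrow> ennreal" where
  "scaled n x = ennreal_of_enat x / of_nat n"

lemma scaled_enat: "0 < n \<Longrightarrow> scaled n (enat i) = ennreal (real i / real n)"
  by (simp add: scaled_def ennreal_of_nat_eq_real_of_nat divide_ennreal)

lemma scaled_infinity [simp]: "scaled n \<infinity> = \<top>"
  by (simp add: scaled_def ennreal_top_divide)

section \<open>The boundary measure and the jumps from 0\<close>

locale boundary_params =
  fixes p1 p2 p3 :: real and p4 :: "real measure"
  assumes p1: "0 \<le> p1" and p2: "0 \<le> p2" and p3: "0 < p3"
    and sets_p4: "sets p4 = sets (restrict_space borel {0<..})"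
    and finite_p4: "(\<integral>\<^sup>+ x. ennreal (min x 1) \<partial>p4) < \<infinity>"
begin

lemma space_p4: "space p4 = {0<..}"
  using sets_eq_imp_space_eq[OF sets_p4] by (simp add: space_restrict_space)

lemma measurable_p4: "f \<in> borel_measurable borel \<Longrightarrow> f \<in> borel_measurable p4"
  unfolding measurable_cong_sets[OF sets_p4 refl] by (rule measurable_restrict_space1)

lemma integrable_min: "integrable p4 (\<lambda>x. min x 1)"
proof (rule integrableI_bounded)
  have "(\<integral>\<^sup>+ x. ennreal (norm (min x 1)) \<partial>p4) = (\<integral>\<^sup>+ x. ennreal (min x 1) \<partial>p4)"
    by (intro nn_integral_cong) (auto simp: space_p4)
  then show "(\<integral>\<^sup>+ x. ennreal (norm (min x 1)) \<partial>p4) < \<infinity>" using finite_p4 by simp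
qed (intro measurable_p4, measurable)

definition jump_mass :: real where "jump_mass = (\<integral>x. min x 1 \<partial>p4)"

lemma jump_mass_nonneg: "0 \<le> jump_mass"
  unfolding jump_mass_def by (intro integral_nonneg_AE AE_I2) (auto simp: space_p4)

lemma integrable_dominated:
  fixes f :: "real \<Rightarrow> real"
  assumes "f \<in> borel_measurable borel" "\<And>x. 0 < x \<Longrightarrow> \<bar>f x\<bar> \<le> c * min x 1"
  shows "integrable p4 f" "\<bar>\<integral>x. f x \<partial>p4\<bar> \<le> c * jump_mass"
proof -
  have int: "integrable p4 (\<lambda>x. c * min x 1)" using integrable_min by simp
  show *: "integrable p4 f"
    by (rule Bochner_Integration.integrable_bound[OF int measurable_p4[OF assms(1)]])
      (use assms(2) in \<open>auto intro!: AE_I2 order_trans[OF _ abs_ge_self] simp: space_p4\<close>)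
  have "\<bar>\<integral>x. f x \<partial>p4\<bar> \<le> (\<integral>x. \<bar>f x\<bar> \<partial>p4)" by (rule integral_abs_bound)
  also have "\<dots> \<le> (\<integral>x. c * min x 1 \<partial>p4)"
    using assms(2) by (intro integral_mono integrable_abs * int) (auto simp: space_p4)
  finally show "\<bar>\<integral>x. f x \<partial>p4\<bar> \<le> c * jump_mass" by (simp add: jump_mass_def)
qed

text \<open>
  Up to the factor \<open>n\<^sup>2 p\<^sub>3\<close>, the weights of the jumps to \<open>j \<ge> 2\<close> are the \<open>p\<^sub>4\<close>-masses of these cells, so sums
  over the jumps are \<open>p\<^sub>4\<close>-integrals of step functions.
\<close>

definition cell :: "nat \<Rightarrow> nat \<Rightarrow> real set" where
  "cell n j = {real j / real n <.. real (j + 1) / real n}"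

definition cell_fun :: "nat \<Rightarrow> (nat \<Rightarrow> real) \<Rightarrow> real \<Rightarrow> real" where
  "cell_fun n v x = (\<Sum>j\<in>{2..<n\<^sup>2}. v j * indicator (cell n j) x)"

lemma cell_iff: "0 < n \<Longrightarrow> x \<in> cell n j \<longleftrightarrow> real j < real n * x \<and> real n * x \<le> real j + 1"
  by (auto simp: cell_def field_simps)

lemma cell_fun_in:
  assumes "0 < n" "x \<in> cell n j" "2 \<le> j" "j < n\<^sup>2"
  shows "cell_fun n v x = v j"
proof -
  have "x \<notin> cell n i" if "i \<noteq> j" for i
  proof
    assume "x \<in> cell n i"
    then have "real i < real j + 1" "real j < real i + 1"
      using assms(2) cell_iff[OF assms(1)] by (auto intro: less_le_trans)
    then show False using that by linarith
  qed
  then have "cell_fun n v x = (\<Sum>i\<in>{2..<n\<^sup>2}. if i = j then v j else 0)"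
    unfolding cell_fun_def using assms(2) by (intro sum.cong) (auto simp: indicator_def)
  then show ?thesis using assms by simp
qed

text \<open>A cell lies to the right of its left endpoint and \<open>min x 1\<close> is increasing,
  so a bound at the endpoints holds on whole cells. This gives a majorant independent of
  \<open>n\<close>.\<close>

lemma cell_fun_bound:
  assumes "0 < n" "0 < x" "0 \<le> c" and v: "\<And>j. 2 \<le> j \<Longrightarrow> j < n\<^sup>2 \<Longrightarrow> \<bar>v j\<bar> \<le> c * min (real j / real n) 1"
  shows "\<bar>cell_fun n v x\<bar> \<le> c * min x 1"
proof (cases "\<exists>j\<in>{2..<n\<^sup>2}. x \<in> cell n j")
  case True
  then obtain j where j: "2 \<le> j" "j < n\<^sup>2" "x \<in> cell n j" by auto
  have "\<bar>cell_fun n v x\<bar> \<le> c * min (real j / real n) 1"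
    using cell_fun_in[OF assms(1) j(3,1,2)] v[OF j(1,2)] by simp
  also have "\<dots> \<le> c * min x 1"
    using j(3) assms(3) by (intro mult_left_mono) (auto simp: cell_def)
  finally show ?thesis .
next
  case False
  then have "cell_fun n v x = 0" unfolding cell_fun_def by (intro sum.neutral) (auto simp: indicator_def)
  then show ?thesis using assms by simp
qed

lemma cell_fun_measurable: "cell_fun n v \<in> borel_measurable borel"
  unfolding cell_fun_def cell_def by measurable

lemma integral_cell_fun:
  assumes "0 < n"
  shows "(\<integral>x. cell_fun n v x \<partial>p4) = (\<Sum>j\<in>{2..<n\<^sup>2}. v j * measure p4 (cell n j))"
proof -
  have inter: "cell n j \<inter> space p4 = cell n j" for j
    using assms by (auto simp: space_p4 cell_def intro: le_less_trans[rotated])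
  have "integrable p4 (\<lambda>x. v j * indicator (cell n j) x) \<and> (\<integral>x. v j * indicator (cell n j) x \<partial>p4) = v j * measure p4 (cell n j)"
    if j: "j \<in> {2..<n\<^sup>2}" for j
  proof -
    have int: "integrable p4 (indicator (cell n j) :: real \<Rightarrow> real)"
    proof (rule integrable_dominated(1))
      fix x :: real assume "0 < x"
      \<comment> \<open>Near 0 the measure \<open>p4\<close> may be infinite, but the cells with
        \<open>j \<ge> 2\<close> stay to the right of \<open>1 / n\<close>, where
        \<open>n * min x 1\<close> is at least 1.\<close>
      show "\<bar>indicator (cell n j) x\<bar> \<le> real n * min x 1"
      proof (cases "x \<in> cell n j")
        case True
        then have "1 \<le> real n * x" using cell_iff[OF assms] j by auto
        then show ?thesis using assms \<open>0 < x\<close> True by (auto simp: min_def)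
      qed (use \<open>0 < x\<close> in simp)
    qed (simp add: cell_def)
    then show ?thesis by (simp add: inter)
  qed
  then show ?thesis
    unfolding cell_fun_def by (subst Bochner_Integration.integral_sum) (auto simp: inter)
qed

text \<open>For large \<open>n\<close> the point \<open>x\<close> lies in one of the cells, whose
  left endpoint \<open>r n\<close> is within \<open>1 / n\<close> of it. Cells are open on the left,
  hence the ceiling minus 1 as index.\<close>

lemma cell_fun_tendsto:
  assumes "continuous_on UNIV f" "0 < x"
  shows "(\<lambda>n. cell_fun n (\<lambda>j. f (real j / real n) - f 0) x) \<longlonglongrightarrow> f x - f 0"
proof -
  define r where "r n = real (nat (\<lceil>real n * x\<rceil> - 1)) / real n" for n :: nat
  \<comment> \<open>From \<open>2 / x < n\<close> the index of the cell of \<open>x\<close> is at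
    least 2, and from \<open>x < n\<close> it is below \<open>n^2\<close>: both truncations of the
    jump range disappear in the limit.\<close>
  obtain N :: nat where N: "max 1 (max (2 / x) x) < real N" using reals_Archimedean2 by blast
  have ev: "cell_fun n (\<lambda>j. f (real j / real n) - f 0) x = f (r n) - f 0 \<and> \<bar>r n - x\<bar> \<le> 1 / real n" if "N \<le> n" for n
  proof -
    have n: "1 < real n" "2 / x < real n" "x < real n" using N that by auto
    then have n0: "0 < n" by simp
    have n2: "2 < real n * x" using n assms(2) by (simp add: field_simps)
    have n3: "real n * x \<le> real n * real n" using n by (intro mult_left_mono) auto
    define j where "j = nat (\<lceil>real n * x\<rceil> - 1)"
    have "2 < \<lceil>real n * x\<rceil>" using n2 by linarith
    then have j2: "real j = real_of_int \<lceil>real n * x\<rceil> - 1" "2 \<le> real_of_int \<lceil>real n * x\<rceil> - 1"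
      unfolding j_def by linarith+
    then have j: "2 \<le> j" "real j = real_of_int \<lceil>real n * x\<rceil> - 1" by linarith+
    have c: "real j < real n * x" "real n * x \<le> real j + 1" using j(2) by linarith+
    have "real j < real n * real n" using c n3 by linarith
    then have "real j < real (n\<^sup>2)" by (simp add: power2_eq_square)
    then have "j < n\<^sup>2" by (simp only: of_nat_less_iff)
    then have "cell_fun n (\<lambda>j. f (real j / real n) - f 0) x = f (r n) - f 0"
      using cell_fun_in[OF n0 _ j(1), of x] cell_iff[OF n0] c by (simp add: r_def flip: j_def)
    moreover have "real n * \<bar>r n - x\<bar> \<le> 1"
    proof -
      have "real n * \<bar>r n - x\<bar> = \<bar>real n * (r n - x)\<bar>" by (simp add: abs_mult)
      also have "real n * (r n - x) = real j - real n * x"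
        using n0 by (simp add: r_def right_diff_distrib flip: j_def)
      finally show ?thesis using c by simp
    qed
    ultimately show ?thesis using n by (simp add: field_simps)
  qed
  have "(\<lambda>n. r n - x) \<longlonglongrightarrow> 0"
  proof (rule Lim_null_comparison)
    show "\<forall>\<^sub>F n in sequentially. norm (r n - x) \<le> 1 / real n"
      using eventually_ge_at_top[of N] by eventually_elim (use ev in simp)
    show "(\<lambda>n. 1 / real n) \<longlonglongrightarrow> 0" by (rule lim_1_over_n)
  qed
  then have "r \<longlonglongrightarrow> x" by (simp add: LIM_zero_iff)
  then have "(\<lambda>n. f (r n) - f 0) \<longlonglongrightarrow> f x - f 0"
    by (intro tendsto_diff continuous_on_tendsto_compose[OF assms(1)]) auto
  moreover have "\<forall>\<^sub>F n in sequentially. f (r n) - f 0 = cell_fun n (\<lambda>j. f (real j / real n) - f 0) x"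
    using eventually_ge_at_top[of N] by eventually_elim (use ev in simp)
  ultimately show ?thesis by (rule Lim_transform_eventually)
qed

definition admissible :: "nat \<Rightarrow> bool" where
  "admissible n \<longleftrightarrow> 2 \<le> n \<and> 0 \<le> jump_weight p1 p2 p3 p4 n 0"

abbreviation jm :: "nat \<Rightarrow> enat pmf" where
  "jm \<equiv> jumping_measure p1 p2 p3 p4"

abbreviation step :: "nat \<Rightarrow> enat \<Rightarrow> enat pmf" where
  "step n \<equiv> brw_step (jm n)"

definition walk_gen :: "nat \<Rightarrow> (ennreal \<Rightarrow> real) \<Rightarrow> enat \<Rightarrow> real" where
  "walk_gen n F x = (real n)\<^sup>2 * ((\<integral>y. F (scaled n y) \<partial>step n x) - F (scaled n x))"

lemma four_le_square: "2 \<le> n \<Longrightarrow> 4 \<le> (n::nat)\<^sup>2"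
  using power_mono[of 2 n 2] by simp

lemma suminf_jump_weight_pos:
  assumes "2 \<le> n"
  shows "(\<Sum>j. jump_weight_pos p2 p3 p4 n (Suc j)) =
    p2 / (real n * p3) + (\<Sum>j\<in>{2..<n\<^sup>2}. measure p4 (cell n j)) / ((real n)\<^sup>2 * p3)"
proof -
  let ?v = "jump_weight_pos p2 p3 p4 n"
  have n4: "4 \<le> n\<^sup>2" using four_le_square[OF assms] .
  have "(\<Sum>j. ?v (Suc j)) = (\<Sum>j\<in>{0..<n\<^sup>2 - 1}. ?v (Suc j))"
    using n4 by (intro suminf_finite) (auto simp: jump_weight_pos_def)
  also have "\<dots> = (\<Sum>j\<in>{1..<n\<^sup>2}. ?v j)"
  proof -
    have "Suc (n\<^sup>2 - 1) = n\<^sup>2" using n4 by linarith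
    then show ?thesis using sum.shift_bounds_Suc_ivl[of ?v 0 "n\<^sup>2 - 1"] by (simp only: One_nat_def)
  qed
  also have "\<dots> = ?v 1 + (\<Sum>j\<in>{2..<n\<^sup>2}. ?v j)"
    using n4 by (subst sum.atLeast_Suc_lessThan) (auto simp: numeral_2_eq_2)
  also have "(\<Sum>j\<in>{2..<n\<^sup>2}. ?v j) = (\<Sum>j\<in>{2..<n\<^sup>2}. measure p4 (cell n j) / ((real n)\<^sup>2 * p3))"
    by (intro sum.cong) (auto simp: jump_weight_pos_def cell_def)
  finally show ?thesis by (simp add: jump_weight_pos_def sum_divide_distrib)
qed

text \<open>The cells carry total mass at most \<open>n * jump_mass\<close>, as
  \<open>n * min x 1\<close> is at least 1 on them. After division by \<open>n^2 * p3\<close> the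
  weight of the long jumps is of order \<open>1 / n\<close>, like that of the step to 1.\<close>

lemma eventually_admissible: "\<forall>\<^sub>F n in sequentially. admissible n"
proof -
  have lim: "(\<lambda>n. p1 / ((real n)\<^sup>2 * p3) + p2 / (real n * p3) + jump_mass / (real n * p3)) \<longlonglongrightarrow> 0"
    using p3 by real_asymp
  then have "\<forall>\<^sub>F n in sequentially. p1 / ((real n)\<^sup>2 * p3) + p2 / (real n * p3) + jump_mass / (real n * p3) < 1"
    by (rule order_tendstoD) simp
  then show ?thesis
    using eventually_ge_at_top[of 2]
  proof eventually_elim
    case (elim n)
    then have n: "0 < n" by simp
    have "(\<integral>x. cell_fun n (\<lambda>_. 1) x \<partial>p4) \<le> real n * jump_mass"
    proof -
      have "\<bar>\<integral>x. cell_fun n (\<lambda>_. 1) x \<partial>p4\<bar> \<le> real n * jump_mass"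
        using n by (intro integrable_dominated cell_fun_measurable cell_fun_bound) (auto simp: min_def field_simps)
      then show ?thesis by simp
    qed
    then have "(\<Sum>j\<in>{2..<n\<^sup>2}. measure p4 (cell n j)) / ((real n)\<^sup>2 * p3) \<le> (real n * jump_mass) / ((real n)\<^sup>2 * p3)"
      using n p3 by (intro divide_right_mono) (auto simp: integral_cell_fun)
    also have "\<dots> = jump_mass / (real n * p3)" using n by (simp add: power2_eq_square)
    finally show ?case
      using elim suminf_jump_weight_pos[OF elim(2)]
      by (simp add: admissible_def jump_weight_def zero_enat_def)
  qed
qed

lemma walk_gen_infinity: "walk_gen n F \<infinity> = 0"
  by (simp add: walk_gen_def)

lemma walk_gen_Suc:
  assumes "0 < n"
  shows "walk_gen n F (enat (Suc i)) = (real n)\<^sup>2 / 2 *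
    (F (ennreal (real i / real n)) + F (ennreal (real (i + 2) / real n)) - 2 * F (ennreal (real (Suc i) / real n)))"
  using assms by (simp add: walk_gen_def integral_pmf_of_set scaled_enat field_simps)

lemma walk_gen_0:
  assumes "admissible n"
  shows "walk_gen n F 0 = p1 / p3 * (F \<top> - F 0) + p2 / p3 * (real n * (F (ennreal (1 / real n)) - F 0))
    + (\<integral>x. cell_fun n (\<lambda>j. F (ennreal (real j / real n)) - F 0) x \<partial>p4) / p3"
proof -
  let ?w = "jump_weight p1 p2 p3 p4 n"
  define g where "g y = F (scaled n y) - F 0" for y
  have n: "2 \<le> n" "0 < n" "0 \<le> ?w 0" using assms by (auto simp: admissible_def)
  have pmf: "pmf (jm n) x = ?w x" for x
    by (rule pmf_jumping_measure[OF p1 p2 p3 n(1,3)])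
  define S where "S = insert \<infinity> (enat ` {..<n\<^sup>2})"
  have out: "?w x = 0" if "x \<notin> S" for x
  proof (cases x)
    case (enat j)
    then have "n\<^sup>2 \<le> j" using that by (force simp: S_def not_le[symmetric])
    then show ?thesis using enat four_le_square[OF n(1)] by (auto simp: jump_weight_def jump_weight_pos_def)
  qed (use that in \<open>simp add: S_def\<close>)
  have "set_pmf (jm n) \<subseteq> S" using out pmf by (auto simp: set_pmf_eq)
  then have fin: "finite (set_pmf (jm n))" by (rule finite_subset) (simp add: S_def)
  have "(\<integral>y. F (scaled n y) \<partial>jm n) - F 0 = (\<integral>y. g y \<partial>jm n)"
    unfolding g_def using fin by (subst Bochner_Integration.integral_diff) (auto simp: integrable_measure_pmf_finite)
  also have "\<dots> = (\<Sum>y\<in>S. pmf (jm n) y * g y)"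
    using \<open>set_pmf (jm n) \<subseteq> S\<close> by (subst integral_measure_pmf[of S]) (auto simp: S_def)
  also have "\<dots> = ?w \<infinity> * g \<infinity> + (\<Sum>j<n\<^sup>2. ?w (enat j) * g (enat j))"
    unfolding S_def pmf by (subst sum.insert) (auto simp: sum.reindex inj_on_def)
  \<comment> \<open>The increment at 0 vanishes, so the holding probability drops out of the
    sum.\<close>
  also have "(\<Sum>j<n\<^sup>2. ?w (enat j) * g (enat j)) = (\<Sum>j\<in>{1..<n\<^sup>2}. ?w (enat j) * g (enat j))"
    using n by (intro sum.mono_neutral_right) (auto simp: g_def scaled_enat zero_enat_def[symmetric] not_le) 
  also have "\<dots> = ?w 1 * g 1 + (\<Sum>j\<in>{2..<n\<^sup>2}. ?w (enat j) * g (enat j))"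
    using four_le_square[OF n(1)] by (subst sum.atLeast_Suc_lessThan) (auto simp: numeral_2_eq_2 one_enat_def)
  also have "(\<Sum>j\<in>{2..<n\<^sup>2}. ?w (enat j) * g (enat j)) =
      (\<Sum>j\<in>{2..<n\<^sup>2}. (F (ennreal (real j / real n)) - F 0) * measure p4 (cell n j)) / ((real n)\<^sup>2 * p3)"
    unfolding sum_divide_distrib using n
    by (intro sum.cong) (auto simp: jump_weight_def jump_weight_pos_def g_def scaled_enat cell_def)
  also have "\<dots> = (\<integral>x. cell_fun n (\<lambda>j. F (ennreal (real j / real n)) - F 0) x \<partial>p4) / ((real n)\<^sup>2 * p3)"
    using n by (simp add: integral_cell_fun)
  finally have "(\<integral>y. F (scaled n y) \<partial>jm n) - F 0 = p1 / ((real n)\<^sup>2 * p3) * (F \<top> - F 0)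
     + (p2 / (real n * p3) * (F (ennreal (1 / real n)) - F 0)
     + (\<integral>x. cell_fun n (\<lambda>j. F (ennreal (real j / real n)) - F 0) x \<partial>p4) / ((real n)\<^sup>2 * p3))"
    using n by (simp add: jump_weight_def jump_weight_pos_def g_def scaled_enat one_enat_def)
  moreover have "scaled n 0 = 0" using scaled_enat[OF n(2), of 0] by (simp add: zero_enat_def)
  ultimately have "walk_gen n F 0 = (real n)\<^sup>2 * (p1 / ((real n)\<^sup>2 * p3) * (F \<top> - F 0)
     + (p2 / (real n * p3) * (F (ennreal (1 / real n)) - F 0)
     + (\<integral>x. cell_fun n (\<lambda>j. F (ennreal (real j / real n)) - F 0) x \<partial>p4) / ((real n)\<^sup>2 * p3)))"
    by (simp add: walk_gen_def zero_enat_def)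
  then show ?thesis
    using n p3 by (simp add: distrib_left power2_eq_square)
qed

text \<open>The 1 covers the second differences at positive sites. The fraction collects the bounds
  at 0: killing costs at most twice the norm, the step to 1 the derivative, and the long jumps a
  combination of both.\<close>

definition gen_const :: real where "gen_const = 1 + (2 * p1 + p2 + 2 * jump_mass) / p3"

lemma gen_const_pos: "0 < gen_const"
  unfolding gen_const_def using p1 p2 p3 jump_mass_nonneg by (intro add_pos_nonneg divide_nonneg_pos) auto

lemma continuous_on_real_bcontfun:
  fixes F :: "ennreal \<Rightarrow>\<^sub>C real"
  shows "continuous_on UNIV (\<lambda>x. F (ennreal x))"
  by (rule continuous_on_compose2[OF continuous_on_apply_bcontfun[of UNIV F] continuous_on_ennreal[OF continuous_on_id]]) auto

text \<open>Small jumps are controlled by the derivative, large ones by the norm; this matches the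
  integrability of \<open>min x 1\<close> under \<open>p4\<close>.\<close>

lemma increment_bound:
  fixes F :: "ennreal \<Rightarrow>\<^sub>C real"
  assumes f1: "\<And>x. 0 < x \<Longrightarrow> ((\<lambda>x. F (ennreal x)) has_real_derivative f1 x) (at x)"
    and b: "\<And>x. 0 < x \<Longrightarrow> \<bar>f1 x\<bar> \<le> b" and y: "0 \<le> y"
  shows "\<bar>F (ennreal y) - F 0\<bar> \<le> b * y" "\<bar>F (ennreal y) - F 0\<bar> \<le> (2 * norm F + b) * min y 1"
proof -
  have "0 \<le> b" using b[of 1] by simp
  show 1: "\<bar>F (ennreal y) - F 0\<bar> \<le> b * y"
  proof (cases "y = 0")
    case False
    then have "0 < y" using y by simp
    have "\<exists>l z. 0 < z \<and> z < y \<and> ((\<lambda>x. F (ennreal x)) has_real_derivative l) (at z) \<and>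
        F (ennreal y) - F (ennreal 0) = (y - 0) * l"
      using f1 by (intro MVT[OF \<open>0 < y\<close>] continuous_on_subset[OF continuous_on_real_bcontfun])
        (auto simp: real_differentiable_def)
    then obtain l z where z: "0 < z" "z < y" "((\<lambda>x. F (ennreal x)) has_real_derivative l) (at z)"
        "F (ennreal y) - F 0 = y * l" by auto
    have "l = f1 z" using DERIV_unique[OF z(3) f1[OF z(1)]] .
    then have "\<bar>F (ennreal y) - F 0\<bar> = y * \<bar>f1 z\<bar>" using z y by (simp add: abs_mult)
    also have "\<dots> \<le> y * b" using b[OF z(1)] y by (intro mult_left_mono)
    finally show ?thesis by (simp add: mult.commute)
  qed simp
  have 2: "\<bar>F (ennreal y) - F 0\<bar> \<le> 2 * norm F"
    using norm_bounded[of F "ennreal y"] norm_bounded[of F 0] by (simp add: abs_if split: if_splits)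
  show "\<bar>F (ennreal y) - F 0\<bar> \<le> (2 * norm F + b) * min y 1"
  proof (cases "y \<le> 1")
    case True
    have "b * y \<le> (2 * norm F + b) * y" using y by (intro mult_right_mono) auto
    then show ?thesis using 1 True by simp
  next
    case False
    then show ?thesis using 2 \<open>0 \<le> b\<close> by simp
  qed
qed

text \<open>The boundary condition is not assumed of \<open>F\<close>. The bound therefore serves
  twice: for functions in the domain, where it makes the convergence uniform in time, and for the
  squared distance to a point, where it limits the frequency of exits.\<close>

lemma walk_gen_bound:
  fixes F :: "ennreal \<Rightarrow>\<^sub>C real"
  assumes n: "admissible n"
    and f1: "\<And>x. 0 < x \<Longrightarrow> ((\<lambda>x. F (ennreal x)) has_real_derivative f1 x) (at x)"
    and f2: "\<And>x. 0 < x \<Longrightarrow> (f1 has_real_derivative f2 x) (at x)"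
    and b: "\<And>x. 0 < x \<Longrightarrow> \<bar>f1 x\<bar> \<le> b" and c: "\<And>x. 0 < x \<Longrightarrow> \<bar>f2 x\<bar> \<le> c"
  shows "\<bar>walk_gen n F x\<bar> \<le> gen_const * (norm F + b + c)"
proof -
  have n0: "0 < n" using n by (auto simp: admissible_def)
  have b0: "0 \<le> b" and c0: "0 \<le> c" using b[of 1] c[of 1] by auto
  have C1: "1 \<le> gen_const" unfolding gen_const_def using p1 p2 p3 jump_mass_nonneg by simp
  consider "x = \<infinity>" | "x = 0" | i where "x = enat (Suc i)"
    by (metis enat.exhaust not0_implies_Suc zero_enat_def)
  then show ?thesis
  proof cases
    case 1
    then show ?thesis using b0 c0 gen_const_pos by (simp add: walk_gen_infinity)
  next
    case 2
    have "\<bar>p1 / p3 * (F \<top> - F 0)\<bar> \<le> p1 / p3 * (2 * norm F)"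
      using p1 p3 norm_bounded[of F \<top>] norm_bounded[of F 0] unfolding abs_mult
      by (intro mult_mono) (auto simp: abs_if split: if_splits)
    moreover have "\<bar>p2 / p3 * (real n * (F (ennreal (1 / real n)) - F 0))\<bar> \<le> p2 / p3 * b"
    proof -
      have "real n * \<bar>F (ennreal (1 / real n)) - F 0\<bar> \<le> real n * (b * (1 / real n))"
        by (intro mult_left_mono increment_bound(1)[OF f1 b]) auto
      then show ?thesis using n0 p2 p3 unfolding abs_mult by (intro mult_mono) auto
    qed
    moreover have "\<bar>(\<integral>x. cell_fun n (\<lambda>j. F (ennreal (real j / real n)) - F 0) x \<partial>p4) / p3\<bar> \<le> (2 * norm F + b) * jump_mass / p3"
    proof -
      have "\<bar>\<integral>x. cell_fun n (\<lambda>j. F (ennreal (real j / real n)) - F 0) x \<partial>p4\<bar> \<le> (2 * norm F + b) * jump_mass"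
        using n0 b0 by (intro integrable_dominated cell_fun_measurable cell_fun_bound increment_bound(2)[OF f1 b]) auto
      then show ?thesis using p3 by (simp add: divide_right_mono)
    qed
    ultimately have "\<bar>walk_gen n F x\<bar> \<le> p1 / p3 * (2 * norm F) + p2 / p3 * b + (2 * norm F + b) * jump_mass / p3"
      unfolding 2 walk_gen_0[OF n] by linarith
    also have "\<dots> \<le> (2 * p1 + p2 + 2 * jump_mass) / p3 * (norm F + b)"
      using p1 p2 p3 b0 jump_mass_nonneg by (simp add: field_simps)
    also have "\<dots> \<le> gen_const * (norm F + b + c)"
      unfolding gen_const_def using p1 p2 p3 b0 c0 jump_mass_nonneg by (intro mult_mono) auto
    finally show ?thesis .
  next
    case (3 i)
    have h: "0 < 1 / real n" "1 / real n \<le> real (Suc i) / real n" using n0 by (auto simp: divide_right_mono)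
    obtain \<xi> where \<xi>: "0 < \<xi>" "F (ennreal (real (Suc i) / real n + 1 / real n)) + F (ennreal (real (Suc i) / real n - 1 / real n))
       - 2 * F (ennreal (real (Suc i) / real n)) = (1 / real n)\<^sup>2 * f2 \<xi>"
      by (rule second_difference[OF h continuous_on_real_bcontfun f1 f2]) auto
    have "walk_gen n F x = f2 \<xi> / 2"
      using \<xi>(2) n0 unfolding 3 walk_gen_Suc[OF n0] by (simp add: diff_divide_distrib[symmetric] add_divide_distrib[symmetric] power2_eq_square field_simps)
    then have "\<bar>walk_gen n F x\<bar> \<le> 1 * c" using c[OF \<xi>(1)] by simp
    also have "\<dots> \<le> gen_const * (norm F + b + c)" using C1 b0 c0 by (intro mult_mono) auto
    finally show ?thesis .
  qed
qed

end

section \<open>Convergence of the semigroups\<close>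

context boundary_params
begin

lemma integrable_step:
  fixes F :: "ennreal \<Rightarrow>\<^sub>C real"
  shows "integrable (measure_pmf p) (\<lambda>y. F (scaled n y))"
  using norm_bounded[of F] by (intro measure_pmf.integrable_const_bound[of _ "norm F"]) auto

lemma walk_gen_diff:
  fixes F F' :: "ennreal \<Rightarrow>\<^sub>C real"
  shows "walk_gen n (F - F') x = walk_gen n F x - walk_gen n F' x"
  using integrable_step by (simp add: walk_gen_def Bochner_Integration.integral_diff algebra_simps)

primrec walk_iter :: "nat \<Rightarrow> nat \<Rightarrow> (enat \<Rightarrow> real) \<Rightarrow> enat \<Rightarrow> real" where
  "walk_iter n 0 f = f"
| "walk_iter n (Suc k) f = (\<lambda>x. \<integral>y. walk_iter n k f y \<partial>step n x)"

lemma pmf_integral_close: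
  fixes f g :: "enat \<Rightarrow> real"
  assumes "\<And>y. \<bar>f y\<bar> \<le> C" "\<And>y. \<bar>g y\<bar> \<le> C'" "\<And>y. \<bar>f y - g y\<bar> \<le> c"
  shows "\<bar>(\<integral>y. f y \<partial>measure_pmf p) - (\<integral>y. g y \<partial>measure_pmf p)\<bar> \<le> c"
proof -
  have i: "integrable (measure_pmf p) f" "integrable (measure_pmf p) g"
    using assms by (auto intro: measure_pmf.integrable_const_bound[of _ C] measure_pmf.integrable_const_bound[of _ C'])
  have "\<bar>(\<integral>y. f y \<partial>measure_pmf p) - (\<integral>y. g y \<partial>measure_pmf p)\<bar> = \<bar>\<integral>y. f y - g y \<partial>measure_pmf p\<bar>"
    using i by simp
  also have "\<dots> \<le> (\<integral>y. \<bar>f y - g y\<bar> \<partial>measure_pmf p)" by (rule integral_abs_bound)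
  also have "\<dots> \<le> (\<integral>y. c \<partial>measure_pmf p)"
    using i assms(3) by (intro integral_mono integrable_abs Bochner_Integration.integrable_diff) auto
  finally show ?thesis by simp
qed

lemma walk_iter_bound:
  assumes "\<And>y. \<bar>f y\<bar> \<le> C"
  shows "\<bar>walk_iter n k f x\<bar> \<le> C"
proof (induction k arbitrary: x)
  case (Suc k)
  have "0 \<le> C" using assms[of 0] by simp
  then show ?case
    using pmf_integral_close[of "walk_iter n k f" C "\<lambda>_. 0" 0 C] Suc by simp
qed (use assms in simp)

lemma walk_iter_close:
  assumes "\<And>y. \<bar>f y\<bar> \<le> C" "\<And>y. \<bar>g y\<bar> \<le> C'" "\<And>y. \<bar>f y - g y\<bar> \<le> c"
  shows "\<bar>walk_iter n k f x - walk_iter n k g x\<bar> \<le> c"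
proof (induction k arbitrary: x)
  case (Suc k)
  show ?case
    using pmf_integral_close[of "walk_iter n k f" C "walk_iter n k g" C' c] Suc walk_iter_bound[OF assms(1)] walk_iter_bound[OF assms(2)]
    by simp
qed (use assms in simp)

text \<open>Backward recursion for the expected product of the functions in the list, taken along
  the steps \<open>K i\<close>, \<open>K (Suc i)\<close>, and so on, when the walk is at
  \<open>x\<close> at step \<open>K i\<close>.\<close>

primrec walk_prod :: "nat \<Rightarrow> (nat \<Rightarrow> nat) \<Rightarrow> nat \<Rightarrow> (ennreal \<Rightarrow>\<^sub>C real) list \<Rightarrow> enat \<Rightarrow> real" where
  "walk_prod n K i [] = (\<lambda>x. 1)"
| "walk_prod n K i (\<phi> # \<phi>s) = (\<lambda>x. \<phi> (scaled n x) * walk_iter n (K (Suc i) - K i) (walk_prod n K (Suc i) \<phi>s) x)"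

lemma walk_prod_bound: "\<bar>walk_prod n K i \<phi>s x\<bar> \<le> prod_list (map norm \<phi>s)"
proof (induction \<phi>s arbitrary: i x)
  case (Cons \<phi> \<phi>s)
  show ?case
    using norm_bounded[of \<phi> "scaled n x"] walk_iter_bound[of "walk_prod n K (Suc i) \<phi>s", OF Cons.IH]
    by (auto simp: abs_mult intro!: mult_mono)
qed simp

end

context feller
begin

definition bmul :: "(ennreal \<Rightarrow>\<^sub>C real) \<Rightarrow> (ennreal \<Rightarrow>\<^sub>C real) \<Rightarrow> ennreal \<Rightarrow>\<^sub>C real" where
  "bmul F G = Bcontfun (\<lambda>z. F z * G z)"

lemma bmul_apply [simp]: "bmul F G z = F z * G z"
  unfolding bmul_def by (subst Bcontfun_inverse) (auto intro!: bcontfun_ennreal continuous_intros)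

text \<open>Counterpart of \<open>walk_prod\<close> for the limit process observed at equal time
  gaps \<open>\<tau>\<close>.\<close>

primrec feller_prod :: "real \<Rightarrow> (ennreal \<Rightarrow>\<^sub>C real) list \<Rightarrow> ennreal \<Rightarrow>\<^sub>C real" where
  "feller_prod \<tau> [] = const_bcontfun 1"
| "feller_prod \<tau> (\<phi> # \<phi>s) = bmul \<phi> (trans_op \<tau> (feller_prod \<tau> \<phi>s))"

end

locale walk_limit = feller \<kappa> + boundary_params p1 p2 p3 p4
  for \<kappa> :: "real \<Rightarrow> ennreal \<Rightarrow> ennreal measure" and p1 p2 p3 :: real and p4 :: "real measure" +
  assumes generator: "semigroup_generator \<kappa> f g \<longleftrightarrow> feller_bm_generator p1 p2 p3 p4 f g"
begin

text \<open>Besides unpacking the domain, this bounds the derivatives by the graph norm. For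
  \<open>f1\<close> one interpolates: over \<open>[x, x + 1]\<close> some value of it is an
  increment of \<open>F\<close>, hence at most twice the norm, and \<open>f2 = 2 * G\<close> limits
  the variation in between.\<close>

lemma gen_derivatives:
  fixes F G :: "ennreal \<Rightarrow>\<^sub>C real"
  assumes "gen F G"
  obtains f1 f2 d where
    "\<And>x. 0 < x \<Longrightarrow> ((\<lambda>x. F (ennreal x)) has_real_derivative f1 x) (at x)"
    "\<And>x. 0 < x \<Longrightarrow> (f1 has_real_derivative f2 x) (at x)"
    "\<And>x. 0 < x \<Longrightarrow> \<bar>f1 x\<bar> \<le> 2 * norm F + 2 * norm G"
    "\<And>x. 0 < x \<Longrightarrow> \<bar>f2 x\<bar> \<le> 2 * norm G"
    "f2 \<in> C0" "(f1 \<longlongrightarrow> d) (at_right 0)"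
    "p1 * (F 0 - F \<top>) - p2 * d + p3 / 2 * f2 0 + (\<integral>x. F 0 - F (ennreal x) \<partial>p4) = 0"
    "\<And>x. 0 \<le> x \<Longrightarrow> G (ennreal x) = f2 x / 2"
proof -
  have "feller_bm_generator p1 p2 p3 p4 (centered F) (centered G)"
    using gen_semigroup_generator[OF assms] generator by simp
  then obtain f1 f2 d where 1:
    "\<And>x. 0 < x \<Longrightarrow> (centered F has_real_derivative f1 x) (at x)"
    "\<And>x. 0 < x \<Longrightarrow> (f1 has_real_derivative f2 x) (at x)"
    "f2 \<in> C0" "(f1 \<longlongrightarrow> d) (at_right 0)"
    "p1 * centered F 0 - p2 * d + p3 / 2 * f2 0 + (\<integral>x. (centered F 0 - centered F x) \<partial>p4) = 0"
    "\<And>x. 0 \<le> x \<Longrightarrow> centered G x = f2 x / 2"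
    unfolding feller_bm_generator_def by blast
  have F: "((\<lambda>x. F (ennreal x)) has_real_derivative f1 x) (at x)" if "0 < x" for x
    using DERIV_add[OF 1(1)[OF that] DERIV_const[of "F \<top>"]] by (simp add: centered_def)
  have G: "G (ennreal x) = f2 x / 2" if "0 \<le> x" for x
    using 1(6)[OF that] gen_top[OF assms] by (simp add: centered_def)
  have f2: "\<bar>f2 x\<bar> \<le> 2 * norm G" if "0 < x" for x
    using norm_bounded[of G "ennreal x"] G[of x] that by simp
  have f1: "\<bar>f1 x\<bar> \<le> 2 * norm F + 2 * norm G" if x: "0 < x" for x
  proof -
    obtain z where z: "x < z" "z < x + 1" "F (ennreal (x + 1)) - F (ennreal x) = (x + 1 - x) * f1 z"
      using MVT2[of x "x + 1" "\<lambda>x. F (ennreal x)" f1] F x by auto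
    obtain w where w: "x < w" "w < z" "f1 z - f1 x = (z - x) * f2 w"
      using MVT2[of x z f1 f2] 1(2) z x by auto
    have "\<bar>f1 z - f1 x\<bar> \<le> 1 * (2 * norm G)"
      unfolding w(3) abs_mult using z w x f2[of w] by (intro mult_mono) auto
    moreover have "\<bar>f1 z\<bar> \<le> 2 * norm F"
      using z(3) norm_bounded[of F "ennreal (x + 1)"] norm_bounded[of F "ennreal x"] by (simp add: abs_if split: if_splits)
    ultimately show ?thesis by linarith
  qed
  have "p1 * (F 0 - F \<top>) - p2 * d + p3 / 2 * f2 0 + (\<integral>x. F 0 - F (ennreal x) \<partial>p4) = 0"
    using 1(5) by (simp add: centered_def)
  then show ?thesis
    using that[OF F 1(2) f1 f2 1(3,4) _ G] by blast
qed

lemma walk_gen_bound_gen: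
  fixes F G :: "ennreal \<Rightarrow>\<^sub>C real"
  assumes "gen F G" "admissible n"
  shows "\<bar>walk_gen n F x\<bar> \<le> 4 * gen_const * (norm F + norm G)"
proof -
  obtain f1 f2 d where d:
    "\<And>x. 0 < x \<Longrightarrow> ((\<lambda>x. F (ennreal x)) has_real_derivative f1 x) (at x)"
    "\<And>x. 0 < x \<Longrightarrow> (f1 has_real_derivative f2 x) (at x)"
    "\<And>x. 0 < x \<Longrightarrow> \<bar>f1 x\<bar> \<le> 2 * norm F + 2 * norm G"
    "\<And>x. 0 < x \<Longrightarrow> \<bar>f2 x\<bar> \<le> 2 * norm G"
    by (rule gen_derivatives[OF assms(1)]) (rule that)
  have "\<bar>walk_gen n F x\<bar> \<le> gen_const * (norm F + (2 * norm F + 2 * norm G) + 2 * norm G)"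
    by (rule walk_gen_bound[OF assms(2) d])
  also have "\<dots> \<le> gen_const * (4 * (norm F + norm G))"
    using gen_const_pos by (intro mult_left_mono) auto
  finally show ?thesis by (simp add: algebra_simps)
qed

text \<open>The second difference is \<open>f2\<close> at a point within \<open>1 / n\<close> of the
  site. Uniform continuity of \<open>f2\<close> up to 0 and up to infinity makes the error uniform
  over all sites, including those next to the boundary.\<close>

lemma walk_gen_tendsto_interior:
  fixes F G :: "ennreal \<Rightarrow>\<^sub>C real"
  assumes "gen F G" "0 < e"
  shows "\<forall>\<^sub>F n in sequentially. \<forall>i. \<bar>walk_gen n F (enat (Suc i)) - G (scaled n (enat (Suc i)))\<bar> \<le> e"
proof -
  obtain f1 f2 d where d:
    "\<And>x. 0 < x \<Longrightarrow> ((\<lambda>x. F (ennreal x)) has_real_derivative f1 x) (at x)"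
    "\<And>x. 0 < x \<Longrightarrow> (f1 has_real_derivative f2 x) (at x)"
    "f2 \<in> C0" "\<And>x. 0 \<le> x \<Longrightarrow> G (ennreal x) = f2 x / 2"
    by (rule gen_derivatives[OF assms(1)]) (rule that)
  obtain \<delta> where \<delta>: "0 < \<delta>" "\<And>x y. 0 \<le> x \<Longrightarrow> 0 \<le> y \<Longrightarrow> \<bar>x - y\<bar> < \<delta> \<Longrightarrow> \<bar>f2 x - f2 y\<bar> < e"
    by (rule C0_uniformly_continuous[OF d(3) assms(2)]) (rule that)
  have "\<forall>\<^sub>F n in sequentially. 1 / real n < \<delta>"
    using lim_1_over_n \<delta>(1) by (rule order_tendstoD)
  then show ?thesis
    using eventually_gt_at_top[of 0]
  proof eventually_elim
    case (elim n)
    show ?case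
    proof
      fix i
      have n0: "0 < n" using elim by simp
      have h: "0 < 1 / real n" "1 / real n \<le> real (Suc i) / real n" using n0 by (auto simp: divide_right_mono)
      obtain \<xi> where \<xi>: "0 < \<xi>" "\<bar>\<xi> - real (Suc i) / real n\<bar> < 1 / real n"
         "F (ennreal (real (Suc i) / real n + 1 / real n)) + F (ennreal (real (Suc i) / real n - 1 / real n))
         - 2 * F (ennreal (real (Suc i) / real n)) = (1 / real n)\<^sup>2 * f2 \<xi>"
        by (rule second_difference[OF h continuous_on_real_bcontfun d(1,2)]) auto
      have "walk_gen n F (enat (Suc i)) = f2 \<xi> / 2"
        using \<xi>(3) n0 unfolding walk_gen_Suc[OF n0] by (simp add: diff_divide_distrib[symmetric] add_divide_distrib[symmetric] power2_eq_square field_simps)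
      moreover have "G (scaled n (enat (Suc i))) = f2 (real (Suc i) / real n) / 2"
        unfolding scaled_enat[OF n0] by (rule d(4)) simp
      moreover have "\<bar>f2 \<xi> - f2 (real (Suc i) / real n)\<bar> < e"
        using \<xi> elim(1) by (intro \<delta>(2)) auto
      ultimately show "\<bar>walk_gen n F (enat (Suc i)) - G (scaled n (enat (Suc i)))\<bar> \<le> e"
        by (simp add: diff_divide_distrib[symmetric])
    qed
  qed
qed

text \<open>
  Because of \<open>p\<^sub>3 > 0\<close>, multiplying the jump probabilities from \<open>0\<close> by \<open>n\<^sup>2\<close> gives the boundary condition in the
  limit: functions in the domain need no correction near \<open>0\<close>.
\<close>

lemma walk_gen_tendsto_0:
  fixes F G :: "ennreal \<Rightarrow>\<^sub>C real"
  assumes "gen F G"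
  shows "(\<lambda>n. walk_gen n F 0) \<longlonglongrightarrow> G 0"
proof -
  obtain f1 f2 d where d:
    "\<And>x. 0 < x \<Longrightarrow> ((\<lambda>x. F (ennreal x)) has_real_derivative f1 x) (at x)"
    "\<And>x. 0 < x \<Longrightarrow> \<bar>f1 x\<bar> \<le> 2 * norm F + 2 * norm G"
    "(f1 \<longlongrightarrow> d) (at_right 0)"
    "p1 * (F 0 - F \<top>) - p2 * d + p3 / 2 * f2 0 + (\<integral>x. F 0 - F (ennreal x) \<partial>p4) = 0"
    "\<And>x. 0 \<le> x \<Longrightarrow> G (ennreal x) = f2 x / 2"
    by (rule gen_derivatives[OF assms(1)]) (rule that)
  let ?c = "2 * norm F + (2 * norm F + 2 * norm G)"
  define v where "v n = (\<lambda>j. F (ennreal (real j / real n)) - F 0)" for n :: nat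
  have inc: "\<bar>F (ennreal y) - F 0\<bar> \<le> ?c * min y 1" if "0 \<le> y" for y
    using increment_bound(2)[OF d(1,2) that] by simp
  have cb: "\<bar>v m j\<bar> \<le> ?c * min (real j / real m) 1" for m j
    unfolding v_def by (rule inc) simp
  \<comment> \<open>The shift by 1 leaves out \<open>n = 0\<close>, for which
    \<open>cell_fun_bound\<close> gives no majorant.\<close>
  have "(\<lambda>n. \<integral>x. cell_fun n (v n) x \<partial>p4) \<longlonglongrightarrow> (\<integral>x. F (ennreal x) - F 0 \<partial>p4)"
  proof (rule LIMSEQ_offset[of _ 1], rule integral_dominated_convergence[where w = "\<lambda>x. ?c * min x 1"])
    show "(\<lambda>x. F (ennreal x) - F 0) \<in> borel_measurable p4"
      by (intro measurable_p4 borel_measurable_continuous_onI continuous_on_diff continuous_on_real_bcontfun continuous_on_const)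
    show "cell_fun (n + 1) (v (n + 1)) \<in> borel_measurable p4" for n
      by (intro measurable_p4 cell_fun_measurable)
    show "integrable p4 (\<lambda>x. ?c * min x 1)" using integrable_min by simp
    show "AE x in p4. (\<lambda>n. cell_fun (n + 1) (v (n + 1)) x) \<longlonglongrightarrow> F (ennreal x) - F 0"
    proof (rule AE_I2)
      fix x assume "x \<in> space p4"
      then have "0 < x" by (simp add: space_p4)
      then show "(\<lambda>n. cell_fun (n + 1) (v (n + 1)) x) \<longlonglongrightarrow> F (ennreal x) - F 0"
        unfolding v_def
        using LIMSEQ_ignore_initial_segment[OF cell_fun_tendsto[OF continuous_on_real_bcontfun[of F] \<open>0 < x\<close>], of 1] by simp
    qed
    show "AE x in p4. norm (cell_fun (n + 1) (v (n + 1)) x) \<le> ?c * min x 1" for n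
    proof (rule AE_I2)
      fix x assume "x \<in> space p4"
      then show "norm (cell_fun (n + 1) (v (n + 1)) x) \<le> ?c * min x 1"
        unfolding real_norm_def by (intro cell_fun_bound cb) (auto simp: space_p4)
    qed
  qed
  \<comment> \<open>The mean value theorem turns the quotient into a value of \<open>f1\<close> in
    \<open>(0, 1 / n)\<close>, so a limit of \<open>f1\<close> at 0 is enough and no derivative at 0
    itself is used.\<close>
  moreover have "(\<lambda>n. real n * (F (ennreal (1 / real n)) - F 0)) \<longlonglongrightarrow> d"
  proof (rule LIMSEQ_I)
    fix r :: real assume "0 < r"
    then have "\<forall>\<^sub>F x in at_right 0. dist (f1 x) d < r" using d(3) by (intro tendstoD)
    then obtain b where b: "0 < b" "\<And>x. 0 < x \<Longrightarrow> x < b \<Longrightarrow> \<bar>f1 x - d\<bar> < r"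
      by (auto simp: eventually_at_right_field dist_real_def)
    obtain N :: nat where N: "1 / b < real N" using reals_Archimedean2 by blast
    show "\<exists>no. \<forall>n\<ge>no. norm (real n * (F (ennreal (1 / real n)) - F 0) - d) < r"
    proof (intro exI[of _ N] allI impI)
      fix n assume "N \<le> n"
      then have n: "1 / b < real n" using N by linarith
      moreover have "0 < 1 / b" using b by simp
      ultimately have n0: "0 < real n" by linarith
      have nb: "1 / real n < b" using n n0 b by (simp add: field_simps)
      have "\<exists>l z. 0 < z \<and> z < 1 / real n \<and> ((\<lambda>x. F (ennreal x)) has_real_derivative l) (at z) \<and>
          F (ennreal (1 / real n)) - F (ennreal 0) = (1 / real n - 0) * l"
        using d(1) n0 by (intro MVT continuous_on_subset[OF continuous_on_real_bcontfun])
          (auto simp: real_differentiable_def)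
      then obtain l z where z: "0 < z" "z < 1 / real n" "((\<lambda>x. F (ennreal x)) has_real_derivative l) (at z)"
          "F (ennreal (1 / real n)) - F 0 = 1 / real n * l" by auto
      have "l = f1 z" using DERIV_unique[OF z(3) d(1)[OF z(1)]] .
      then show "norm (real n * (F (ennreal (1 / real n)) - F 0) - d) < r"
        using z(4) n0 b(2)[of z] z nb by simp
    qed
  qed
  ultimately have "(\<lambda>n. p1 / p3 * (F \<top> - F 0) + p2 / p3 * (real n * (F (ennreal (1 / real n)) - F 0))
      + (\<integral>x. cell_fun n (v n) x \<partial>p4) / p3) \<longlonglongrightarrow>
      p1 / p3 * (F \<top> - F 0) + p2 / p3 * d + (\<integral>x. F (ennreal x) - F 0 \<partial>p4) / p3"
    using p3 by (intro tendsto_intros) auto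
  also have "p1 / p3 * (F \<top> - F 0) + p2 / p3 * d + (\<integral>x. F (ennreal x) - F 0 \<partial>p4) / p3 = f2 0 / 2"
  proof -
    have "(\<integral>x. F 0 - F (ennreal x) \<partial>p4) = - (\<integral>x. F (ennreal x) - F 0 \<partial>p4)"
      by (subst integral_minus[symmetric]) simp
    then have "p3 * (f2 0 / 2) = p1 * (F \<top> - F 0) + p2 * d + (\<integral>x. F (ennreal x) - F 0 \<partial>p4)"
      using d(4) by (simp add: algebra_simps)
    then show ?thesis using p3 by (simp add: field_simps)
  qed
  also have "\<dots> = G 0" using d(5)[of 0] by simp
  finally show ?thesis
  proof (rule Lim_transform_eventually)
    show "\<forall>\<^sub>F n in sequentially. p1 / p3 * (F \<top> - F 0) + p2 / p3 * (real n * (F (ennreal (1 / real n)) - F 0))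
      + (\<integral>x. cell_fun n (v n) x \<partial>p4) / p3 = walk_gen n F 0"
      using eventually_admissible by eventually_elim (simp add: walk_gen_0 v_def)
  qed
qed

lemma walk_gen_tendsto:
  fixes F G :: "ennreal \<Rightarrow>\<^sub>C real"
  assumes "gen F G" "0 < e"
  shows "\<forall>\<^sub>F n in sequentially. \<forall>x. \<bar>walk_gen n F x - G (scaled n x)\<bar> \<le> e"
proof -
  have "\<forall>\<^sub>F n in sequentially. dist (walk_gen n F 0) (G 0) < e"
    using walk_gen_tendsto_0[OF assms(1)] assms(2) by (rule tendstoD)
  then show ?thesis
    using walk_gen_tendsto_interior[OF assms] eventually_gt_at_top[of 0]
  proof eventually_elim
    case (elim n)
    show ?case
    proof
      fix x
      consider "x = \<infinity>" | "x = 0" | i where "x = enat (Suc i)"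
        by (metis enat.exhaust not0_implies_Suc zero_enat_def)
      then show "\<bar>walk_gen n F x - G (scaled n x)\<bar> \<le> e"
      proof cases
        case 1
        then show ?thesis using gen_top[OF assms(1)] assms(2) by (simp add: walk_gen_infinity)
      next
        case 2
        have "scaled n 0 = 0" using scaled_enat[OF elim(3), of 0] by (simp add: zero_enat_def)
        then show ?thesis using 2 elim(1) by (simp add: dist_real_def)
      next
        case 3
        then show ?thesis using elim(2) by simp
      qed
    qed
  qed
qed

text \<open>
  Uniformity in time comes from the compactness of the orbit and the bound on \<^term>\<open>walk_gen\<close> by the graph norm.
\<close>

lemma walk_gen_tendsto_orbit:
  fixes F G :: "ennreal \<Rightarrow>\<^sub>C real"
  assumes g: "gen F G" and e: "0 < e" and t: "0 \<le> t"
  shows "\<forall>\<^sub>F n in sequentially. \<forall>s x. 0 \<le> s \<longrightarrow> s \<le> t \<longrightarrow> \<bar>walk_gen n (trans_op s F) x - trans_op s G (scaled n x)\<bar> \<le> e"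
proof -
  \<comment> \<open>Passing from \<open>s\<close> to the grid time below it costs
    \<open>4 * gen_const * (r + r)\<close> for the walk and \<open>r\<close> for the limit, together
    \<open>e / 2\<close>; the other half of \<open>e\<close> is the error at the finitely many grid
    times.\<close>
  define r where "r = e / 2 / (8 * gen_const + 1)"
  have r: "0 < r" using e gen_const_pos by (simp add: r_def)
  obtain d1 where d1: "0 < d1" "\<And>s t. 0 \<le> s \<Longrightarrow> s \<le> t \<Longrightarrow> t < s + d1 \<Longrightarrow> norm (trans_op t F - trans_op s F) < r"
    by (rule orbit_uniform[OF r, of F]) (rule that)
  obtain d2 where d2: "0 < d2" "\<And>s t. 0 \<le> s \<Longrightarrow> s \<le> t \<Longrightarrow> t < s + d2 \<Longrightarrow> norm (trans_op t G - trans_op s G) < r"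
    by (rule orbit_uniform[OF r, of G]) (rule that)
  define q where "q = min d1 d2"
  have q: "0 < q" "q \<le> d1" "q \<le> d2" using d1 d2 by (auto simp: q_def)
  define N where "N = nat \<lfloor>t / q\<rfloor>"
  have "\<forall>\<^sub>F n in sequentially. \<forall>i\<in>{..N}. \<forall>x. \<bar>walk_gen n (trans_op (real i * q) F) x - trans_op (real i * q) G (scaled n x)\<bar> \<le> e / 2"
    using e q by (intro eventually_ball_finite ballI walk_gen_tendsto gen_T[OF g]) auto
  then show ?thesis
    using eventually_admissible
  proof eventually_elim
    case (elim n)
    show ?case
    proof (intro allI impI)
      fix s x assume s: "0 \<le> s" "s \<le> t"
      define i where "i = nat \<lfloor>s / q\<rfloor>"
      have "\<lfloor>s / q\<rfloor> \<le> \<lfloor>t / q\<rfloor>" using s q by (intro floor_mono divide_right_mono) auto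
      then have "i \<le> N" by (simp add: i_def N_def nat_mono)
      have i': "real i \<le> s / q" "s / q < real i + 1" using s q by (auto simp: i_def)
      have i: "real i * q \<le> s" "s < real i * q + q"
        using i' q by (auto simp: pos_le_divide_eq pos_divide_less_eq algebra_simps)
      define u where "u = real i * q"
      have u: "0 \<le> u" "u \<le> s" "s < u + d1" "s < u + d2" using i q by (auto simp: u_def)
      have 1: "norm (trans_op s F - trans_op u F) < r" by (rule d1(2)[OF u(1,2,3)])
      have 2: "norm (trans_op s G - trans_op u G) < r" by (rule d2(2)[OF u(1,2,4)])
      have "\<bar>walk_gen n (trans_op s F - trans_op u F) x\<bar> \<le> 4 * gen_const * (norm (trans_op s F - trans_op u F) + norm (trans_op s G - trans_op u G))"
        using s u elim(2) by (intro walk_gen_bound_gen gen_diff gen_T[OF g]) auto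
      also have "\<dots> \<le> 4 * gen_const * (r + r)"
        using 1 2 gen_const_pos by (intro mult_left_mono add_mono) auto
      finally have "\<bar>walk_gen n (trans_op s F) x - walk_gen n (trans_op u F) x\<bar> \<le> 4 * gen_const * (r + r)"
        unfolding walk_gen_diff .
      moreover have "\<bar>walk_gen n (trans_op u F) x - trans_op u G (scaled n x)\<bar> \<le> e / 2"
        using elim(1) \<open>i \<le> N\<close> by (simp add: u_def)
      moreover have "\<bar>trans_op s G (scaled n x) - trans_op u G (scaled n x)\<bar> \<le> r"
        using norm_bounded[of "trans_op s G - trans_op u G" "scaled n x"] 2 by simp
      moreover have "4 * gen_const * (r + r) + r = e / 2"
      proof -
        have "4 * gen_const * (r + r) + r = (8 * gen_const + 1) * r" by algebra
        also have "\<dots> = e / 2"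
          unfolding r_def times_divide_eq_right[of _ "e / 2"] using gen_const_pos by (intro nonzero_mult_div_cancel_left) simp
        finally show ?thesis .
      qed
      ultimately show "\<bar>walk_gen n (trans_op s F) x - trans_op s G (scaled n x)\<bar> \<le> e" by linarith
    qed
  qed
qed

text \<open>One step of the walk and the time \<open>h = 1 / n^2\<close> of the semigroup differ by
  at most \<open>2 * h * r\<close>: one \<open>h * r\<close> for replacing \<open>walk_gen\<close>
  by the generator at the current time of the orbit, another for the difference quotient of the
  semigroup. Averaging over a step does not enlarge errors, so over at most \<open>t / h\<close>
  steps they merely add up. The \<open>t + 1\<close> in \<open>r\<close> keeps the quotient
  meaningful at \<open>t = 0\<close>.\<close>

lemma walk_iter_tendsto_gen:
  fixes F G :: "ennreal \<Rightarrow>\<^sub>C real"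
  assumes g: "gen F G" and e: "0 < e" and t: "0 \<le> t"
  shows "\<forall>\<^sub>F n in sequentially. \<forall>k x. real k \<le> t * (real n)\<^sup>2 \<longrightarrow>
    \<bar>walk_iter n k (\<lambda>y. F (scaled n y)) x - trans_op (real k / (real n)\<^sup>2) F (scaled n x)\<bar> \<le> e"
proof -
  define r where "r = e / (2 * (t + 1))"
  have r: "0 < r" using e t by (simp add: r_def)
  obtain d where d: "0 < d" "\<And>h. 0 < h \<Longrightarrow> h < d \<Longrightarrow> norm (trans_op h F - F - h *\<^sub>R G) \<le> h * r"
    using g r unfolding gen_def by metis
  have "(\<lambda>n. 1 / (real n)\<^sup>2) \<longlonglongrightarrow> 0" by real_asymp
  then have "\<forall>\<^sub>F n in sequentially. 1 / (real n)\<^sup>2 < d" using d(1) by (rule order_tendstoD)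
  then show ?thesis
    using walk_gen_tendsto_orbit[OF g r t] eventually_gt_at_top[of 0]
  proof eventually_elim
    case (elim n)
    define h where "h = 1 / (real n)\<^sup>2"
    have h: "0 < h" "h < d" "(real n)\<^sup>2 * h = 1" using elim by (auto simp: h_def)
    have main: "\<bar>walk_iter n k (\<lambda>y. F (scaled n y)) x - trans_op (real k * h) F (scaled n x)\<bar> \<le> real k * h * (2 * r)"
      if "real k * h \<le> t" for k x
      using that
    proof (induction k arbitrary: x)
      case 0
      then show ?case by (simp add: zero)
    next
      case (Suc k)
      define s where "s = real k * h"
      have s: "0 \<le> s" "s \<le> t" using Suc.prems h by (auto simp: s_def distrib_right)
      have IH: "\<bar>walk_iter n k (\<lambda>y. F (scaled n y)) y - trans_op s F (scaled n y)\<bar> \<le> s * (2 * r)" for y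
        using Suc.IH s by (simp add: s_def)
      have 1: "\<bar>walk_iter n (Suc k) (\<lambda>y. F (scaled n y)) x - (\<integral>y. trans_op s F (scaled n y) \<partial>step n x)\<bar> \<le> s * (2 * r)"
        using norm_bounded[of F] norm_bounded[of "trans_op s F"] IH
        by (auto intro!: pmf_integral_close[of _ "norm F" _ "norm (trans_op s F)"] walk_iter_bound)
      have "walk_gen n (trans_op s F) x = (real n)\<^sup>2 * ((\<integral>y. trans_op s F (scaled n y) \<partial>step n x) - trans_op s F (scaled n x))"
        by (simp add: walk_gen_def)
      then have "h * walk_gen n (trans_op s F) x = ((real n)\<^sup>2 * h) * ((\<integral>y. trans_op s F (scaled n y) \<partial>step n x) - trans_op s F (scaled n x))"
        by (simp add: mult.commute mult.left_commute)
      then have 2: "(\<integral>y. trans_op s F (scaled n y) \<partial>step n x) = trans_op s F (scaled n x) + h * walk_gen n (trans_op s F) x"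
        using h by simp
      have "\<bar>walk_gen n (trans_op s F) x - trans_op s G (scaled n x)\<bar> \<le> r" using elim(2) s by blast
      then have "h * \<bar>walk_gen n (trans_op s F) x - trans_op s G (scaled n x)\<bar> \<le> h * r" using h by simp
      then have 3: "\<bar>h * walk_gen n (trans_op s F) x - h * trans_op s G (scaled n x)\<bar> \<le> h * r"
        using h by (simp add: abs_mult flip: right_diff_distrib)
      have "trans_op (s + h) F - trans_op s F - h *\<^sub>R trans_op s G = trans_op s (trans_op h F - F - h *\<^sub>R G)"
        using s h by (simp add: add diff scale)
      then have "norm (trans_op (s + h) F - trans_op s F - h *\<^sub>R trans_op s G) \<le> h * r"
        using contraction[OF s(1), of "trans_op h F - F - h *\<^sub>R G"] d(2)[OF h(1,2)] by simp
      then have 4: "\<bar>trans_op (s + h) F (scaled n x) - trans_op s F (scaled n x) - h * trans_op s G (scaled n x)\<bar> \<le> h * r"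
        using norm_bounded[of "trans_op (s + h) F - trans_op s F - h *\<^sub>R trans_op s G" "scaled n x"] by simp
      have sh: "real (Suc k) * h = s + h" by (simp add: s_def distrib_right)
      have "\<bar>walk_iter n (Suc k) (\<lambda>y. F (scaled n y)) x - trans_op (s + h) F (scaled n x)\<bar> \<le> s * (2 * r) + h * r + h * r"
        using 1 3 4 unfolding 2 by linarith
      also have "\<dots> = (s + h) * (2 * r)" by algebra
      finally show ?case unfolding sh .
    qed
    show ?case
    proof (intro allI impI)
      fix k x assume k: "real k \<le> t * (real n)\<^sup>2"
      have "real k * h \<le> t" using k elim by (simp add: h_def pos_divide_le_eq)
      then have "\<bar>walk_iter n k (\<lambda>y. F (scaled n y)) x - trans_op (real k * h) F (scaled n x)\<bar> \<le> real k * h * (2 * r)"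
        by (rule main)
      also have "\<dots> \<le> (t + 1) * (2 * r)" using \<open>real k * h \<le> t\<close> r t by (intro mult_right_mono) auto
      also have "\<dots> = 2 * (t + 1) * r" by algebra
      also have "\<dots> = e" unfolding r_def using t by simp
      finally show "\<bar>walk_iter n k (\<lambda>y. F (scaled n y)) x - trans_op (real k / (real n)\<^sup>2) F (scaled n x)\<bar> \<le> e"
        by (simp add: h_def)
    qed
  qed
qed

text \<open>Both evolutions are contractions, so replacing \<open>F\<close> by an element of the
  domain costs a quarter of \<open>e\<close> on either side. The remaining quarters go to the
  convergence on the domain and to replacing the time \<open>k n / n^2\<close> by \<open>t\<close>;
  the horizon \<open>t + 1\<close> eventually contains these times.\<close>

lemma walk_iter_tendsto:
  fixes F :: "ennreal \<Rightarrow>\<^sub>C real"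
  assumes k: "(\<lambda>n. real (k n) / (real n)\<^sup>2) \<longlonglongrightarrow> t" and t: "0 \<le> t" and e: "0 < e"
  shows "\<forall>\<^sub>F n in sequentially. \<forall>x. \<bar>walk_iter n (k n) (\<lambda>y. F (scaled n y)) x - trans_op t F (scaled n x)\<bar> \<le> e"
proof -
  have e4: "0 < e / 4" using e by simp
  have "0 \<le> t + 1" using t by simp
  obtain F' G' where F': "gen F' G'" "norm (F - F') < e / 4"
    by (rule gen_dense[OF e4, of F]) (rule that)
  have "((\<lambda>n. trans_op (real (k n) / (real n)\<^sup>2) F') \<longlonglongrightarrow> trans_op t F')"
    using k t by (intro continuous_on_tendsto_compose[OF continuous_on_orbit]) auto
  then have "\<forall>\<^sub>F n in sequentially. dist (trans_op (real (k n) / (real n)\<^sup>2) F') (trans_op t F') < e / 4"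
    using e4 by (rule tendstoD)
  moreover have "\<forall>\<^sub>F n in sequentially. real (k n) / (real n)\<^sup>2 < t + 1"
    using k by (rule order_tendstoD) simp
  ultimately show ?thesis
    using walk_iter_tendsto_gen[OF F'(1) e4 \<open>0 \<le> t + 1\<close>] eventually_gt_at_top[of 0]
  proof eventually_elim
    case (elim n)
    show ?case
    proof
      fix x
      have "real (k n) \<le> (t + 1) * (real n)\<^sup>2" using elim by (simp add: pos_divide_less_eq less_imp_le)
      then have 1: "\<bar>walk_iter n (k n) (\<lambda>y. F' (scaled n y)) x - trans_op (real (k n) / (real n)\<^sup>2) F' (scaled n x)\<bar> \<le> e / 4"
        using elim by blast
      have 2: "\<bar>trans_op (real (k n) / (real n)\<^sup>2) F' (scaled n x) - trans_op t F' (scaled n x)\<bar> \<le> e / 4"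
        using norm_bounded[of "trans_op (real (k n) / (real n)\<^sup>2) F' - trans_op t F'" "scaled n x"] elim by (simp add: dist_norm)
      have c: "\<bar>F z - F' z\<bar> \<le> e / 4" for z
        using norm_bounded[of "F - F'" z] F'(2) by simp
      have 3: "\<bar>walk_iter n (k n) (\<lambda>y. F (scaled n y)) x - walk_iter n (k n) (\<lambda>y. F' (scaled n y)) x\<bar> \<le> e / 4"
        using norm_bounded[of F] norm_bounded[of F'] c by (intro walk_iter_close[of _ "norm F" _ "norm F'"]) auto
      have 4: "\<bar>trans_op t F' (scaled n x) - trans_op t F (scaled n x)\<bar> \<le> e / 4"
        using norm_bounded[of "trans_op t F' - trans_op t F" "scaled n x"] contraction[OF t, of "F - F'"] F'(2) t
        by (simp add: diff norm_minus_commute)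
      show "\<bar>walk_iter n (k n) (\<lambda>y. F (scaled n y)) x - trans_op t F (scaled n x)\<bar> \<le> e"
        using 1 2 3 4 by linarith
    qed
  qed
qed

text \<open>Uniformity in the starting point is essential for the induction: the inner product is
  evaluated at a random position, and a uniform error passes through the iterate unchanged.\<close>

lemma walk_prod_tendsto:
  assumes K: "\<And>i. (\<lambda>n. real (K n (Suc i) - K n i) / (real n)\<^sup>2) \<longlonglongrightarrow> \<tau>" and \<tau>: "0 \<le> \<tau>" and e: "0 < e"
  shows "\<forall>\<^sub>F n in sequentially. \<forall>x. \<bar>walk_prod n (K n) i \<phi>s x - feller_prod \<tau> \<phi>s (scaled n x)\<bar> \<le> e"
  using e
proof (induction \<phi>s arbitrary: i e)
  case Nil
  then show ?case by simp
next
  case (Cons \<phi> \<phi>s)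
  define r where "r = e / (2 * (norm \<phi> + 1))"
  have np: "0 < norm \<phi> + 1" by (simp add: add_nonneg_pos)
  have r: "0 < r" using Cons.prems np by (simp add: r_def)
  have "\<forall>\<^sub>F n in sequentially. \<forall>x. \<bar>walk_prod n (K n) (Suc i) \<phi>s x - feller_prod \<tau> \<phi>s (scaled n x)\<bar> \<le> r"
    by (rule Cons.IH[OF r])
  then show ?case
    using walk_iter_tendsto[OF K \<tau> r, of i "feller_prod \<tau> \<phi>s"]
  proof eventually_elim
    case (elim n)
    show ?case
    proof
      fix x
      let ?k = "K n (Suc i) - K n i"
      have "\<bar>walk_iter n ?k (walk_prod n (K n) (Suc i) \<phi>s) x - walk_iter n ?k (\<lambda>y. feller_prod \<tau> \<phi>s (scaled n y)) x\<bar> \<le> r"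
        using elim(1) norm_bounded[of "feller_prod \<tau> \<phi>s"]
        by (intro walk_iter_close[OF walk_prod_bound, of _ "norm (feller_prod \<tau> \<phi>s)"]) auto
      then have "\<bar>walk_iter n ?k (walk_prod n (K n) (Suc i) \<phi>s) x - trans_op \<tau> (feller_prod \<tau> \<phi>s) (scaled n x)\<bar> \<le> r + r"
        using elim(2)[rule_format, of x] by linarith
      then have "\<bar>\<phi> (scaled n x)\<bar> * \<bar>walk_iter n ?k (walk_prod n (K n) (Suc i) \<phi>s) x - trans_op \<tau> (feller_prod \<tau> \<phi>s) (scaled n x)\<bar> \<le> (norm \<phi> + 1) * (r + r)"
        using norm_bounded[of \<phi> "scaled n x"] np by (intro mult_mono) auto
      also have "\<dots> = 2 * (norm \<phi> + 1) * r" by algebra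
      also have "\<dots> = e" unfolding r_def using np by simp
      finally show "\<bar>walk_prod n (K n) i (\<phi> # \<phi>s) x - feller_prod \<tau> (\<phi> # \<phi>s) (scaled n x)\<bar> \<le> e"
        by (simp add: abs_mult flip: right_diff_distrib)
    qed
  qed
qed

end

section \<open>Exits of the random walk\<close>

text \<open>The newest state comes first, so that a step of the walk is a cons, the present state is
  the head, and dropping elements goes back in time.\<close>

primrec hist :: "(nat \<Rightarrow> 'w \<Rightarrow> enat) \<Rightarrow> nat \<Rightarrow> 'w \<Rightarrow> enat list" where
  "hist X 0 \<omega> = [X 0 \<omega>]"
| "hist X (Suc k) \<omega> = X (Suc k) \<omega> # hist X k \<omega>"

lemma hist_simps [simp]: "length (hist X k \<omega>) = Suc k" "hd (hist X k \<omega>) = X k \<omega>" "hist X k \<omega> \<noteq> []"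
  by (induction k) auto

lemma drop_hist: "drop r (hist X (k + r) \<omega>) = hist X k \<omega>"
  by (induction r) auto

lemma hist_eq_iff: "hist X k \<omega> = xs \<longleftrightarrow> length xs = Suc k \<and> (\<forall>l\<le>k. X l \<omega> = xs ! (k - l))"
proof (induction k arbitrary: xs)
  case 0
  then show ?case by (auto simp: length_Suc_conv)
next
  case (Suc k)
  show ?case
  proof (cases xs)
    case (Cons y ys)
    have "(\<forall>l\<le>Suc k. X l \<omega> = xs ! (Suc k - l)) \<longleftrightarrow> X (Suc k) \<omega> = y \<and> (\<forall>l\<le>k. X l \<omega> = ys ! (k - l))"
      by (auto simp: Cons le_Suc_eq Suc_diff_le)
    then show ?thesis using Suc[of ys] Cons by auto
  qed simp
qed

primrec histp :: "enat pmf \<Rightarrow> nat \<Rightarrow> nat \<Rightarrow> enat list pmf" where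
  "histp \<pp> i 0 = return_pmf [enat i]"
| "histp \<pp> i (Suc k) = bind_pmf (histp \<pp> i k) (\<lambda>xs. map_pmf (\<lambda>y. y # xs) (brw_step \<pp> (hd xs)))"

lemma pmf_histp_Suc:
  "pmf (histp \<pp> i (Suc k)) (y # ys) = pmf (histp \<pp> i k) ys * pmf (brw_step \<pp> (hd ys)) y"
proof -
  have "pmf (map_pmf (\<lambda>y. y # xs) (brw_step \<pp> (hd xs))) (y # ys) = indicator {ys} xs * pmf (brw_step \<pp> (hd ys)) y" for xs
  proof (cases "xs = ys")
    case True
    have "pmf (map_pmf (\<lambda>y. y # ys) (brw_step \<pp> (hd ys))) ((\<lambda>y. y # ys) y) = pmf (brw_step \<pp> (hd ys)) y"
      by (rule pmf_map_inj') (auto simp: inj_on_def)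
    then show ?thesis using True by simp
  next
    case False
    then have "pmf (map_pmf (\<lambda>y. y # xs) (brw_step \<pp> (hd xs))) (y # ys) = 0"
      by (intro pmf_map_outside) auto
    then show ?thesis using False by simp
  qed
  then show ?thesis
    by (simp add: pmf_bind measure_pmf_single)
qed

locale brw =
  fixes \<pp> :: "enat pmf" and i0 :: nat and M :: "'w measure" and X :: "nat \<Rightarrow> 'w \<Rightarrow> enat"
  assumes brw: "boundary_random_walk \<pp> i0 M X"
begin

sublocale prob_space M
  using brw by (simp add: boundary_random_walk_def)

lemma X_measurable [measurable]: "X k \<in> M \<rightarrow>\<^sub>M count_space UNIV"
  using brw by (simp add: boundary_random_walk_def)

lemma hist_vimage: "hist X k -` {xs} \<inter> space M = (if length xs = Suc k then {\<omega> \<in> space M. \<forall>l\<le>k. X l \<omega> = xs ! (k - l)} else {})"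
proof -
  have "hist X k -` {xs} \<inter> space M = {\<omega> \<in> space M. hist X k \<omega> = xs}" by auto
  then show ?thesis unfolding hist_eq_iff by auto
qed

lemma hist_measurable [measurable]: "hist X k \<in> M \<rightarrow>\<^sub>M count_space UNIV"
proof (rule measurable_count_space_eq2_countable[THEN iffD2])
  have "{\<omega> \<in> space M. \<forall>l\<le>k. X l \<omega> = xs ! (k - l)} \<in> sets M" for xs
    by measurable
  then show "hist X k \<in> space M \<rightarrow> UNIV \<and> (\<forall>a\<in>UNIV. hist X k -` {a} \<inter> space M \<in> sets M)"
    unfolding hist_vimage by auto
qed

text \<open>The product rule in the definition of the walk is the recursion of \<open>histp\<close>,
  read on lists of the right length; all other lists have probability 0 on both sides.\<close>

lemma measure_hist: "measure M (hist X k -` {xs} \<inter> space M) = pmf (histp \<pp> i0 k) xs"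
proof (induction k arbitrary: xs)
  case 0
  have ae: "AE \<omega> in M. X 0 \<omega> = enat i0" using brw by (simp add: boundary_random_walk_def)
  have "prob (hist X 0 -` {xs} \<inter> space M) = prob {\<omega> \<in> space M. xs = [enat i0]}"
    by (rule finite_measure_eq_AE) (use ae in \<open>auto elim!: eventually_mono\<close>)
  also have "\<dots> = indicator {[enat i0]} xs"
    using prob_space by (auto simp: indicator_def)
  also have "\<dots> = pmf (histp \<pp> i0 0) xs" by (auto simp: pmf_return indicator_def)
  finally show ?case .
next
  case (Suc k)
  show ?case
  proof (cases xs)
    case Nil
    have "pmf (histp \<pp> i0 (Suc k)) [] = 0"
      by (auto simp: set_pmf_eq[symmetric] pmf_eq_0_set_pmf)
    then show ?thesis using Nil by (simp only: hist_vimage) simp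
  next
    case (Cons y ys)
    show ?thesis
    proof (cases "length ys = Suc k")
      case True
      define x where "x l = xs ! (Suc k - l)" for l
      have "prob {\<omega> \<in> space M. \<forall>l\<le>Suc k. X l \<omega> = x l} = prob {\<omega> \<in> space M. \<forall>l\<le>k. X l \<omega> = x l} * pmf (brw_step \<pp> (x k)) (x (Suc k))"
        using brw by (simp add: boundary_random_walk_def)
      moreover have "x k = hd ys" "x (Suc k) = y"
        using True by (cases ys; simp add: x_def Cons Suc_diff_le)+
      moreover have "{\<omega> \<in> space M. \<forall>l\<le>k. X l \<omega> = x l} = hist X k -` {ys} \<inter> space M"
        using True unfolding hist_vimage by (auto simp: x_def Cons Suc_diff_le)
      moreover have "{\<omega> \<in> space M. \<forall>l\<le>Suc k. X l \<omega> = x l} = hist X (Suc k) -` {xs} \<inter> space M"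
        using True Cons unfolding hist_vimage by (auto simp: x_def)
      ultimately show ?thesis using Suc[of ys] pmf_histp_Suc[of \<pp> i0 k y ys] Cons
        by (simp del: hist.simps histp.simps)
    next
      case False
      then have "pmf (histp \<pp> i0 k) ys = 0" using Suc[of ys] by (simp add: hist_vimage)
      moreover have "hist X (Suc k) -` {xs} \<inter> space M = {}"
        using False Cons unfolding hist_vimage by simp
      ultimately show ?thesis using pmf_histp_Suc[of \<pp> i0 k y ys] Cons
        by (simp del: hist.simps histp.simps)
    qed
  qed
qed

lemma distr_hist: "distr M (count_space UNIV) (hist X k) = measure_pmf (histp \<pp> i0 k)"
proof (rule measure_eqI_countable[of _ UNIV])
  fix xs :: "enat list"
  have "emeasure (distr M (count_space UNIV) (hist X k)) {xs} = emeasure M (hist X k -` {xs} \<inter> space M)"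
    by (subst emeasure_distr) auto
  also have "\<dots> = ennreal (pmf (histp \<pp> i0 k) xs)"
    by (simp add: emeasure_eq_measure measure_hist)
  finally show "emeasure (distr M (count_space UNIV) (hist X k)) {xs} = emeasure (measure_pmf (histp \<pp> i0 k)) {xs}"
    by (simp add: emeasure_pmf_single)
qed auto

lemma integral_hist:
  fixes g :: "enat list \<Rightarrow> real"
  shows "(\<integral>\<omega>. g (hist X k \<omega>) \<partial>M) = (\<integral>xs. g xs \<partial>histp \<pp> i0 k)"
  unfolding distr_hist[symmetric] by (subst integral_distr) auto

text \<open>The Markov property is needed given the whole history and not only the present state,
  since products of earlier factors and the exit state depend on the entire past.\<close>

lemma integral_step:
  fixes g :: "enat list \<Rightarrow> real"
  assumes g: "\<And>xs. \<bar>g xs\<bar> \<le> C"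
  shows "(\<integral>\<omega>. g (hist X (Suc k) \<omega>) \<partial>M) = (\<integral>\<omega>. (\<integral>y. g (y # hist X k \<omega>) \<partial>brw_step \<pp> (X k \<omega>)) \<partial>M)"
proof -
  have "(\<integral>\<omega>. g (hist X (Suc k) \<omega>) \<partial>M) = (\<integral>xs. g xs \<partial>histp \<pp> i0 (Suc k))"
    by (rule integral_hist)
  also have "\<dots> = (\<integral>xs. (\<integral>zs. g zs \<partial>map_pmf (\<lambda>y. y # xs) (brw_step \<pp> (hd xs))) \<partial>histp \<pp> i0 k)"
    unfolding histp.simps measure_pmf_bind
    by (rule integral_bind[where K = "count_space UNIV" and B = C and B' = 1])
      (auto simp: g measure_pmf_in_subprob_algebra measure_pmf.emeasure_space_1 intro!: measure_pmf.finite_measure)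
  also have "\<dots> = (\<integral>\<omega>. (\<integral>zs. g zs \<partial>map_pmf (\<lambda>y. y # hist X k \<omega>) (brw_step \<pp> (hd (hist X k \<omega>)))) \<partial>M)"
    by (rule integral_hist[symmetric])
  finally show ?thesis by simp
qed

lemma integrable_hist:
  fixes g :: "enat list \<Rightarrow> real"
  assumes "\<And>xs. \<bar>g xs\<bar> \<le> C"
  shows "integrable M (\<lambda>\<omega>. g (hist X k \<omega>))"
  using assms by (intro integrable_const_bound[of _ C]) (auto intro!: measurable_compose[OF hist_measurable])

end

section \<open>The Markov property of the walk at several times\<close>

primrec path_prod :: "(nat \<Rightarrow> ennreal) \<Rightarrow> nat \<Rightarrow> (ennreal \<Rightarrow>\<^sub>C real) list \<Rightarrow> real" where
  "path_prod Y i [] = 1"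
| "path_prod Y i (\<phi> # \<phi>s) = \<phi> (Y i) * path_prod Y (Suc i) \<phi>s"

context boundary_params
begin

lemma integral_walk_iter:
  assumes b: "boundary_random_walk (jm n) i0 M X"
    and Z: "\<And>xs. \<bar>Z xs\<bar> \<le> C" and f: "\<And>y. \<bar>f y\<bar> \<le> C'"
  shows "(\<integral>\<omega>. Z (hist X k \<omega>) * f (X (k + r) \<omega>) \<partial>M) = (\<integral>\<omega>. Z (hist X k \<omega>) * walk_iter n r f (X k \<omega>) \<partial>M)"
  using Z
proof (induction r arbitrary: k Z)
  case 0
  then show ?case by simp
next
  case (Suc r)
  interpret brw "jm n" i0 M X by (rule brw.intro[OF b])
  \<comment> \<open>Forgetting the newest state turns \<open>Z\<close> into a functional of the
    longer history, which is why the induction is over all functionals and all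
    \<open>k\<close>.\<close>
  have Zt: "\<bar>Z (tl xs)\<bar> \<le> C" for xs by (rule Suc.prems)
  have C0: "0 \<le> C" using order_trans[OF abs_ge_zero Suc.prems] .
  have pf: "\<bar>walk_iter n r f y\<bar> \<le> C'" for y by (rule walk_iter_bound[OF f])
  have "(\<integral>\<omega>. Z (hist X k \<omega>) * f (X (k + Suc r) \<omega>) \<partial>M) = (\<integral>\<omega>. Z (tl (hist X (Suc k) \<omega>)) * f (X (Suc k + r) \<omega>) \<partial>M)"
    by simp
  also have "\<dots> = (\<integral>\<omega>. Z (tl (hist X (Suc k) \<omega>)) * walk_iter n r f (X (Suc k) \<omega>) \<partial>M)"
    using Suc.IH[of "\<lambda>xs. Z (tl xs)" "Suc k", OF Zt] .
  also have "\<dots> = (\<integral>\<omega>. (\<lambda>xs. Z (tl xs) * walk_iter n r f (hd xs)) (hist X (Suc k) \<omega>) \<partial>M)"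
    by simp
  also have "\<dots> = (\<integral>\<omega>. (\<integral>y. Z (hist X k \<omega>) * walk_iter n r f y \<partial>step n (X k \<omega>)) \<partial>M)"
    using pf Suc.prems C0 by (subst integral_step[of _ "C * C'"]) (auto simp: abs_mult intro!: mult_mono)
  finally show ?case by simp
qed

text \<open>\<open>Z\<close> collects the factors already met. The first factor is moved into it,
  the induction hypothesis replaces the later ones by \<open>walk_prod\<close>, and
  \<open>integral_walk_iter\<close> brings the result back from step \<open>K (Suc i)\<close> to
  step \<open>K i\<close>.\<close>

lemma integral_path_prod_walk:
  assumes b: "boundary_random_walk (jm n) i0 M X"
    and K: "\<And>i. K i \<le> K (Suc i)" and Z: "\<And>xs. \<bar>Z xs\<bar> \<le> C"
  shows "(\<integral>\<omega>. Z (hist X (K i) \<omega>) * path_prod (\<lambda>j. scaled n (X (K j) \<omega>)) i \<phi>s \<partial>M)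
     = (\<integral>\<omega>. Z (hist X (K i) \<omega>) * walk_prod n K i \<phi>s (X (K i) \<omega>) \<partial>M)"
  using Z
proof (induction \<phi>s arbitrary: i Z C)
  case Nil
  then show ?case by simp
next
  case (Cons \<phi> \<phi>s)
  define d where "d = K (Suc i) - K i"
  have Kd: "K (Suc i) = K i + d" using K[of i] by (simp add: d_def)
  define Z' where "Z' xs = Z (drop d xs) * \<phi> (scaled n (hd (drop d xs)))" for xs
  define Z2 where "Z2 xs = Z xs * \<phi> (scaled n (hd xs))" for xs
  have C0: "0 \<le> C" using order_trans[OF abs_ge_zero Cons.prems] .
  have Z'b: "\<bar>Z' xs\<bar> \<le> C * norm \<phi>" for xs
    using Cons.prems[of "drop d xs"] norm_bounded[of \<phi> "scaled n (hd (drop d xs))"] C0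
    by (auto simp: Z'_def abs_mult intro!: mult_mono)
  have Z2b: "\<bar>Z2 xs\<bar> \<le> C * norm \<phi>" for xs
    using Cons.prems[of xs] norm_bounded[of \<phi> "scaled n (hd xs)"] C0
    by (auto simp: Z2_def abs_mult intro!: mult_mono)
  have Z'h: "Z' (hist X (K (Suc i)) \<omega>) = Z (hist X (K i) \<omega>) * \<phi> (scaled n (X (K i) \<omega>))" for \<omega>
    unfolding Z'_def Kd by (simp add: drop_hist)
  have "(\<integral>\<omega>. Z (hist X (K i) \<omega>) * path_prod (\<lambda>j. scaled n (X (K j) \<omega>)) i (\<phi> # \<phi>s) \<partial>M)
     = (\<integral>\<omega>. Z' (hist X (K (Suc i)) \<omega>) * path_prod (\<lambda>j. scaled n (X (K j) \<omega>)) (Suc i) \<phi>s \<partial>M)"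
    by (simp add: Z'h mult.assoc)
  also have "\<dots> = (\<integral>\<omega>. Z' (hist X (K (Suc i)) \<omega>) * walk_prod n K (Suc i) \<phi>s (X (K (Suc i)) \<omega>) \<partial>M)"
    by (rule Cons.IH[OF Z'b])
  also have "\<dots> = (\<integral>\<omega>. Z2 (hist X (K i) \<omega>) * walk_prod n K (Suc i) \<phi>s (X (K i + d) \<omega>) \<partial>M)"
    by (simp only: Z'h Z2_def hist_simps Kd[symmetric])
  also have "\<dots> = (\<integral>\<omega>. Z2 (hist X (K i) \<omega>) * walk_iter n d (walk_prod n K (Suc i) \<phi>s) (X (K i) \<omega>) \<partial>M)"
    by (rule integral_walk_iter[OF b Z2b walk_prod_bound])
  finally show ?case by (simp add: Z2_def d_def mult.assoc)
qed

lemma integral_path_prod: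
  assumes b: "boundary_random_walk (jm n) i0 M X" and K: "\<And>i. K i \<le> K (Suc i)" "K 0 = 0"
  shows "(\<integral>\<omega>. path_prod (\<lambda>j. scaled n (X (K j) \<omega>)) 0 \<phi>s \<partial>M) = walk_prod n K 0 \<phi>s (enat i0)"
proof -
  interpret brw "jm n" i0 M X by (rule brw.intro[OF b])
  have ae: "AE \<omega> in M. X 0 \<omega> = enat i0" using b by (simp add: boundary_random_walk_def)
  have "(\<integral>\<omega>. path_prod (\<lambda>j. scaled n (X (K j) \<omega>)) 0 \<phi>s \<partial>M) = (\<integral>\<omega>. walk_prod n K 0 \<phi>s (X 0 \<omega>) \<partial>M)"
    using integral_path_prod_walk[where K = K and Z = "\<lambda>_. 1" and C = 1 and i = 0 and \<phi>s = \<phi>s, OF b K(1)] K(2) by simp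
  also have "\<dots> = (\<integral>\<omega>. walk_prod n K 0 \<phi>s (enat i0) \<partial>M)"
    using ae by (intro integral_cong_AE) (auto elim!: eventually_mono intro!: measurable_compose[OF X_measurable])
  also have "\<dots> = walk_prod n K 0 \<phi>s (enat i0)" by (simp add: prob_space)
  finally show ?thesis .
qed

text \<open>
  The state \<open>(a, c, b)\<close> consists of the reference position \<open>a\<close>, reset whenever the walk has moved by more than \<open>\<epsilon>\<close>
  from it, the age \<open>c\<close> of the reference, and the information \<open>b\<close> whether some reference lasted at most \<open>D\<close> steps.
\<close>

primrec exit_state :: "nat \<Rightarrow> nat \<Rightarrow> real \<Rightarrow> enat list \<Rightarrow> enat \<times> nat \<times> bool" where
  "exit_state n D \<epsilon> [] = (0, 0, False)"
| "exit_state n D \<epsilon> (y # xs) = (if xs = [] then (y, 0, False) else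
     (case exit_state n D \<epsilon> xs of (a, c, b) \<Rightarrow>
       if \<epsilon> < compact_dist (scaled n y) (scaled n a) then (y, 0, b \<or> c < D) else (a, Suc c, b)))"

text \<open>Squaring makes the distance to a point twice differentiable in the position, as
  \<open>walk_gen_bound\<close> requires.\<close>

definition sqd :: "real \<Rightarrow> ennreal \<Rightarrow>\<^sub>C real" where
  "sqd c = Bcontfun (\<lambda>z. (psi z - c)\<^sup>2)"

lemma sqd_apply [simp]: "sqd c z = (psi z - c)\<^sup>2"
  unfolding sqd_def by (subst Bcontfun_inverse) (auto intro!: bcontfun_ennreal continuous_intros)

text \<open>With \<open>W x = 1 / (1 + x)\<close> the function is \<open>(W x - c)^2\<close>. As
  \<open>W x\<close> and \<open>\<bar>W x - c\<bar>\<close> are at most 1, it and its first two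
  derivatives are bounded by 1, 2 and 6, whose sum is the 9.\<close>

lemma step_sqd:
  assumes n: "admissible n" and c: "0 \<le> c" "c \<le> 1"
  shows "(\<integral>y. (psi (scaled n y) - c)\<^sup>2 \<partial>step n x) \<le> (psi (scaled n x) - c)\<^sup>2 + 9 * gen_const / (real n)\<^sup>2"
proof -
  have n0: "0 < n" using n by (auto simp: admissible_def)
  have sq1: "\<bar>u - c\<bar> \<le> 1" if "0 \<le> u" "u \<le> 1" for u using c that by (auto simp: abs_if)
  define W where "W x = 1 / (1 + x)" for x :: real
  have W: "(W has_real_derivative - (W x)\<^sup>2) (at x)" if "0 < x" for x
    unfolding W_def using that by (auto intro!: derivative_eq_intros simp: power2_eq_square)
  define f1 where "f1 x = - 2 * (W x - c) * (W x)\<^sup>2" for x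
  define f2 where "f2 x = 2 * (W x) ^ 4 + 4 * (W x - c) * (W x) ^ 3" for x
  have "norm (sqd c) \<le> 1"
    using sq1[OF psi_nonneg psi_le_1] by (intro norm_bound) (simp add: abs_square_le_1)
  moreover have "\<bar>walk_gen n (sqd c) x\<bar> \<le> gen_const * (norm (sqd c) + 2 + 6)"
  proof (rule walk_gen_bound[OF n, where ?f1.0 = f1 and ?f2.0 = f2])
    fix x :: real assume x: "0 < x"
    have u: "0 \<le> W x" "W x \<le> 1" using x by (auto simp: W_def)
    have "((\<lambda>x. (W x - c)\<^sup>2) has_real_derivative f1 x) (at x)"
      unfolding f1_def by (rule derivative_eq_intros W x refl)+ (simp add: power2_eq_square algebra_simps)
    moreover have "\<forall>\<^sub>F y in nhds x. (W y - c)\<^sup>2 = sqd c (ennreal y)"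
      using eventually_nhds_in_open[of "{0<..}" x] x by (auto elim!: eventually_mono simp: psi_ennreal W_def)
    ultimately show "((\<lambda>x. sqd c (ennreal x)) has_real_derivative f1 x) (at x)"
      by (subst (asm) DERIV_cong_ev[OF refl _ refl])
    show "(f1 has_real_derivative f2 x) (at x)"
      unfolding f1_def f2_def by (rule derivative_eq_intros W x refl)+ (simp add: power2_eq_square power3_eq_cube power4_eq_xxxx algebra_simps)
    have p: "\<bar>W x ^ k\<bar> \<le> 1" for k using u by (simp add: power_le_one)
    have "\<bar>f1 x\<bar> = 2 * (\<bar>W x - c\<bar> * \<bar>(W x)\<^sup>2\<bar>)" unfolding f1_def abs_mult by simp
    also have "\<dots> \<le> 2 * (1 * 1)" using sq1[OF u] p[of 2] by (intro mult_left_mono mult_mono) auto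
    finally show "\<bar>f1 x\<bar> \<le> 2" by simp
    have "\<bar>W x - c\<bar> * \<bar>W x ^ 3\<bar> \<le> 1 * 1" using sq1[OF u] p by (intro mult_mono) auto
    moreover have "\<bar>4 * (W x - c) * W x ^ 3\<bar> = 4 * (\<bar>W x - c\<bar> * \<bar>W x ^ 3\<bar>)" unfolding abs_mult by simp
    ultimately have "\<bar>4 * (W x - c) * W x ^ 3\<bar> \<le> 4" by linarith
    then show "\<bar>f2 x\<bar> \<le> 6" using p[of 4] unfolding f2_def by linarith
  qed
  moreover have "gen_const * (norm (sqd c) + 2 + 6) \<le> gen_const * 9" if "norm (sqd c) \<le> 1"
    using that gen_const_pos by (intro mult_left_mono) auto
  ultimately have "walk_gen n (sqd c) x \<le> gen_const * 9" by linarith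
  then have "(real n)\<^sup>2 * ((\<integral>y. (psi (scaled n y) - c)\<^sup>2 \<partial>step n x) - (psi (scaled n x) - c)\<^sup>2) \<le> gen_const * 9"
    by (simp add: walk_gen_def)
  then show ?thesis using n0 by (simp add: field_simps)
qed


text \<open>
  A supermartingale bounding the probability of a short exit within the remaining \<open>r\<close> steps.  The squared
  distance to the reference grows by at most \<open>\<theta> \<epsilon>\<^sup>2\<close> per step in mean and is at least \<open>\<epsilon>\<^sup>2\<close> at an exit; the second
  summand is the risk of the present reference, the last one pays the risk \<open>D \<theta>\<close> of each future reference.
\<close>

definition exit_potential :: "nat \<Rightarrow> nat \<Rightarrow> real \<Rightarrow> real \<Rightarrow> nat \<Rightarrow> enat \<times> nat \<times> bool \<Rightarrow> enat \<Rightarrow> real" where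
  "exit_potential n D \<epsilon> \<theta> r s y = (case s of (a, c, b) \<Rightarrow>
     of_bool b + (if c < D then (psi (scaled n y) - psi (scaled n a))\<^sup>2 / \<epsilon>\<^sup>2 + real (D - c) * \<theta> else 0)
     + real D * \<theta> * ((psi (scaled n y) - psi (scaled n a))\<^sup>2 / \<epsilon>\<^sup>2 + real r * \<theta>))"

lemma exit_potential_bounds:
  assumes "0 \<le> \<theta>" "0 < \<epsilon>"
  shows "of_bool (snd (snd s)) \<le> exit_potential n D \<epsilon> \<theta> r s y"
    and "exit_potential n D \<epsilon> \<theta> r s y \<le> 1 + (1 / \<epsilon>\<^sup>2 + real D * \<theta>) + real D * \<theta> * (1 / \<epsilon>\<^sup>2 + real r * \<theta>)"
proof -
  obtain a c b where s: "s = (a, c, b)" by (cases s)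
  define q where "q = (psi (scaled n y) - psi (scaled n a))\<^sup>2"
  have q: "0 \<le> q" "q \<le> 1"
    using psi_nonneg[of "scaled n y"] psi_nonneg[of "scaled n a"] psi_le_1[of "scaled n y"] psi_le_1[of "scaled n a"]
    by (auto simp: q_def abs_square_le_1 abs_if)
  have q': "0 \<le> q / \<epsilon>\<^sup>2" "q / \<epsilon>\<^sup>2 \<le> 1 / \<epsilon>\<^sup>2" using q assms by (auto intro: divide_right_mono)
  have P: "exit_potential n D \<epsilon> \<theta> r s y = of_bool b + (if c < D then q / \<epsilon>\<^sup>2 + real (D - c) * \<theta> else 0)
     + real D * \<theta> * (q / \<epsilon>\<^sup>2 + real r * \<theta>)"
    by (simp add: exit_potential_def s q_def)
  have 1: "0 \<le> (if c < D then q / \<epsilon>\<^sup>2 + real (D - c) * \<theta> else 0)"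
    using q' assms by auto
  have 2: "0 \<le> real D * \<theta> * (q / \<epsilon>\<^sup>2 + real r * \<theta>)"
    using q' assms by auto
  show "of_bool (snd (snd s)) \<le> exit_potential n D \<epsilon> \<theta> r s y"
    unfolding P using 1 2 s by simp
  have 3: "(if c < D then q / \<epsilon>\<^sup>2 + real (D - c) * \<theta> else 0) \<le> 1 / \<epsilon>\<^sup>2 + real D * \<theta>"
    using q' assms by (auto intro!: add_mono mult_right_mono)
  have 4: "real D * \<theta> * (q / \<epsilon>\<^sup>2 + real r * \<theta>) \<le> real D * \<theta> * (1 / \<epsilon>\<^sup>2 + real r * \<theta>)"
    using q' assms by (intro mult_left_mono add_mono) auto
  show "exit_potential n D \<epsilon> \<theta> r s y \<le> 1 + (1 / \<epsilon>\<^sup>2 + real D * \<theta>) + real D * \<theta> * (1 / \<epsilon>\<^sup>2 + real r * \<theta>)"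
    unfolding P using 3 4 by (intro add_mono) auto
qed

lemma exit_potential_abs:
  assumes "0 \<le> \<theta>" "0 < \<epsilon>"
  shows "\<bar>exit_potential n D \<epsilon> \<theta> r s y\<bar> = exit_potential n D \<epsilon> \<theta> r s y"
proof -
  have "0 \<le> exit_potential n D \<epsilon> \<theta> r s y"
    by (rule order_trans[OF _ exit_potential_bounds(1)[OF assms]]) simp
  then show ?thesis by simp
qed

lemma exit_potential_step:
  assumes n: "admissible n" and e: "0 < \<epsilon>" and \<theta>: "\<theta> = 9 * gen_const / ((real n)\<^sup>2 * \<epsilon>\<^sup>2)" and xs: "xs \<noteq> []"
  shows "(\<integral>y. exit_potential n D \<epsilon> \<theta> r (exit_state n D \<epsilon> (y # xs)) y \<partial>step n (hd xs))
     \<le> exit_potential n D \<epsilon> \<theta> (Suc r) (exit_state n D \<epsilon> xs) (hd xs)"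
proof -
  obtain a c b where s: "exit_state n D \<epsilon> xs = (a, c, b)" by (cases "exit_state n D \<epsilon> xs")
  define q where "q y = (psi (scaled n y) - psi (scaled n a))\<^sup>2 / \<epsilon>\<^sup>2" for y
  have th: "0 \<le> \<theta>" using gen_const_pos by (simp add: \<theta>)
  have q0: "0 \<le> q y" for y by (simp add: q_def)
  have q1: "q y \<le> 1 / \<epsilon>\<^sup>2" for y
    using psi_nonneg[of "scaled n y"] psi_nonneg[of "scaled n a"] psi_le_1[of "scaled n y"] psi_le_1[of "scaled n a"]
    unfolding q_def by (intro divide_right_mono) (auto simp: abs_square_le_1 abs_if)
  \<comment> \<open>After one step the potential is at most affine in \<open>q y\<close>, whether or
    not there is an exit. In \<open>\<beta>\<close> the remaining lifetime is already reduced by 1: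
    the \<open>\<theta>\<close> thus released, and the one held by \<open>Suc r\<close>, pay for the
    mean growth of \<open>q\<close>.\<close>
  define \<gamma> where "\<gamma> = (if c < D then 1 else 0) + real D * \<theta>"
  define \<beta> where "\<beta> = of_bool b + (if c < D then (real (D - c) - 1) * \<theta> else 0) + real D * \<theta> * (real r * \<theta>)"
  have \<gamma>0: "0 \<le> \<gamma>" using th by (simp add: \<gamma>_def)
  have le: "exit_potential n D \<epsilon> \<theta> r (exit_state n D \<epsilon> (y # xs)) y \<le> \<beta> + \<gamma> * q y" for y
  proof (cases "\<epsilon> < compact_dist (scaled n y) (scaled n a)")
    case True
    have "\<epsilon>\<^sup>2 \<le> (psi (scaled n y) - psi (scaled n a))\<^sup>2"
      using True e by (subst power2_abs[symmetric]) (intro power_mono, auto simp: compact_dist_psi)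
    then have "1 \<le> q y" using e by (simp add: q_def)
    have "exit_potential n D \<epsilon> \<theta> r (exit_state n D \<epsilon> (y # xs)) y = of_bool (b \<or> c < D) + real D * \<theta> + real D * \<theta> * (real r * \<theta>)"
      using True xs s by (simp add: exit_potential_def)
    \<comment> \<open>At an exit \<open>q y\<close> is at least 1, so the two parts of
      \<open>\<gamma>\<close> pay for a possible short exit and for the risk
      \<open>real D * \<theta>\<close> of the new reference, which starts at distance 0.\<close>
    also have "\<dots> \<le> \<beta> + \<gamma> * 1"
      using th by (auto simp: \<beta>_def \<gamma>_def)
    also have "\<dots> \<le> \<beta> + \<gamma> * q y"
      using \<gamma>0 \<open>1 \<le> q y\<close> by (intro add_left_mono mult_left_mono)
    finally show ?thesis .
  next
    case False
    have "exit_potential n D \<epsilon> \<theta> r (exit_state n D \<epsilon> (y # xs)) y = of_bool b + (if Suc c < D then q y + real (D - Suc c) * \<theta> else 0)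
       + real D * \<theta> * (q y + real r * \<theta>)"
      using False xs s by (simp add: exit_potential_def q_def)
    also have "\<dots> \<le> \<beta> + \<gamma> * q y"
    proof -
      consider "Suc c < D" | "D = Suc c" | "D \<le> c" by linarith
      then show ?thesis
        using q0[of y] th by cases (auto simp: \<beta>_def \<gamma>_def algebra_simps of_nat_diff)
    qed
    finally show ?thesis .
  qed
  have iq: "integrable (step n (hd xs)) q"
    using q0 q1 by (intro measure_pmf.integrable_const_bound[of _ "1 / \<epsilon>\<^sup>2"]) auto
  have "(\<integral>y. exit_potential n D \<epsilon> \<theta> r (exit_state n D \<epsilon> (y # xs)) y \<partial>step n (hd xs)) \<le> (\<integral>y. \<beta> + \<gamma> * q y \<partial>step n (hd xs))"
  proof (rule integral_mono[OF _ _ le])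
    show "integrable (step n (hd xs)) (\<lambda>y. exit_potential n D \<epsilon> \<theta> r (exit_state n D \<epsilon> (y # xs)) y)"
      using exit_potential_bounds(2)[OF th e] exit_potential_abs[OF th e]
      by (intro measure_pmf.integrable_const_bound[of _ "1 + (1 / \<epsilon>\<^sup>2 + real D * \<theta>) + real D * \<theta> * (1 / \<epsilon>\<^sup>2 + real r * \<theta>)"]) auto
  qed (use iq in auto)
  also have "\<dots> = \<beta> + \<gamma> * (\<integral>y. q y \<partial>step n (hd xs))" using iq by simp
  also have "\<dots> \<le> \<beta> + \<gamma> * (q (hd xs) + \<theta>)"
  proof (intro add_left_mono mult_left_mono \<gamma>0)
    have "(\<integral>y. q y \<partial>step n (hd xs)) = (\<integral>y. (psi (scaled n y) - psi (scaled n a))\<^sup>2 \<partial>step n (hd xs)) / \<epsilon>\<^sup>2"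
      by (simp add: q_def)
    also have "\<dots> \<le> ((psi (scaled n (hd xs)) - psi (scaled n a))\<^sup>2 + 9 * gen_const / (real n)\<^sup>2) / \<epsilon>\<^sup>2"
      using n psi_nonneg psi_le_1 by (intro divide_right_mono step_sqd) auto
    also have "\<dots> = q (hd xs) + \<theta>" by (simp add: q_def \<theta> add_divide_distrib)
    finally show "(\<integral>y. q y \<partial>step n (hd xs)) \<le> q (hd xs) + \<theta>" .
  qed
  also have "\<dots> = exit_potential n D \<epsilon> \<theta> (Suc r) (exit_state n D \<epsilon> xs) (hd xs)"
    by (auto simp: exit_potential_def s q_def \<beta>_def \<gamma>_def algebra_simps add_divide_distrib)
  finally show ?thesis .
qed

text \<open>Iterating the one-step inequality leads back to time 0, where the distance to the
  reference is 0 and only the terms in \<open>\<theta>\<close> remain. As \<open>\<theta>\<close> is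
  of order \<open>1 / n^2\<close>, taking \<open>D\<close> about \<open>\<delta> * n^2\<close> and
  \<open>k\<close> about \<open>T * n^2\<close> gives a bound of order \<open>\<delta>\<close>,
  uniformly in \<open>n\<close>.\<close>

lemma prob_short_exit:
  assumes b: "boundary_random_walk (jm n) i0 M X" and n: "admissible n" and e: "0 < \<epsilon>"
    and \<theta>: "\<theta> = 9 * gen_const / ((real n)\<^sup>2 * \<epsilon>\<^sup>2)"
  shows "measure M {\<omega> \<in> space M. snd (snd (exit_state n D \<epsilon> (hist X k \<omega>)))} \<le> real D * \<theta> * (1 + real k * \<theta>)"
proof -
  interpret brw "jm n" i0 M X by (rule brw.intro[OF b])
  have th: "0 \<le> \<theta>" using gen_const_pos by (simp add: \<theta>)
  define E where "E r j = (\<integral>\<omega>. exit_potential n D \<epsilon> \<theta> r (exit_state n D \<epsilon> (hist X j \<omega>)) (X j \<omega>) \<partial>M)" for r j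
  have bd: "\<bar>exit_potential n D \<epsilon> \<theta> r (exit_state n D \<epsilon> zs) (hd zs)\<bar> \<le> 1 + (1 / \<epsilon>\<^sup>2 + real D * \<theta>) + real D * \<theta> * (1 / \<epsilon>\<^sup>2 + real r * \<theta>)" for r zs
    unfolding exit_potential_abs[OF th e] by (rule exit_potential_bounds(2)[OF th e])
  have int: "integrable M (\<lambda>\<omega>. exit_potential n D \<epsilon> \<theta> r (exit_state n D \<epsilon> (hist X j \<omega>)) (X j \<omega>))" for r j
    using integrable_hist[of "\<lambda>zs. exit_potential n D \<epsilon> \<theta> r (exit_state n D \<epsilon> zs) (hd zs)", OF bd] by simp
  have step: "E r (Suc j) \<le> E (Suc r) j" for r j
  proof -
    have "E r (Suc j) = (\<integral>\<omega>. (\<lambda>zs. exit_potential n D \<epsilon> \<theta> r (exit_state n D \<epsilon> zs) (hd zs)) (hist X (Suc j) \<omega>) \<partial>M)"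
      by (simp add: E_def del: exit_state.simps)
    also have "\<dots> = (\<integral>\<omega>. (\<integral>y. exit_potential n D \<epsilon> \<theta> r (exit_state n D \<epsilon> (y # hist X j \<omega>)) y \<partial>step n (X j \<omega>)) \<partial>M)"
      by (subst integral_step[OF bd]) (simp del: exit_state.simps)
    also have "\<dots> \<le> E (Suc r) j"
      unfolding E_def
    proof (rule integral_mono[OF _ int])
      show "(\<integral>y. exit_potential n D \<epsilon> \<theta> r (exit_state n D \<epsilon> (y # hist X j \<omega>)) y \<partial>step n (X j \<omega>))
          \<le> exit_potential n D \<epsilon> \<theta> (Suc r) (exit_state n D \<epsilon> (hist X j \<omega>)) (X j \<omega>)" for \<omega>
        using exit_potential_step[OF n e \<theta>, of "hist X j \<omega>" D r] by (simp del: exit_state.simps)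
      have "\<bar>\<integral>y. exit_potential n D \<epsilon> \<theta> r (exit_state n D \<epsilon> (y # zs)) y \<partial>step n (hd zs)\<bar>
          \<le> 1 + (1 / \<epsilon>\<^sup>2 + real D * \<theta>) + real D * \<theta> * (1 / \<epsilon>\<^sup>2 + real r * \<theta>)" for zs
      proof -
        have "\<bar>exit_potential n D \<epsilon> \<theta> r (exit_state n D \<epsilon> (y # zs)) y\<bar> \<le> 1 + (1 / \<epsilon>\<^sup>2 + real D * \<theta>) + real D * \<theta> * (1 / \<epsilon>\<^sup>2 + real r * \<theta>)" for y
          using bd[of r "y # zs"] by (simp del: exit_state.simps)
        then show ?thesis
          using pmf_integral_close[of "\<lambda>y. exit_potential n D \<epsilon> \<theta> r (exit_state n D \<epsilon> (y # zs)) y"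
            "1 + (1 / \<epsilon>\<^sup>2 + real D * \<theta>) + real D * \<theta> * (1 / \<epsilon>\<^sup>2 + real r * \<theta>)" "\<lambda>_. 0" 0
            "1 + (1 / \<epsilon>\<^sup>2 + real D * \<theta>) + real D * \<theta> * (1 / \<epsilon>\<^sup>2 + real r * \<theta>)"] by (simp del: exit_state.simps)
      qed
      from integrable_hist[of "\<lambda>zs. \<integral>y. exit_potential n D \<epsilon> \<theta> r (exit_state n D \<epsilon> (y # zs)) y \<partial>step n (hd zs)", OF this]
      show "integrable M (\<lambda>\<omega>. \<integral>y. exit_potential n D \<epsilon> \<theta> r (exit_state n D \<epsilon> (y # hist X j \<omega>)) y \<partial>step n (X j \<omega>))"
        by (simp del: exit_state.simps)
    qed
    finally show ?thesis .
  qed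
  have dec: "E r j \<le> E (r + j) 0" for r j
  proof (induction j arbitrary: r)
    case (Suc j)
    show ?case using step[of r j] Suc[of "Suc r"] by simp
  qed simp
  have "measure M {\<omega> \<in> space M. snd (snd (exit_state n D \<epsilon> (hist X k \<omega>)))}
     = (\<integral>\<omega>. indicator {\<omega> \<in> space M. snd (snd (exit_state n D \<epsilon> (hist X k \<omega>)))} \<omega> \<partial>M)"
    by (simp add: Int_absorb2 subset_eq)
  also have "\<dots> \<le> E 0 k"
    unfolding E_def
  proof (rule integral_mono[OF _ int])
    have "integrable M (\<lambda>\<omega>. (\<lambda>zs. of_bool (snd (snd (exit_state n D \<epsilon> zs)))) (hist X k \<omega>) :: real)"
      by (rule integrable_hist[of _ 1]) simp
    then show "integrable M (indicator {\<omega> \<in> space M. snd (snd (exit_state n D \<epsilon> (hist X k \<omega>)))} :: _ \<Rightarrow> real)"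
      by (rule Bochner_Integration.integrable_cong[THEN iffD1, rotated 2]) (auto simp: indicator_def)
    show "indicator {\<omega> \<in> space M. snd (snd (exit_state n D \<epsilon> (hist X k \<omega>)))} \<omega>
        \<le> exit_potential n D \<epsilon> \<theta> 0 (exit_state n D \<epsilon> (hist X k \<omega>)) (X k \<omega>)" for \<omega>
      using exit_potential_bounds(1)[OF th e, where s = "exit_state n D \<epsilon> (hist X k \<omega>)" and n = n and D = D and r = 0 and y = "X k \<omega>"]
        exit_potential_abs[OF th e, of n D 0 "exit_state n D \<epsilon> (hist X k \<omega>)" "X k \<omega>"]
      by (auto simp: indicator_def split: if_splits)
  qed
  also have "\<dots> \<le> E k 0" using dec[of 0 k] by simp
  also have "E k 0 \<le> (\<integral>\<omega>. real D * \<theta> * (1 + real k * \<theta>) \<partial>M)"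
    unfolding E_def
  proof (rule integral_mono[OF int])
    show "exit_potential n D \<epsilon> \<theta> k (exit_state n D \<epsilon> (hist X 0 \<omega>)) (X 0 \<omega>) \<le> real D * \<theta> * (1 + real k * \<theta>)" for \<omega>
      by (simp add: exit_potential_def distrib_left)
  qed simp
  also have "\<dots> = real D * \<theta> * (1 + real k * \<theta>)" by (simp add: prob_space)
  finally show ?thesis .
qed

text \<open>Invariant of the walk up to step \<open>k\<close>: \<open>S\<close> holds the exit times
  and \<open>l\<close> the time of the current reference. Time 0 is adjoined as the first reference,
  so that the gap before the first exit counts too. The bound \<open>2 * \<epsilon>\<close> comes
  from comparing two positions with a common reference.\<close>

definition exit_set :: "nat \<Rightarrow> nat \<Rightarrow> real \<Rightarrow> (nat \<Rightarrow> enat) \<Rightarrow> nat \<Rightarrow> nat set \<Rightarrow> nat \<Rightarrow> bool" where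
  "exit_set n D \<epsilon> x k S l \<longleftrightarrow> S \<subseteq> {1..k} \<and> l \<in> insert 0 S \<and> (\<forall>s\<in>S. s \<le> l) \<and> l \<le> k \<and>
    (\<forall>j. l \<le> j \<longrightarrow> j \<le> k \<longrightarrow> compact_dist (scaled n (x j)) (scaled n (x l)) \<le> \<epsilon>) \<and>
    (\<forall>s\<in>insert 0 S. \<forall>s'\<in>insert 0 S. s < s' \<longrightarrow> s + D < s') \<and>
    (\<forall>j j'. j < j' \<longrightarrow> j' \<le> k \<longrightarrow> S \<inter> {j<..j'} = {} \<longrightarrow>
       compact_dist (scaled n (x j)) (scaled n (x j')) \<le> 2 * \<epsilon>)"

lemma exit_setD:
  assumes "exit_set n D \<epsilon> x k S l"
  shows "S \<subseteq> {1..k}" "l \<in> insert 0 S" "\<forall>s\<in>S. s \<le> l" "l \<le> k"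
    "\<forall>j. l \<le> j \<longrightarrow> j \<le> k \<longrightarrow> compact_dist (scaled n (x j)) (scaled n (x l)) \<le> \<epsilon>"
    "\<forall>s\<in>insert 0 S. \<forall>s'\<in>insert 0 S. s < s' \<longrightarrow> s + D < s'"
    "\<forall>j j'. j < j' \<longrightarrow> j' \<le> k \<longrightarrow> S \<inter> {j<..j'} = {} \<longrightarrow>
       compact_dist (scaled n (x j)) (scaled n (x j')) \<le> 2 * \<epsilon>"
  by (insert assms, unfold exit_set_def, (elim conjE, assumption)+)

text \<open>At an exit the new time joins \<open>S\<close> and becomes the reference. Otherwise a
  time not separated by \<open>S\<close> from the present one is not before \<open>l\<close>, so
  both positions are within \<open>\<epsilon>\<close> of the current reference.\<close>

lemma exit_structure:
  assumes "exit_state n D \<epsilon> (hist X k \<omega>) = (a, c, b)" "\<not> b" "0 \<le> \<epsilon>"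
  shows "\<exists>S l. exit_set n D \<epsilon> (\<lambda>j. X j \<omega>) k S l \<and> a = X l \<omega> \<and> c = k - l"
  using assms(1,2)
proof (induction k arbitrary: a c b)
  case 0
  then show ?case using assms(3) by (intro exI[of _ "{}"] exI[of _ 0]) (auto simp: exit_set_def)
next
  case (Suc k)
  obtain a0 c0 b0 where s0: "exit_state n D \<epsilon> (hist X k \<omega>) = (a0, c0, b0)" by (cases "exit_state n D \<epsilon> (hist X k \<omega>)")
  have st: "(a, c, b) = (if \<epsilon> < compact_dist (scaled n (X (Suc k) \<omega>)) (scaled n a0) then (X (Suc k) \<omega>, 0, b0 \<or> c0 < D) else (a0, Suc c0, b0))"
    using Suc.prems(1) s0 by simp
  then have "\<not> b0" using Suc.prems(2) by (auto split: if_splits)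
  then obtain S l where E: "exit_set n D \<epsilon> (\<lambda>j. X j \<omega>) k S l" and al: "a0 = X l \<omega>" "c0 = k - l"
    using Suc.IH[OF s0] by auto
  note S = exit_setD[OF E]
  show ?case
  proof (cases "\<epsilon> < compact_dist (scaled n (X (Suc k) \<omega>)) (scaled n a0)")
    case True
    then have a: "a = X (Suc k) \<omega>" "c = 0" "D \<le> c0" using st Suc.prems(2) by auto
    have up: "s \<le> l" if "s \<in> insert 0 S" for s using S(3) that by auto
    \<comment> \<open>The age counts the steps since the reference without the exit itself, which
      comes \<open>Suc c0\<close> steps after it; hence the strict inequality.\<close>
    have gap: "s + D < Suc k" if "s \<in> insert 0 S" for s
      using up[OF that] a(3) S(4) al by linarith
    show ?thesis
      unfolding exit_set_def
    proof (intro exI[of _ "insert (Suc k) S"] exI[of _ "Suc k"] conjI)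
      show "\<forall>s\<in>insert 0 (insert (Suc k) S). \<forall>s'\<in>insert 0 (insert (Suc k) S). s < s' \<longrightarrow> s + D < s'"
      proof (intro ballI impI)
        fix s s' assume ss: "s \<in> insert 0 (insert (Suc k) S)" "s' \<in> insert 0 (insert (Suc k) S)" "s < s'"
        have le: "r \<le> Suc k" if "r \<in> insert 0 (insert (Suc k) S)" for r using that S(1) by auto
        have s: "s \<in> insert 0 S" using ss le[of s'] by auto
        show "s + D < s'"
        proof (cases "s' = Suc k")
          case True
          then show ?thesis using gap[OF s] by simp
        next
          case False
          then show ?thesis using S(6) s ss(2,3) by auto
        qed
      qed
      show "\<forall>j j'. j < j' \<longrightarrow> j' \<le> Suc k \<longrightarrow> insert (Suc k) S \<inter> {j<..j'} = {} \<longrightarrow>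
       compact_dist (scaled n (X j \<omega>)) (scaled n (X j' \<omega>)) \<le> 2 * \<epsilon>"
      proof (intro allI impI)
        fix j j' assume j: "j < j'" "j' \<le> Suc k" "insert (Suc k) S \<inter> {j<..j'} = {}"
        then have "j' \<noteq> Suc k" by auto
        then show "compact_dist (scaled n (X j \<omega>)) (scaled n (X j' \<omega>)) \<le> 2 * \<epsilon>"
          using j S(7) by auto
      qed
    qed (use S(1) a assms(3) in \<open>auto simp: le_Suc_eq\<close>)
  next
    case False
    then have a: "a = X l \<omega>" "c = Suc c0" using st al by auto
    have near: "compact_dist (scaled n (X j \<omega>)) (scaled n (X l \<omega>)) \<le> \<epsilon>" if "l \<le> j" "j \<le> Suc k" for j
      using S(5) False al that by (cases "j = Suc k") auto
    show ?thesis
      unfolding exit_set_def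
    proof (intro exI[of _ S] exI[of _ l] conjI)
      show "\<forall>j j'. j < j' \<longrightarrow> j' \<le> Suc k \<longrightarrow> S \<inter> {j<..j'} = {} \<longrightarrow>
       compact_dist (scaled n (X j \<omega>)) (scaled n (X j' \<omega>)) \<le> 2 * \<epsilon>"
      proof (intro allI impI)
        fix j j' assume j: "j < j'" "j' \<le> Suc k" "S \<inter> {j<..j'} = {}"
        show "compact_dist (scaled n (X j \<omega>)) (scaled n (X j' \<omega>)) \<le> 2 * \<epsilon>"
        proof (cases "j' = Suc k")
          case True
          have "l \<le> j"
          proof (rule ccontr)
            assume "\<not> l \<le> j"
            then have "l \<in> S \<inter> {j<..j'}" using S(2,4) True by auto
            then show False using j by simp
          qed
          then have "compact_dist (scaled n (X j \<omega>)) (scaled n (X l \<omega>)) \<le> \<epsilon>" "compact_dist (scaled n (X j' \<omega>)) (scaled n (X l \<omega>)) \<le> \<epsilon>"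
            using j by (auto intro!: near)
          then show ?thesis
            using compact_dist_triangle[of "scaled n (X j \<omega>)" "scaled n (X j' \<omega>)" "scaled n (X l \<omega>)"]
              compact_dist_commute[of "scaled n (X l \<omega>)" "scaled n (X j' \<omega>)"] by linarith
        next
          case False
          then show ?thesis using j S(7) by auto
        qed
      qed
      show "\<forall>j. l \<le> j \<longrightarrow> j \<le> Suc k \<longrightarrow> compact_dist (scaled n (X j \<omega>)) (scaled n (X l \<omega>)) \<le> \<epsilon>"
        using near by blast
      show "\<forall>s\<in>insert 0 S. \<forall>s'\<in>insert 0 S. s < s' \<longrightarrow> s + D < s'" by (rule S(6))
    qed (use S(1-4) a al in \<open>auto simp: Suc_diff_le\<close>)
  qed
qed

text \<open>Division by \<open>D\<close> is injective on a set whose gaps exceed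
  \<open>D\<close>.\<close>

lemma card_separated:
  fixes S :: "nat set"
  assumes "S \<subseteq> {..k}" "0 < D" and sep: "\<And>s s'. s \<in> S \<Longrightarrow> s' \<in> S \<Longrightarrow> s < s' \<Longrightarrow> s + D < s'"
  shows "real (card S) \<le> real k / real D + 1"
proof -
  have less: "s div D < s' div D" if "s \<in> S" "s' \<in> S" "s < s'" for s s'
  proof -
    have "(s + D) div D \<le> s' div D" using sep[OF that] by (intro div_le_mono) simp
    then show ?thesis using assms(2) by simp
  qed
  have "inj_on (\<lambda>s. s div D) S"
    by (rule linorder_inj_onI') (use less in force)
  moreover have "(\<lambda>s. s div D) ` S \<subseteq> {..k div D}" using assms(1) by (auto intro: div_le_mono)
  ultimately have "card S \<le> card {..k div D}" by (intro card_inj_on_le) auto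
  then have "real (card S) \<le> real (k div D) + 1" by simp
  also have "real (k div D) \<le> real k / real D"
  proof -
    have "real (k div D * D) \<le> real k" by (simp only: of_nat_le_iff div_times_less_eq_dividend)
    then show ?thesis using assms(2) by (simp add: pos_le_divide_eq)
  qed
  finally show ?thesis by simp
qed

lemma rescale_eq: "rescale n X t \<omega> = scaled n (X (nat \<lfloor>(real n)\<^sup>2 * t\<rfloor>) \<omega>)"
  by (simp add: rescale_def scaled_def)

text \<open>Divided by \<open>n^2\<close>, the exit times and 0 form a set as required by
  \<open>skorokhod_dist_sampled_le\<close>: their gaps are at least \<open>\<delta>\<close>, so
  there are at most \<open>T / \<delta> + 1\<close> of them, a number independent of
  \<open>n\<close>.\<close>

lemma walk_path_close:
  assumes n: "0 < n" and nb: "\<not> snd (snd (exit_state n D \<epsilon> (hist X (nat \<lfloor>(real n)\<^sup>2 * T\<rfloor>) \<omega>)))"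
    and D: "0 < \<delta>" "\<delta> * (real n)\<^sup>2 \<le> real D" and e: "0 < \<epsilon>" and T: "0 \<le> T"
    and m: "0 < m" "1 / m \<le> \<eta> * \<delta>" and eta: "0 < \<eta>" "\<eta> \<le> 1/2"
  shows "skorokhod_dist (restrict (\<lambda>t. rescale n X t \<omega>) {0..}) (step_path m (\<lambda>i. rescale n X (real i / m) \<omega>))
    \<le> 2 * \<eta> + 2 * \<epsilon> + (T / \<delta> + 1) / m + exp (- T)"
proof -
  define N where "N = (real n)\<^sup>2"
  have N: "0 < N" using n by (simp add: N_def)
  define k where "k = nat \<lfloor>N * T\<rfloor>"
  have k: "real k \<le> N * T" using N T by (simp add: k_def)
  have D0: "0 < D"
  proof -
    have "0 < \<delta> * (real n)\<^sup>2" using D(1) n by simp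
    then show ?thesis using D(2) by linarith
  qed
  obtain a c b where st: "exit_state n D \<epsilon> (hist X k \<omega>) = (a, c, b)" by (cases "exit_state n D \<epsilon> (hist X k \<omega>)")
  then have "\<not> b" using nb by (simp add: k_def N_def)
  obtain S l where E: "exit_set n D \<epsilon> (\<lambda>j. X j \<omega>) k S l"
    using exit_structure[OF st \<open>\<not> b\<close> less_imp_le[OF e]] by auto
  note S = exit_setD(1)[OF E] exit_setD(6,7)[OF E, rule_format]
  have finS: "finite S" using S(1) by (rule finite_subset) simp
  define S' where "S' = (\<lambda>s. real s / N) ` insert 0 S"
  have "card S' \<le> card (insert 0 S)" unfolding S'_def using finS by (intro card_image_le) simp
  then have "real (card S') \<le> real (card (insert 0 S))" by simp
  also have "\<dots> \<le> real k / real D + 1"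
    using S(1,2) D0 by (intro card_separated) auto
  also have "real k / real D \<le> (N * T) / (\<delta> * N)"
    using k D N T by (intro frac_le) (auto simp: N_def)
  also have "\<dots> = T / \<delta>" using N by simp
  finally have card: "real (card S') / m \<le> (T / \<delta> + 1) / m" using m by (simp add: divide_right_mono)
  have gapN: "\<delta> * N \<le> real s' - real s" if "s \<in> insert 0 S" "s' \<in> insert 0 S" "s < s'" for s s'
    using S(2)[OF that] D(2) by (simp add: N_def)
  let ?x = "restrict (\<lambda>t. rescale n X t \<omega>) {0..}"
  have "skorokhod_dist ?x (step_path m (\<lambda>i. ?x (real i / m))) \<le> 2 * \<eta> + 2 * \<epsilon> + card S' / m + exp (- T)"
  proof (rule skorokhod_dist_sampled_le[OF m(1), where d = \<delta>])
    show "finite S'" "0 \<in> S'" "S' \<subseteq> {0..}" using finS N by (auto simp: S'_def)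
    show "\<delta> \<le> \<bar>s - s'\<bar>" if ss: "s \<in> S'" "s' \<in> S'" "s \<noteq> s'" for s s'
    proof -
      obtain r where r1: "r \<in> insert 0 S" "s = real r / N" using ss(1) unfolding S'_def by blast
      obtain r' where r2: "r' \<in> insert 0 S" "s' = real r' / N" using ss(2) unfolding S'_def by blast
      note r = r1(1) r2(1) r1(2) r2(2)
      then have "r \<noteq> r'" using ss(3) by auto
      then have "\<delta> * N \<le> \<bar>real r - real r'\<bar>" using gapN[of r r'] gapN[of r' r] r by (cases "r < r'") auto
      then have "\<delta> \<le> \<bar>real r - real r'\<bar> / N" using N by (simp add: pos_le_divide_eq)
      then show ?thesis using N r by (simp add: diff_divide_distrib[symmetric])
    qed
    fix t t' assume t: "0 \<le> t" "t < t'" "t' < T" "S' \<inter> {t<..t'} = {}"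
    define j j' where "j = nat \<lfloor>N * t\<rfloor>" and "j' = nat \<lfloor>N * t'\<rfloor>"
    have Nt: "0 \<le> N * t" "N * t \<le> N * t'" "N * t' \<le> N * T" using N t by auto
    have jj: "j \<le> j'" "j' \<le> k" using Nt by (auto simp: j_def j'_def k_def intro!: nat_mono floor_mono)
    have j1: "N * t < real j + 1" "real j' \<le> N * t'" using Nt by (auto simp: j_def j'_def)
    have "S \<inter> {j<..j'} = {}"
    proof (rule ccontr)
      assume "S \<inter> {j<..j'} \<noteq> {}"
      then obtain s where s: "s \<in> S" "j < s" "s \<le> j'" by auto
      have "N * t < real s" "real s \<le> N * t'" using j1 s by linarith+
      then have "t < real s / N" "real s / N \<le> t'"
        using N by (auto simp: pos_less_divide_eq pos_divide_le_eq mult.commute)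
      then have "real s / N \<in> S' \<inter> {t<..t'}" using s by (auto simp: S'_def)
      then show False using t by simp
    qed
    then have "compact_dist (scaled n (X j \<omega>)) (scaled n (X j' \<omega>)) \<le> 2 * \<epsilon>"
      using S(3)[of j j'] jj e by (cases "j = j'") auto
    then show "compact_dist (?x t) (?x t') \<le> 2 * \<epsilon>"
      using t by (simp add: rescale_eq j_def j'_def N_def)
  qed (use m eta e in auto)
  moreover have "step_path m (\<lambda>i. ?x (real i / m)) = step_path m (\<lambda>i. rescale n X (real i / m) \<omega>)"
    using m by simp
  ultimately show ?thesis using card by simp
qed

end

section \<open>Convergence of the laws\<close>

lemma path_prod_map:
  "path_prod Y i (map g [i..<i + k]) = (\<Prod>j\<in>{i..<i + k}. g j (Y j))"
proof (induction k arbitrary: i)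
  case (Suc k)
  have "[i..<i + Suc k] = i # [Suc i..<Suc i + k]" by (simp add: upt_conv_Cons)
  moreover have "{i..<i + Suc k} = insert i {Suc i..<Suc i + k}" by auto
  ultimately show ?case using Suc[of "Suc i"] by simp
qed simp

lemma path_prod_map_atMost: "path_prod Y 0 (map g [0..<Suc I]) = (\<Prod>j\<le>I. g j (Y j))"
  using path_prod_map[of Y 0 g "Suc I"] by (simp add: atLeast0LessThan lessThan_Suc_atMost del: upt_Suc)

section \<open>The Markov property of the limit process\<close>

lemma space_past: "space (past M B s) = space M"
  by (simp add: past_def space_measure_of_conv)

lemma sets_past: "sets (past M B s) = sigma_sets (space M) {B u -` A \<inter> space M | u A. 0 \<le> u \<and> u \<le> s \<and> A \<in> sets borel}"
  unfolding past_def by (rule sets_measure_of) auto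

lemma past_mono: "s \<le> t \<Longrightarrow> sets (past M B s) \<subseteq> sets (past M B t)"
  unfolding sets_past by (rule sigma_sets_mono') fastforce

lemma measurable_past_mono:
  assumes "f \<in> past M B s \<rightarrow>\<^sub>M N" "s \<le> t"
  shows "f \<in> past M B t \<rightarrow>\<^sub>M N"
  by (rule measurable_mono[THEN subsetD, OF _ _ _ _ assms(1)]) (use past_mono[OF assms(2)] in \<open>auto simp: space_past\<close>)

lemma measurable_past:
  assumes "0 \<le> u" "u \<le> s"
  shows "B u \<in> past M B s \<rightarrow>\<^sub>M borel"
proof (rule measurableI)
  fix A :: "ennreal set" assume "A \<in> sets borel"
  then have "B u -` A \<inter> space M \<in> sets (past M B s)"
    unfolding sets_past using assms by (intro sigma_sets.Basic) blast
  then show "B u -` A \<inter> space (past M B s) \<in> sets (past M B s)" by (simp add: space_past)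
qed simp

context feller
begin

lemma kernel_measure_measurable:
  assumes "0 \<le> t" "A \<in> sets borel"
  shows "(\<lambda>z. measure (\<kappa> t z) A) \<in> borel_measurable borel"
proof -
  have "(\<lambda>z. emeasure (\<kappa> t z) A) \<in> borel_measurable borel"
    using measurable_prob_algebraD[OF kernel[OF assms(1)]] measurable_emeasure_subprob_algebra[OF assms(2)]
    by (rule measurable_compose)
  then show ?thesis unfolding measure_def by measurable
qed

context
  fixes x0 :: ennreal and M :: "'w measure" and B :: "real \<Rightarrow> 'w \<Rightarrow> ennreal"
  assumes markov: "markov_process \<kappa> x0 M B"
begin

interpretation prob_space M using markov by (simp add: markov_process_def)

lemma B_measurable: "0 \<le> t \<Longrightarrow> B t \<in> borel_measurable M"
  using markov by (simp add: markov_process_def)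

lemma subalgebra_past: "subalgebra M (past M B s)"
proof -
  have "{B u -` A \<inter> space M | u A. 0 \<le> u \<and> u \<le> s \<and> A \<in> sets borel} \<subseteq> sets M"
    using measurable_sets[OF B_measurable] by blast
  then show ?thesis
    unfolding subalgebra_def space_past sets_past by (auto intro: sets.sigma_sets_subset[THEN subsetD])
qed

lemma markov_indicator:
  assumes s: "0 \<le> s" and t: "0 \<le> t" and Z: "Z \<in> borel_measurable (past M B s)" "\<And>\<omega>. \<bar>Z \<omega>\<bar> \<le> (C::real)"
    and A: "A \<in> sets borel"
  shows "(\<integral>\<omega>. Z \<omega> * indicator A (B (s + t) \<omega>) \<partial>M) = (\<integral>\<omega>. Z \<omega> * measure (\<kappa> t (B s \<omega>)) A \<partial>M)"
proof -
  interpret finite_measure_subalgebra M "past M B s"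
    using subalgebra_past by unfold_locales
  have ZM: "Z \<in> borel_measurable M" by (rule measurable_from_subalg[OF subalgebra_past Z(1)])
  have BM: "B (s + t) \<in> borel_measurable M" using s t by (intro B_measurable) simp
  have gM: "(\<lambda>\<omega>. indicator A (B (s + t) \<omega>) :: real) \<in> borel_measurable M"
    by (rule measurable_compose[OF BM]) (use A in measurable)
  have C0: "0 \<le> C" using order_trans[OF abs_ge_zero Z(2)] .
  have int: "integrable M (\<lambda>\<omega>. Z \<omega> * indicator A (B (s + t) \<omega>))"
    using ZM gM Z(2) C0 by (intro integrable_const_bound[of _ C]) (auto simp: indicator_def)
  have "(\<integral>\<omega>. Z \<omega> * indicator A (B (s + t) \<omega>) \<partial>M)
      = (\<integral>\<omega>. Z \<omega> * real_cond_exp M (past M B s) (\<lambda>\<omega>. indicator A (B (s + t) \<omega>)) \<omega> \<partial>M)"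
    by (rule real_cond_exp_intg(2)[OF int Z(1) gM, symmetric])
  also have "\<dots> = (\<integral>\<omega>. Z \<omega> * measure (\<kappa> t (B s \<omega>)) A \<partial>M)"
  proof (rule integral_cong_AE)
    have "AE \<omega> in M. real_cond_exp M (past M B s) (\<lambda>\<omega>. indicator A (B (s + t) \<omega>)) \<omega> = measure (\<kappa> t (B s \<omega>)) A"
      using markov s t A by (simp add: markov_process_def)
    then show "AE \<omega> in M. Z \<omega> * real_cond_exp M (past M B s) (\<lambda>\<omega>. indicator A (B (s + t) \<omega>)) \<omega> = Z \<omega> * measure (\<kappa> t (B s \<omega>)) A"
      by eventually_elim simp
    have "(\<lambda>z. measure (\<kappa> t z) A) \<in> borel_measurable borel"
      by (rule kernel_measure_measurable[OF t A])
    then show "(\<lambda>\<omega>. Z \<omega> * measure (\<kappa> t (B s \<omega>)) A) \<in> borel_measurable M"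
      using ZM measurable_compose[OF B_measurable[OF s]] by (intro borel_measurable_times) auto
  qed (use ZM in measurable)
  finally show ?thesis .
qed

text \<open>The Markov property is given for indicators. A non-negative \<open>Z\<close>, used as a
  density, turns the claim into the equality of two measures on the state space, which is checked on
  sets and then integrated against \<open>F\<close>.\<close>

lemma markov_integral_nonneg:
  fixes F :: "ennreal \<Rightarrow>\<^sub>C real"
  assumes s: "0 \<le> s" and t: "0 \<le> t" and Z: "Z \<in> borel_measurable (past M B s)" "\<And>\<omega>. 0 \<le> Z \<omega>" "\<And>\<omega>. Z \<omega> \<le> (C::real)"
  shows "(\<integral>\<omega>. Z \<omega> * F (B (s + t) \<omega>) \<partial>M) = (\<integral>\<omega>. Z \<omega> * trans_op t F (B s \<omega>) \<partial>M)"
proof -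
  have ZM: "Z \<in> borel_measurable M" by (rule measurable_from_subalg[OF subalgebra_past Z(1)])
  have Bst: "B (s + t) \<in> borel_measurable M" and Bs: "B s \<in> borel_measurable M"
    using s t by (auto intro: B_measurable)
  define N where "N = density M (\<lambda>\<omega>. ennreal (Z \<omega>))"
  have N: "sets N = sets M" "space N = space M" by (simp_all add: N_def)
  have iZ: "integrable M Z" using ZM Z(2,3) by (intro integrable_const_bound[of _ C]) auto
  have "emeasure N (space N) = ennreal (\<integral>\<omega>. Z \<omega> \<partial>M)"
    using ZM iZ Z(2) by (simp add: N_def emeasure_density nn_integral_eq_integral cong: nn_integral_cong)
  then interpret N: finite_measure N by (intro finite_measureI) simp
  have BN: "B (s + t) \<in> N \<rightarrow>\<^sub>M borel" "B s \<in> N \<rightarrow>\<^sub>M borel"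
    using Bst Bs N by (simp_all cong: measurable_cong_sets)
  define P where "P = distr N borel (B s)"
  interpret P: finite_measure P unfolding P_def by (rule N.finite_measure_distr[OF BN(2)])
  have kP: "\<kappa> t \<in> P \<rightarrow>\<^sub>M subprob_algebra borel"
    using measurable_prob_algebraD[OF kernel[OF t]] by (simp add: P_def cong: measurable_cong_sets)
  have "distr N borel (B (s + t)) = P \<bind> \<kappa> t"
  proof (rule measure_eqI)
    show "sets (distr N borel (B (s + t))) = sets (P \<bind> \<kappa> t)"
      using sets_bind[of P "\<kappa> t" borel] sets_kernel[OF t] by (simp add: P_def)
    fix A :: "ennreal set" assume "A \<in> sets (distr N borel (B (s + t)))"
    then have A: "A \<in> sets borel" by simp
    have Zb: "\<bar>Z \<omega>\<bar> \<le> C" for \<omega> using Z(2,3)[of \<omega>] by simp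
    have mk: "(\<lambda>z. measure (\<kappa> t z) A) \<in> borel_measurable borel"
      by (rule kernel_measure_measurable[OF t A])
    have ek: "emeasure (\<kappa> t z) A = ennreal (measure (\<kappa> t z) A)" for z
      using prob_space.finite_measure[OF prob_kernel[OF t]] by (rule finite_measure.emeasure_eq_measure)
    have indM: "(\<lambda>\<omega>. indicator A (B (s + t) \<omega>) :: real) \<in> borel_measurable M"
      by (rule measurable_compose[OF Bst]) (use A in measurable)
    have kM: "(\<lambda>\<omega>. measure (\<kappa> t (B s \<omega>)) A) \<in> borel_measurable M"
      by (rule measurable_compose[OF Bs mk])
    have C0: "0 \<le> C" using order_trans[OF Z(2) Z(3)] .
    have i1: "integrable M (\<lambda>\<omega>. Z \<omega> * indicator A (B (s + t) \<omega>))"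
      using ZM indM Zb C0 by (intro integrable_const_bound[of _ C]) (auto simp: indicator_def)
    have "Z \<omega> * measure (\<kappa> t (B s \<omega>)) A \<le> C * 1" for \<omega>
      using Z(2,3) C0 by (intro mult_mono prob_space.prob_le_1[OF prob_kernel[OF t]]) auto
    then have i2: "integrable M (\<lambda>\<omega>. Z \<omega> * measure (\<kappa> t (B s \<omega>)) A)"
      using ZM kM Z(2) by (intro integrable_const_bound[of _ C]) auto
    have "emeasure (distr N borel (B (s + t))) A = emeasure N (B (s + t) -` A \<inter> space N)"
      by (rule emeasure_distr[OF BN(1) A])
    also have "\<dots> = (\<integral>\<^sup>+\<omega>. ennreal (Z \<omega>) * indicator (B (s + t) -` A \<inter> space N) \<omega> \<partial>M)"
      unfolding N_def using ZM measurable_sets[OF BN(1) A] N by (subst emeasure_density) auto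
    also have "\<dots> = (\<integral>\<^sup>+\<omega>. ennreal (Z \<omega> * indicator A (B (s + t) \<omega>)) \<partial>M)"
      using N by (intro nn_integral_cong) (auto simp: indicator_def)
    also have "\<dots> = ennreal (\<integral>\<omega>. Z \<omega> * indicator A (B (s + t) \<omega>) \<partial>M)"
      using i1 Z(2) by (intro nn_integral_eq_integral) auto
    also have "\<dots> = ennreal (\<integral>\<omega>. Z \<omega> * measure (\<kappa> t (B s \<omega>)) A \<partial>M)"
      using markov_indicator[OF s t Z(1) Zb A] by simp
    also have "\<dots> = (\<integral>\<^sup>+\<omega>. ennreal (Z \<omega> * measure (\<kappa> t (B s \<omega>)) A) \<partial>M)"
      using i2 Z(2) by (intro nn_integral_eq_integral[symmetric]) auto
    also have "\<dots> = (\<integral>\<^sup>+\<omega>. ennreal (Z \<omega>) * emeasure (\<kappa> t (B s \<omega>)) A \<partial>M)"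
      using Z(2) by (intro nn_integral_cong) (simp add: ek ennreal_mult)
    also have "\<dots> = (\<integral>\<^sup>+\<omega>. emeasure (\<kappa> t (B s \<omega>)) A \<partial>N)"
      unfolding N_def ek using ZM kM by (subst nn_integral_density) auto
    also have "\<dots> = (\<integral>\<^sup>+z. emeasure (\<kappa> t z) A \<partial>P)"
      unfolding P_def ek using BN(2) mk by (subst nn_integral_distr) auto
    also have "\<dots> = emeasure (P \<bind> \<kappa> t) A"
      using kP A by (intro emeasure_bind[symmetric]) (auto simp: P_def)
    finally show "emeasure (distr N borel (B (s + t))) A = emeasure (P \<bind> \<kappa> t) A" .
  qed
  then have "(\<integral>z. F z \<partial>distr N borel (B (s + t))) = (\<integral>z. F z \<partial>(P \<bind> \<kappa> t))" by simp
  also have "(\<integral>z. F z \<partial>(P \<bind> \<kappa> t)) = (\<integral>w. \<integral>y. F y \<partial>\<kappa> t w \<partial>P)"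
  proof (rule integral_bind[where K = borel and B = "norm F" and B' = 1])
    show "AE x in P. emeasure (\<kappa> t x) (space (\<kappa> t x)) \<le> ennreal 1"
      using prob_space.emeasure_space_1[OF prob_kernel[OF t]] by simp
  qed (use norm_bounded[of F] kP P.finite_measure_axioms in auto)
  also have "\<dots> = (\<integral>w. trans_op t F w \<partial>P)" using t by (simp add: trans_op_apply)
  finally have "(\<integral>\<omega>. F (B (s + t) \<omega>) \<partial>N) = (\<integral>\<omega>. trans_op t F (B s \<omega>) \<partial>N)"
    unfolding P_def using BN by (simp add: integral_distr)
  then show ?thesis
    unfolding N_def using ZM Z(2) measurable_compose[OF Bst apply_bcontfun_measurable] measurable_compose[OF Bs apply_bcontfun_measurable]
    by (simp add: integral_density)
qed

lemma markov_integral: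
  fixes F :: "ennreal \<Rightarrow>\<^sub>C real"
  assumes s: "0 \<le> s" and t: "0 \<le> t" and Z: "Z \<in> borel_measurable (past M B s)" "\<And>\<omega>. \<bar>Z \<omega>\<bar> \<le> (C::real)"
  shows "(\<integral>\<omega>. Z \<omega> * F (B (s + t) \<omega>) \<partial>M) = (\<integral>\<omega>. Z \<omega> * trans_op t F (B s \<omega>) \<partial>M)"
proof -
  have ZM: "Z \<in> borel_measurable M" by (rule measurable_from_subalg[OF subalgebra_past Z(1)])
  have C0: "0 \<le> C" using order_trans[OF abs_ge_zero Z(2)] .
  have int: "integrable M (\<lambda>\<omega>. Y \<omega> * G (B u \<omega>))"
    if "Y \<in> borel_measurable M" "\<And>\<omega>. \<bar>Y \<omega>\<bar> \<le> C" "0 \<le> u" for Y u and G :: "ennreal \<Rightarrow>\<^sub>C real"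
    using that norm_bounded[of G] measurable_compose[OF B_measurable[OF that(3)] apply_bcontfun_measurable] C0
    by (intro integrable_const_bound[of _ "C * norm G"]) (auto simp: abs_mult intro!: mult_mono)
  have eq: "(\<integral>\<omega>. (Z \<omega> + C) * G (B u \<omega>) \<partial>M) = (\<integral>\<omega>. Z \<omega> * G (B u \<omega>) \<partial>M) + (\<integral>\<omega>. C * G (B u \<omega>) \<partial>M)"
    if "0 \<le> u" for u and G :: "ennreal \<Rightarrow>\<^sub>C real"
    unfolding distrib_right using C0 that int[OF ZM Z(2)] int[of "\<lambda>_. C"] by (intro Bochner_Integration.integral_add) auto
  \<comment> \<open>Adding \<open>C\<close> makes the weight non-negative; the contribution of the
    constant is computed in the same way and subtracted.\<close>
  have a: "(\<integral>\<omega>. (Z \<omega> + C) * F (B (s + t) \<omega>) \<partial>M) = (\<integral>\<omega>. (Z \<omega> + C) * trans_op t F (B s \<omega>) \<partial>M)"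
  proof (rule markov_integral_nonneg[OF s t])
    show "(\<lambda>\<omega>. Z \<omega> + C) \<in> borel_measurable (past M B s)" using Z(1) by measurable
    show "0 \<le> Z \<omega> + C" for \<omega> using Z(2)[of \<omega>] by linarith
    show "Z \<omega> + C \<le> 2 * C" for \<omega> using Z(2)[of \<omega>] by linarith
  qed
  have b: "(\<integral>\<omega>. C * F (B (s + t) \<omega>) \<partial>M) = (\<integral>\<omega>. C * trans_op t F (B s \<omega>) \<partial>M)"
    by (rule markov_integral_nonneg[OF s t]) (use C0 in auto)
  have "0 \<le> s + t" using s t by simp
  then show ?thesis using a b eq[of "s + t" F] eq[OF s, of "trans_op t F"] by linarith
qed

lemma integral_path_prod_markov:
  assumes \<tau>: "0 \<le> \<tau>" and Z: "Z \<in> borel_measurable (past M B (real i * \<tau>))" "\<And>\<omega>. \<bar>Z \<omega>\<bar> \<le> (C::real)"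
  shows "(\<integral>\<omega>. Z \<omega> * path_prod (\<lambda>j. B (real j * \<tau>) \<omega>) i \<phi>s \<partial>M) = (\<integral>\<omega>. Z \<omega> * feller_prod \<tau> \<phi>s (B (real i * \<tau>) \<omega>) \<partial>M)"
  using Z
proof (induction \<phi>s arbitrary: i Z C)
  case Nil
  then show ?case by simp
next
  case (Cons \<phi> \<phi>s)
  have it: "0 \<le> real i * \<tau>" "real i * \<tau> \<le> real (Suc i) * \<tau>" "real (Suc i) * \<tau> = real i * \<tau> + \<tau>"
    using \<tau> by (auto simp: distrib_right)
  have C0: "0 \<le> C" using order_trans[OF abs_ge_zero Cons.prems(2)] .
  define Z' where "Z' \<omega> = Z \<omega> * \<phi> (B (real i * \<tau>) \<omega>)" for \<omega>
  have Z'm: "Z' \<in> borel_measurable (past M B (real i * \<tau>))"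
    unfolding Z'_def using Cons.prems(1) measurable_compose[OF measurable_past[OF it(1) order_refl] apply_bcontfun_measurable]
    by (intro borel_measurable_times) auto
  have Z'b: "\<bar>Z' \<omega>\<bar> \<le> C * norm \<phi>" for \<omega>
    using Cons.prems(2)[of \<omega>] norm_bounded[of \<phi> "B (real i * \<tau>) \<omega>"] C0
    by (auto simp: Z'_def abs_mult intro!: mult_mono)
  have "(\<integral>\<omega>. Z \<omega> * path_prod (\<lambda>j. B (real j * \<tau>) \<omega>) i (\<phi> # \<phi>s) \<partial>M)
     = (\<integral>\<omega>. Z' \<omega> * path_prod (\<lambda>j. B (real j * \<tau>) \<omega>) (Suc i) \<phi>s \<partial>M)"
    by (simp add: Z'_def mult.assoc)
  also have "\<dots> = (\<integral>\<omega>. Z' \<omega> * feller_prod \<tau> \<phi>s (B (real (Suc i) * \<tau>) \<omega>) \<partial>M)"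
    by (rule Cons.IH[OF measurable_past_mono[OF Z'm it(2)] Z'b])
  also have "\<dots> = (\<integral>\<omega>. Z' \<omega> * trans_op \<tau> (feller_prod \<tau> \<phi>s) (B (real i * \<tau>) \<omega>) \<partial>M)"
    unfolding it(3) by (rule markov_integral[OF it(1) \<tau> Z'm Z'b])
  finally show ?case by (simp add: Z'_def mult.assoc)
qed

lemma integral_path_prod_feller:
  assumes \<tau>: "0 \<le> \<tau>"
  shows "(\<integral>\<omega>. path_prod (\<lambda>j. B (real j * \<tau>) \<omega>) 0 \<phi>s \<partial>M) = feller_prod \<tau> \<phi>s x0"
proof -
  have ae: "AE \<omega> in M. B 0 \<omega> = x0" using markov by (simp add: markov_process_def)
  have "(\<integral>\<omega>. path_prod (\<lambda>j. B (real j * \<tau>) \<omega>) 0 \<phi>s \<partial>M) = (\<integral>\<omega>. feller_prod \<tau> \<phi>s (B 0 \<omega>) \<partial>M)"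
    using integral_path_prod_markov[OF \<tau>, of "\<lambda>_. 1" 0 1 \<phi>s] by simp
  also have "\<dots> = (\<integral>\<omega>. feller_prod \<tau> \<phi>s x0 \<partial>M)"
    using ae measurable_compose[OF B_measurable[OF order_refl] apply_bcontfun_measurable]
    by (intro integral_cong_AE) (auto elim!: eventually_mono)
  also have "\<dots> = feller_prod \<tau> \<phi>s x0" by (simp add: prob_space)
  finally show ?thesis .
qed

end

end

context boundary_params
begin

lemma rescale_measurable:
  assumes "boundary_random_walk \<pp> i0 N X"
  shows "rescale n X t \<in> borel_measurable N"
proof -
  interpret brw \<pp> i0 N X by (rule brw.intro[OF assms])
  have "(\<lambda>\<omega>. scaled n (X (nat \<lfloor>(real n)\<^sup>2 * t\<rfloor>) \<omega>)) \<in> borel_measurable N"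
    by (rule measurable_compose[OF X_measurable]) simp
  moreover have "rescale n X t = (\<lambda>\<omega>. scaled n (X (nat \<lfloor>(real n)\<^sup>2 * t\<rfloor>) \<omega>))"
    by (rule ext) (rule rescale_eq)
  ultimately show ?thesis by simp
qed

lemma rescale_cadlag:
  assumes "0 < n"
  shows "cadlag (\<lambda>t. rescale n X t \<omega>)"
proof -
  have "step_path ((real n)\<^sup>2) (\<lambda>j. scaled n (X j \<omega>)) \<in> skorokhod_space"
    using assms by (intro step_path_in_skorokhod_space) simp
  then have "cadlag (step_path ((real n)\<^sup>2) (\<lambda>j. scaled n (X j \<omega>)))"
    by (simp add: skorokhod_space_def)
  then show ?thesis
    by (rule cadlag_cong) (simp add: step_path_def rescale_eq)
qed

text \<open>
  The mesh does not depend on \<open>n\<close>: this takes the place of tightness of the laws.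
\<close>

lemma walk_discretization:
  fixes h :: "(real \<Rightarrow> ennreal) \<Rightarrow> real"
  assumes h: "skorokhod_lipschitz K h" "\<And>x. x \<in> skorokhod_space \<Longrightarrow> \<bar>h x\<bar> \<le> C" and r: "0 < r"
  obtains m0 where "0 < m0" "\<And>m. m0 \<le> m \<Longrightarrow> \<forall>\<^sub>F n in sequentially. \<forall>i0 (N :: 'b measure) X.
      boundary_random_walk (jm n) i0 N X \<longrightarrow>
      \<bar>(\<integral>\<omega>. h (restrict (\<lambda>t. rescale n X t \<omega>) {0..}) \<partial>N) - (\<integral>\<omega>. h (step_path m (\<lambda>i. rescale n X (real i / m) \<omega>)) \<partial>N)\<bar> \<le> r"
proof -
  have K: "0 \<le> K" using h(1) by (rule skorokhod_lipschitzD)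
  have C: "0 \<le> C" using order_trans[OF abs_ge_zero h(2)[OF step_path_in_skorokhod_space[of 1 "\<lambda>_. 0"]]] by simp
  \<comment> \<open>Off the bad event the distance is at most \<open>6 * q\<close>:
    \<open>2 * q\<close> each from the distortion and from the exit radius, and \<open>q\<close>
    each from the number of exits and from the tail. The estimate below rounds this up to
    \<open>8 * q\<close>, and \<open>(K + 1) * (8 * q)\<close> is \<open>r / 2\<close>.\<close>
  define q where "q = r / (16 * (K + 1))"
  have q: "0 < q" using K r by (simp add: q_def)
  define T where "T = max 0 (- ln q)"
  have T: "0 \<le> T" "exp (- T) \<le> q"
    using q by (auto simp: T_def max_def ln_ge_iff simp flip: ln_ge_iff)
  define \<eta> where "\<eta> = min (1/2) q"
  have eta: "0 < \<eta>" "\<eta> \<le> 1/2" "\<eta> \<le> q" using q by (auto simp: \<eta>_def)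
  define c where "c = 9 * gen_const / q\<^sup>2"
  have c: "0 < c" using gen_const_pos q by (simp add: c_def)
  define Q where "Q = c * (1 + T * c)"
  have Q: "0 < Q" using c T by (simp add: Q_def add_pos_nonneg)
  \<comment> \<open>The bad event has probability at most \<open>2 * \<delta> * Q\<close>, that is
    \<open>r / (4 * (C + 1))\<close>. On it the two values of \<open>h\<close> differ by at most
    \<open>2 * C\<close>, which contributes at most \<open>r / 2\<close>.\<close>
  define \<delta> where "\<delta> = r / (8 * (C + 1)) / Q"
  have \<delta>: "0 < \<delta>" using r C Q by (simp add: \<delta>_def)
  have \<delta>Q: "\<delta> * Q = r / (8 * (C + 1))" using Q by (simp add: \<delta>_def)
  define m0 where "m0 = max (1 / (\<eta> * \<delta>)) ((T / \<delta> + 1) / q)"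
  have m0: "0 < m0" using eta \<delta> by (simp add: m0_def less_max_iff_disj)
  have "\<forall>\<^sub>F n in sequentially. \<forall>i0 (N :: 'b measure) X.
      boundary_random_walk (jm n) i0 N X \<longrightarrow>
      \<bar>(\<integral>\<omega>. h (restrict (\<lambda>t. rescale n X t \<omega>) {0..}) \<partial>N) - (\<integral>\<omega>. h (step_path m (\<lambda>i. rescale n X (real i / m) \<omega>)) \<partial>N)\<bar> \<le> r"
    if mm: "m0 \<le> m" for m
  proof -
    have m: "0 < m" "1 / (\<eta> * \<delta>) \<le> m" "(T / \<delta> + 1) / q \<le> m" using mm m0 by (auto simp: m0_def)
    have m1: "1 / m \<le> \<eta> * \<delta>" using m eta \<delta> by (simp add: field_simps)
    have m2: "(T / \<delta> + 1) / m \<le> q" using m q by (simp add: pos_divide_le_eq mult.commute)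
    have "filterlim (\<lambda>n. (real n)\<^sup>2) at_top sequentially" by real_asymp
    then have "\<forall>\<^sub>F n in sequentially. 1 / \<delta> \<le> (real n)\<^sup>2"
      by (simp add: filterlim_at_top)
    then show ?thesis
      using eventually_admissible
    proof eventually_elim
      case (elim n)
      have n: "0 < n" using elim(2) by (auto simp: admissible_def)
      have n2: "0 < (real n)\<^sup>2" using n by simp
      define D where "D = nat \<lceil>\<delta> * (real n)\<^sup>2\<rceil>"
      have D: "\<delta> * (real n)\<^sup>2 \<le> real D" unfolding D_def by linarith
      \<comment> \<open>This makes rounding up to the integer \<open>D\<close> at most double
        \<open>\<delta> * n^2\<close>.\<close>
      have "1 \<le> \<delta> * (real n)\<^sup>2" using elim(1) \<delta> by (simp add: field_simps)
      then have D2: "real D \<le> 2 * \<delta> * (real n)\<^sup>2" unfolding D_def by linarith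
      define \<theta> where "\<theta> = 9 * gen_const / ((real n)\<^sup>2 * q\<^sup>2)"
      have \<theta>c: "(real n)\<^sup>2 * \<theta> = c" using n by (simp add: \<theta>_def c_def)
      have th: "0 \<le> \<theta>" using gen_const_pos by (simp add: \<theta>_def)
      define k where "k = nat \<lfloor>(real n)\<^sup>2 * T\<rfloor>"
      have k: "real k \<le> (real n)\<^sup>2 * T" using T by (simp add: k_def)
      show ?case
      proof (intro allI impI)
        fix i0 and N :: "'b measure" and X
        assume b: "boundary_random_walk (jm n) i0 N X"
        interpret brw "jm n" i0 N X by (rule brw.intro[OF b])
        define bad where "bad = {\<omega> \<in> space N. snd (snd (exit_state n D q (hist X k \<omega>)))}"
        have bad_sets: "bad \<in> sets N"
          using measurable_sets[OF hist_measurable, of "{xs. snd (snd (exit_state n D q xs))}" k]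
          by (simp add: bad_def vimage_def Int_def conj_commute)
        have "measure N bad \<le> real D * \<theta> * (1 + real k * \<theta>)"
          unfolding bad_def by (rule prob_short_exit[OF b elim(2) q \<theta>_def])
        also have "\<dots> \<le> (2 * \<delta> * (real n)\<^sup>2) * \<theta> * (1 + ((real n)\<^sup>2 * T) * \<theta>)"
          using D2 k th by (intro mult_mono add_mono) auto
        also have "\<dots> = 2 * \<delta> * ((real n)\<^sup>2 * \<theta>) * (1 + T * ((real n)\<^sup>2 * \<theta>))" by (simp add: mult_ac)
        also have "\<dots> = 2 * (\<delta> * Q)" unfolding \<theta>c Q_def by (simp add: mult_ac)
        also have "\<dots> = r / (4 * (C + 1))" unfolding \<delta>Q using C by (simp add: field_simps)
        finally have pb: "measure N bad \<le> r / (4 * (C + 1))" .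
        define h1 where "h1 = (\<lambda>\<omega>. h (restrict (\<lambda>t. rescale n X t \<omega>) {0..}))"
        define h2 where "h2 = (\<lambda>\<omega>. h (step_path m (\<lambda>i. rescale n X (real i / m) \<omega>)))"
        have S1: "restrict (\<lambda>t. rescale n X t \<omega>) {0..} \<in> skorokhod_space" for \<omega>
          by (rule path_in_skorokhod_space[OF rescale_cadlag[OF n]])
        have S2: "step_path m (\<lambda>i. rescale n X (real i / m) \<omega>) \<in> skorokhod_space" for \<omega>
          by (rule step_path_in_skorokhod_space[OF m(1)])
        have b12: "\<bar>h1 \<omega>\<bar> \<le> C" "\<bar>h2 \<omega>\<bar> \<le> C" for \<omega>
          unfolding h1_def h2_def by (intro h(2) S1 S2)+
        have i1: "integrable N h1"
          using lipschitz_path_measurable[of K h "rescale n X" N, OF h(1) rescale_measurable[OF b] rescale_cadlag[OF n]] b12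
          by (intro integrable_const_bound[of _ C]) (auto simp: h1_def)
        have i2: "integrable N h2"
          using step_path_measurable[of K h m "\<lambda>i. rescale n X (real i / m)" N, OF h(1) m(1) rescale_measurable[OF b]] b12
          by (intro integrable_const_bound[of _ C]) (auto simp: h2_def)
        have close: "\<bar>h1 \<omega> - h2 \<omega>\<bar> \<le> r / 2 + 2 * C * indicator bad \<omega>" if "\<omega> \<in> space N" for \<omega>
        proof (cases "\<omega> \<in> bad")
          case True
          then show ?thesis using b12[of \<omega>] r by (simp add: abs_if split: if_splits)
        next
          case False
          then have nb: "\<not> snd (snd (exit_state n D q (hist X (nat \<lfloor>(real n)\<^sup>2 * T\<rfloor>) \<omega>)))"
            using that by (simp add: bad_def k_def)
          have "\<bar>h1 \<omega> - h2 \<omega>\<bar> \<le> K * skorokhod_dist (restrict (\<lambda>t. rescale n X t \<omega>) {0..}) (step_path m (\<lambda>i. rescale n X (real i / m) \<omega>))"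
            unfolding h1_def h2_def by (rule skorokhod_lipschitzD(1)[OF h(1) S1 S2])
          also have "\<dots> \<le> K * (2 * \<eta> + 2 * q + (T / \<delta> + 1) / m + exp (- T))"
            using K by (intro mult_left_mono walk_path_close[OF n nb \<delta> D q T(1) m(1) m1 eta(1,2)])
          also have "\<dots> \<le> (K + 1) * (8 * q)"
            using K q eta T m2 m \<delta> by (intro mult_mono) (auto intro!: add_nonneg_nonneg)
          also have "\<dots> = r / 2" using K by (simp add: q_def field_simps)
          finally show ?thesis using False by simp
        qed
        have ib: "integrable N (\<lambda>\<omega>. indicator bad \<omega> :: real)"
          using bad_sets by (intro integrable_const_bound[of _ 1]) auto
        have "\<bar>(\<integral>\<omega>. h1 \<omega> \<partial>N) - (\<integral>\<omega>. h2 \<omega> \<partial>N)\<bar> = \<bar>\<integral>\<omega>. h1 \<omega> - h2 \<omega> \<partial>N\<bar>" using i1 i2 by simp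
        also have "\<dots> \<le> (\<integral>\<omega>. \<bar>h1 \<omega> - h2 \<omega>\<bar> \<partial>N)" by (rule integral_abs_bound)
        also have "\<dots> \<le> (\<integral>\<omega>. r / 2 + 2 * C * indicator bad \<omega> \<partial>N)"
          by (rule integral_mono) (use i1 i2 ib close in auto)
        also have "\<dots> = (\<integral>\<omega>. r / 2 \<partial>N) + (\<integral>\<omega>. 2 * C * indicator bad \<omega> \<partial>N)"
          using ib by (intro Bochner_Integration.integral_add) auto
        also have "\<dots> = r / 2 + 2 * C * measure N bad"
          using sets.sets_into_space[OF bad_sets] by (simp add: prob_space Int_absorb2)
        also have "\<dots> \<le> r / 2 + 2 * C * (r / (4 * (C + 1)))"
          using pb C by (intro add_left_mono mult_left_mono) auto
        also have "2 * C * (r / (4 * (C + 1))) \<le> r / 2"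
          using C r by (simp add: field_simps)
        finally show "\<bar>(\<integral>\<omega>. h (restrict (\<lambda>t. rescale n X t \<omega>) {0..}) \<partial>N) - (\<integral>\<omega>. h (step_path m (\<lambda>i. rescale n X (real i / m) \<omega>)) \<partial>N)\<bar> \<le> r"
          by (simp add: h1_def h2_def)
      qed
    qed
  qed
  then show ?thesis using that[OF m0] by blast
qed

end

context walk_limit
begin

text \<open>The approximation of \<open>h\<close> by sums of products is uniform over step paths, so
  the same sum serves the walk and the limit process. What remains are finitely many expected
  products, evaluated by the Markov property on either side and compared through
  \<open>walk_prod_tendsto\<close>.\<close>

lemma discretized_tendsto:
  fixes h :: "(real \<Rightarrow> ennreal) \<Rightarrow> real" and N :: "nat \<Rightarrow> 'b measure" and M :: "'a measure"
  assumes h: "skorokhod_lipschitz K h" and m: "0 < m" and x0: "0 \<le> x0"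
    and walk: "\<And>n. admissible n \<Longrightarrow> boundary_random_walk (jm n) (nat \<lfloor>real n * x0\<rfloor>) (N n) (X n)"
    and markov: "markov_process \<kappa> (ennreal x0) M B"
  shows "(\<lambda>n. \<integral>\<omega>. h (step_path m (\<lambda>i. rescale n (X n) (real i / m) \<omega>)) \<partial>N n)
     \<longlonglongrightarrow> (\<integral>\<omega>. h (step_path m (\<lambda>i. B (real i / m) \<omega>)) \<partial>M)"
proof (rule LIMSEQ_I)
  fix r :: real assume r: "0 < r"
  interpret M: prob_space M using markov by (simp add: markov_process_def)
  have r4: "0 < r / 4" using r by simp
  obtain Af :: "(nat \<Rightarrow> nat) set" and w I and \<phi> :: "nat \<Rightarrow> ennreal \<Rightarrow> real" where ap:
    "finite Af" "\<And>j. continuous_on UNIV (\<phi> j)"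
    "\<And>y. \<bar>h (step_path m y) - (\<Sum>a\<in>Af. w a * (\<Prod>i\<le>I. \<phi> (a i) (y i)))\<bar> \<le> r / 4"
    by (rule lipschitz_step_path_approx[OF h m r4]) (rule that)
  define \<Phi> where "\<Phi> j = Bcontfun (\<phi> j)" for j
  have \<Phi>: "\<Phi> j z = \<phi> j z" for j z
    unfolding \<Phi>_def by (subst Bcontfun_inverse) (auto intro: bcontfun_ennreal ap(2))
  define fs where "fs a = map (\<lambda>i. \<Phi> (a i)) [0..<Suc I]" for a :: "nat \<Rightarrow> nat"
  have path_prod_fs: "path_prod y 0 (fs a) = (\<Prod>i\<le>I. \<phi> (a i) (y i))" for y a
    unfolding fs_def path_prod_map_atMost by (simp add: \<Phi>)
  define S where "S y = (\<Sum>a\<in>Af. w a * path_prod y 0 (fs a))" for y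
  have ap': "\<bar>h (step_path m y) - S y\<bar> \<le> r / 4" for y
    using ap(3)[of y] by (simp add: S_def path_prod_fs)
  have close: "\<bar>(\<integral>\<omega>. h (step_path m (\<lambda>i. Y i \<omega>)) \<partial>P) - (\<Sum>a\<in>Af. w a * (\<integral>\<omega>. path_prod (\<lambda>i. Y i \<omega>) 0 (fs a) \<partial>P))\<bar> \<le> r / 4"
    if P: "prob_space P" and Y: "\<And>i. Y i \<in> borel_measurable P" for P :: "'c measure" and Y
  proof -
    interpret P: prob_space P by (rule P)
    have pm: "(\<lambda>\<omega>. path_prod (\<lambda>i. Y i \<omega>) 0 (fs a)) \<in> borel_measurable P" for a
      unfolding path_prod_fs \<Phi>[symmetric]
      by (intro borel_measurable_prod measurable_compose[OF Y apply_bcontfun_measurable])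
    have "\<bar>path_prod y 0 (fs a)\<bar> \<le> (\<Prod>i\<le>I. norm (\<Phi> (a i)))" for y a
      unfolding path_prod_fs \<Phi>[symmetric] abs_prod using norm_bounded[of "\<Phi> (a _)"] by (intro prod_mono) auto
    then have ip: "integrable P (\<lambda>\<omega>. path_prod (\<lambda>i. Y i \<omega>) 0 (fs a))" for a
      using pm by (intro P.integrable_const_bound[of _ "\<Prod>i\<le>I. norm (\<Phi> (a i))"]) auto
    then have iS: "integrable P (\<lambda>\<omega>. S (\<lambda>i. Y i \<omega>))"
      unfolding S_def by (intro Bochner_Integration.integrable_sum integrable_mult_right)
    have hm: "(\<lambda>\<omega>. h (step_path m (\<lambda>i. Y i \<omega>))) \<in> borel_measurable P"
      by (rule step_path_measurable[OF h m Y])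
    have id: "integrable P (\<lambda>\<omega>. h (step_path m (\<lambda>i. Y i \<omega>)) - S (\<lambda>i. Y i \<omega>))"
      using hm borel_measurable_integrable[OF iS] ap' by (intro P.integrable_const_bound[of _ "r / 4"]) auto
    have "(\<lambda>\<omega>. h (step_path m (\<lambda>i. Y i \<omega>))) = (\<lambda>\<omega>. (h (step_path m (\<lambda>i. Y i \<omega>)) - S (\<lambda>i. Y i \<omega>)) + S (\<lambda>i. Y i \<omega>))"
      by simp
    then have "(\<integral>\<omega>. h (step_path m (\<lambda>i. Y i \<omega>)) \<partial>P) = (\<integral>\<omega>. h (step_path m (\<lambda>i. Y i \<omega>)) - S (\<lambda>i. Y i \<omega>) \<partial>P) + (\<integral>\<omega>. S (\<lambda>i. Y i \<omega>) \<partial>P)"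
      using Bochner_Integration.integral_add[OF id iS] by simp
    moreover have "(\<integral>\<omega>. S (\<lambda>i. Y i \<omega>) \<partial>P) = (\<Sum>a\<in>Af. w a * (\<integral>\<omega>. path_prod (\<lambda>i. Y i \<omega>) 0 (fs a) \<partial>P))"
      unfolding S_def using ip by (subst Bochner_Integration.integral_sum) auto
    moreover have "\<bar>\<integral>\<omega>. h (step_path m (\<lambda>i. Y i \<omega>)) - S (\<lambda>i. Y i \<omega>) \<partial>P\<bar> \<le> r / 4"
    proof -
      have "\<bar>\<integral>\<omega>. h (step_path m (\<lambda>i. Y i \<omega>)) - S (\<lambda>i. Y i \<omega>) \<partial>P\<bar> \<le> (\<integral>\<omega>. \<bar>h (step_path m (\<lambda>i. Y i \<omega>)) - S (\<lambda>i. Y i \<omega>)\<bar> \<partial>P)"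
        by (rule integral_abs_bound)
      also have "\<dots> \<le> (\<integral>\<omega>. r / 4 \<partial>P)" using id ap' by (intro integral_mono integrable_abs) auto
      finally show ?thesis by (simp add: P.prob_space)
    qed
    ultimately show ?thesis by linarith
  qed
  define Kt where "Kt n i = nat \<lfloor>(real n)\<^sup>2 * (real i / m)\<rfloor>" for n i
  have Kt_mono: "Kt n i \<le> Kt n (Suc i)" for n i
    unfolding Kt_def using m by (intro nat_mono floor_mono mult_left_mono divide_right_mono) auto
  have Kt_lim: "(\<lambda>n. real (Kt n i) / (real n)\<^sup>2) \<longlonglongrightarrow> real i / m" for i
  proof -
    have "(\<lambda>n. real (Kt n i) / (real n)\<^sup>2 - real i / m) \<longlonglongrightarrow> 0"
    proof (rule Lim_null_comparison)
      show "(\<lambda>n. 1 / (real n)\<^sup>2) \<longlonglongrightarrow> 0" by real_asymp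
      show "\<forall>\<^sub>F n in sequentially. norm (real (Kt n i) / (real n)\<^sup>2 - real i / m) \<le> 1 / (real n)\<^sup>2"
        using eventually_gt_at_top[of 0]
      proof eventually_elim
        case (elim n)
        define u where "u = (real n)\<^sup>2 * (real i / m)"
        have "0 \<le> u" using m by (simp add: u_def)
        then have u: "\<bar>real (Kt n i) - u\<bar> \<le> 1" unfolding Kt_def u_def[symmetric] by linarith
        have "real (Kt n i) / (real n)\<^sup>2 - real i / m = (real (Kt n i) - u) / (real n)\<^sup>2"
          using elim by (simp add: u_def diff_divide_distrib)
        then show ?case using u by (simp add: divide_right_mono)
      qed
    qed
    then show ?thesis by (simp add: LIM_zero_iff)
  qed
  have Kt_diff: "(\<lambda>n. real (Kt n (Suc i) - Kt n i) / (real n)\<^sup>2) \<longlonglongrightarrow> 1 / m" for i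
  proof -
    have "(\<lambda>n. real (Kt n (Suc i)) / (real n)\<^sup>2 - real (Kt n i) / (real n)\<^sup>2) \<longlonglongrightarrow> real (Suc i) / m - real i / m"
      by (intro tendsto_diff Kt_lim)
    moreover have "real (Suc i) / m - real i / m = 1 / m" by (simp add: add_divide_distrib)
    ultimately show ?thesis using Kt_mono by (simp add: of_nat_diff diff_divide_distrib)
  qed
  have start: "(\<lambda>n. scaled n (enat (nat \<lfloor>real n * x0\<rfloor>))) \<longlonglongrightarrow> ennreal x0"
  proof -
    have "(\<lambda>n. real (nat \<lfloor>real n * x0\<rfloor>) / real n - x0) \<longlonglongrightarrow> 0"
    proof (rule Lim_null_comparison[OF _ lim_1_over_n])
      show "\<forall>\<^sub>F n in sequentially. norm (real (nat \<lfloor>real n * x0\<rfloor>) / real n - x0) \<le> 1 / real n"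
        using eventually_gt_at_top[of 0]
      proof eventually_elim
        case (elim n)
        have "0 \<le> real n * x0" using x0 by simp
        then have "\<bar>real (nat \<lfloor>real n * x0\<rfloor>) - real n * x0\<bar> \<le> 1" by linarith
        moreover have "real (nat \<lfloor>real n * x0\<rfloor>) / real n - x0 = (real (nat \<lfloor>real n * x0\<rfloor>) - real n * x0) / real n"
          using elim by (simp add: diff_divide_distrib)
        ultimately show ?case by (simp add: divide_right_mono)
      qed
    qed
    then have "(\<lambda>n. ennreal (real (nat \<lfloor>real n * x0\<rfloor>) / real n)) \<longlonglongrightarrow> ennreal x0"
      by (intro tendsto_ennrealI) (simp add: LIM_zero_iff)
    then show ?thesis
    proof (rule Lim_transform_eventually)
      show "\<forall>\<^sub>F n in sequentially. ennreal (real (nat \<lfloor>real n * x0\<rfloor>) / real n) = scaled n (enat (nat \<lfloor>real n * x0\<rfloor>))"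
        using eventually_gt_at_top[of 0] by eventually_elim (simp add: scaled_enat)
    qed
  qed
  have wlim: "(\<lambda>n. walk_prod n (Kt n) 0 \<psi>s (enat (nat \<lfloor>real n * x0\<rfloor>))) \<longlonglongrightarrow> feller_prod (1 / m) \<psi>s (ennreal x0)" for \<psi>s
  proof -
    have "(\<lambda>n. feller_prod (1 / m) \<psi>s (scaled n (enat (nat \<lfloor>real n * x0\<rfloor>)))) \<longlonglongrightarrow> feller_prod (1 / m) \<psi>s (ennreal x0)"
      by (rule continuous_on_tendsto_compose[OF continuous_on_apply_bcontfun[of UNIV] start]) auto
    moreover have "(\<lambda>n. walk_prod n (Kt n) 0 \<psi>s (enat (nat \<lfloor>real n * x0\<rfloor>)) - feller_prod (1 / m) \<psi>s (scaled n (enat (nat \<lfloor>real n * x0\<rfloor>)))) \<longlonglongrightarrow> 0"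
    proof (rule LIMSEQ_I)
      fix e :: real assume "0 < e"
      then have "0 < e / 2" "0 \<le> 1 / m" using m by auto
      then have "\<forall>\<^sub>F n in sequentially. \<forall>x. \<bar>walk_prod n (Kt n) 0 \<psi>s x - feller_prod (1 / m) \<psi>s (scaled n x)\<bar> \<le> e / 2"
        by (intro walk_prod_tendsto Kt_diff)
      then obtain n0 where n0: "\<And>n x. n0 \<le> n \<Longrightarrow> \<bar>walk_prod n (Kt n) 0 \<psi>s x - feller_prod (1 / m) \<psi>s (scaled n x)\<bar> \<le> e / 2"
        by (auto simp: eventually_sequentially)
      show "\<exists>no. \<forall>n\<ge>no. norm (walk_prod n (Kt n) 0 \<psi>s (enat (nat \<lfloor>real n * x0\<rfloor>)) - feller_prod (1 / m) \<psi>s (scaled n (enat (nat \<lfloor>real n * x0\<rfloor>))) - 0) < e"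
      proof (intro exI[of _ n0] allI impI)
        fix n assume "n0 \<le> n"
        from n0[OF this, of "enat (nat \<lfloor>real n * x0\<rfloor>)"] \<open>0 < e\<close>
        show "norm (walk_prod n (Kt n) 0 \<psi>s (enat (nat \<lfloor>real n * x0\<rfloor>)) - feller_prod (1 / m) \<psi>s (scaled n (enat (nat \<lfloor>real n * x0\<rfloor>))) - 0) < e"
          unfolding real_norm_def by linarith
      qed
    qed
    ultimately show ?thesis by (rule Lim_transform)
  qed
  have "(\<lambda>n. \<Sum>a\<in>Af. w a * walk_prod n (Kt n) 0 (fs a) (enat (nat \<lfloor>real n * x0\<rfloor>))) \<longlonglongrightarrow> (\<Sum>a\<in>Af. w a * feller_prod (1 / m) (fs a) (ennreal x0))"
    by (intro tendsto_sum tendsto_mult_left wlim)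
  then have "\<forall>\<^sub>F n in sequentially. dist (\<Sum>a\<in>Af. w a * walk_prod n (Kt n) 0 (fs a) (enat (nat \<lfloor>real n * x0\<rfloor>))) (\<Sum>a\<in>Af. w a * feller_prod (1 / m) (fs a) (ennreal x0)) < r / 4"
    using r4 by (rule tendstoD)
  then have "\<forall>\<^sub>F n in sequentially. norm ((\<integral>\<omega>. h (step_path m (\<lambda>i. rescale n (X n) (real i / m) \<omega>)) \<partial>N n) - (\<integral>\<omega>. h (step_path m (\<lambda>i. B (real i / m) \<omega>)) \<partial>M)) < r"
    using eventually_admissible
  proof eventually_elim
    case (elim n)
    note b = walk[OF elim(2)]
    have Pn: "prob_space (N n)" using b by (simp add: boundary_random_walk_def)
    have 1: "\<bar>(\<integral>\<omega>. h (step_path m (\<lambda>i. rescale n (X n) (real i / m) \<omega>)) \<partial>N n)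
       - (\<Sum>a\<in>Af. w a * (\<integral>\<omega>. path_prod (\<lambda>i. rescale n (X n) (real i / m) \<omega>) 0 (fs a) \<partial>N n))\<bar> \<le> r / 4"
      by (rule close[OF Pn rescale_measurable[OF b]])
    have 2: "\<bar>(\<integral>\<omega>. h (step_path m (\<lambda>i. B (real i / m) \<omega>)) \<partial>M)
       - (\<Sum>a\<in>Af. w a * (\<integral>\<omega>. path_prod (\<lambda>i. B (real i / m) \<omega>) 0 (fs a) \<partial>M))\<bar> \<le> r / 4"
      using m by (intro close M.prob_space_axioms B_measurable[OF markov]) auto
    have 3: "(\<integral>\<omega>. path_prod (\<lambda>i. rescale n (X n) (real i / m) \<omega>) 0 (fs a) \<partial>N n) = walk_prod n (Kt n) 0 (fs a) (enat (nat \<lfloor>real n * x0\<rfloor>))" for a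
      using integral_path_prod[where K = "Kt n" and \<phi>s = "fs a", OF b Kt_mono] by (simp add: rescale_eq Kt_def)
    have 4: "(\<integral>\<omega>. path_prod (\<lambda>i. B (real i / m) \<omega>) 0 (fs a) \<partial>M) = feller_prod (1 / m) (fs a) (ennreal x0)" for a
      using integral_path_prod_feller[OF markov, of "1 / m" "fs a"] m by simp
    show ?case
      using 1 2 elim(1) unfolding 3 4 dist_real_def real_norm_def by linarith
  qed
  then show "\<exists>no. \<forall>n\<ge>no. norm ((\<integral>\<omega>. h (step_path m (\<lambda>i. rescale n (X n) (real i / m) \<omega>)) \<partial>N n) - (\<integral>\<omega>. h (step_path m (\<lambda>i. B (real i / m) \<omega>)) \<partial>M)) < r"
    by (simp add: eventually_sequentially)
qed

end

theorem theorem4p2: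
  fixes p1 p2 p3 x0 :: real and p4 :: "real measure"
    and M :: "'a measure" and B :: "real \<Rightarrow> 'a \<Rightarrow> ennreal"
    and N :: "nat \<Rightarrow> 'b measure" and X :: "nat \<Rightarrow> nat \<Rightarrow> 'b \<Rightarrow> enat"
  assumes "0 \<le> p1" and "0 \<le> p2" and "0 < p3"
    and "sets p4 = sets (restrict_space borel {0<..})"
    and "(\<integral>\<^sup>+ x. ennreal (min x 1) \<partial>p4) < \<infinity>"
    and "0 \<le> x0"
    and "feller_brownian_motion p1 p2 p3 p4 x0 M B"
    and "\<And>n. 2 \<le> n \<Longrightarrow> 0 \<le> jump_weight p1 p2 p3 p4 n 0 \<Longrightarrow>
           boundary_random_walk (jumping_measure p1 p2 p3 p4 n) (nat \<lfloor>real n * x0\<rfloor>) (N n) (X n)"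
  shows "weakly_converges_to skorokhod_topology
           (\<lambda>n. path_law (N n) (rescale n (X n))) (path_law M B)"
proof -
  obtain \<kappa> where \<kappa>: "feller_transition \<kappa>"
    "\<And>f g. semigroup_generator \<kappa> f g \<longleftrightarrow> feller_bm_generator p1 p2 p3 p4 f g"
    "markov_process \<kappa> (ennreal x0) M B"
    using assms(7) unfolding feller_brownian_motion_def by blast
  have cad: "cadlag (\<lambda>t. B t \<omega>)" if "\<omega> \<in> space M" for \<omega>
    using assms(7) that unfolding feller_brownian_motion_def by blast
  interpret walk_limit \<kappa> p1 p2 p3 p4
    by (intro walk_limit.intro feller.intro boundary_params.intro walk_limit_axioms.intro \<kappa> assms(1-5))
  interpret M: prob_space M using \<kappa>(3) by (simp add: markov_process_def)
  note Bm = B_measurable[OF \<kappa>(3)]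
  have walk: "boundary_random_walk (jm n) (nat \<lfloor>real n * x0\<rfloor>) (N n) (X n)" if "admissible n" for n
    using that by (intro assms(8)) (auto simp: admissible_def)
  have n0: "0 < n" if "admissible n" for n using that by (simp add: admissible_def)
  have probN: "prob_space (N n)" if "admissible n" for n
    using walk[OF that] by (simp add: boundary_random_walk_def)
  show ?thesis
  proof (rule weakly_converges_to_lipschitzI)
    show "\<forall>\<^sub>F n in sequentially. path_law (N n) (rescale n (X n)) \<in> space (prob_algebra (borel_of skorokhod_topology))"
      using eventually_admissible
      by eventually_elim (intro path_law_in_prob_algebra probN rescale_measurable[OF walk] rescale_cadlag n0)
    show "path_law M B \<in> space (prob_algebra (borel_of skorokhod_topology))"
      by (intro path_law_in_prob_algebra M.prob_space_axioms Bm cad)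
  next
    fix h :: "(real \<Rightarrow> ennreal) \<Rightarrow> real" and K C
    assume h: "skorokhod_lipschitz K h" and C: "\<And>x. x \<in> skorokhod_space \<Longrightarrow> \<bar>h x\<bar> \<le> C"
    define c where "c k = (\<integral>\<omega>. h (step_path (real (Suc k)) (\<lambda>i. B (real i / real (Suc k)) \<omega>)) \<partial>M)" for k
    define L where "L = (\<integral>\<omega>. h (restrict (\<lambda>t. B t \<omega>) {0..}) \<partial>M)"
    have cL: "c \<longlonglongrightarrow> L"
      unfolding c_def L_def
    proof (rule integral_dominated_convergence[where w = "\<lambda>_. C"])
      show "(\<lambda>\<omega>. h (restrict (\<lambda>t. B t \<omega>) {0..})) \<in> borel_measurable M"
        by (rule lipschitz_path_measurable[OF h Bm cad])
      show "(\<lambda>\<omega>. h (step_path (real (Suc k)) (\<lambda>i. B (real i / real (Suc k)) \<omega>))) \<in> borel_measurable M" for k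
        by (rule step_path_measurable[OF h]) (auto intro: Bm)
      show "AE \<omega> in M. (\<lambda>k. h (step_path (real (Suc k)) (\<lambda>i. B (real i / real (Suc k)) \<omega>))) \<longlonglongrightarrow> h (restrict (\<lambda>t. B t \<omega>) {0..})"
        by (rule AE_I2) (rule lipschitz_sampled_tendsto[OF h cad])
      show "AE \<omega> in M. norm (h (step_path (real (Suc k)) (\<lambda>i. B (real i / real (Suc k)) \<omega>))) \<le> C" for k
        unfolding real_norm_def by (intro AE_I2 C step_path_in_skorokhod_space) simp
    qed simp
    have "(\<lambda>n. \<integral>x. h x \<partial>path_law (N n) (rescale n (X n))) \<longlonglongrightarrow> L"
    proof (rule tendstoI)
      fix r :: real assume r: "0 < r"
      then have r3: "0 < r / 3" by simp
      obtain m0 where m0: "0 < m0" "\<And>m. m0 \<le> m \<Longrightarrow> \<forall>\<^sub>F n in sequentially. \<forall>i0 (N :: 'b measure) X.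
          boundary_random_walk (jm n) i0 N X \<longrightarrow>
          \<bar>(\<integral>\<omega>. h (restrict (\<lambda>t. rescale n X t \<omega>) {0..}) \<partial>N) - (\<integral>\<omega>. h (step_path m (\<lambda>i. rescale n X (real i / m) \<omega>)) \<partial>N)\<bar> \<le> r / 3"
        by (rule walk_discretization[OF h C r3], assumption) (rule that)
      have "\<forall>\<^sub>F k in sequentially. dist (c k) L < r / 3" using cL r3 by (rule tendstoD)
      moreover have "\<forall>\<^sub>F k in sequentially. nat \<lceil>m0\<rceil> \<le> k" by (rule eventually_ge_at_top)
      ultimately have "\<forall>\<^sub>F k in sequentially. dist (c k) L < r / 3 \<and> nat \<lceil>m0\<rceil> \<le> k" by (rule eventually_conj)
      \<comment> \<open>The mesh \<open>1 / Suc k\<close> is fixed here, before \<open>n\<close>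
        tends to infinity: fine enough for the limit process by dominated convergence, and for the
        walk by \<open>m0\<close>, which does not depend on \<open>n\<close>.\<close>
      then obtain k where k: "dist (c k) L < r / 3" "nat \<lceil>m0\<rceil> \<le> k"
        by (auto simp: eventually_sequentially)
      define m where "m = real (Suc k)"
      have "0 < m" by (simp add: m_def)
      have "m0 \<le> m" using k(2) unfolding m_def by linarith
      have ck: "c k = (\<integral>\<omega>. h (step_path m (\<lambda>i. B (real i / m) \<omega>)) \<partial>M)" by (simp add: c_def m_def)
      have "\<forall>\<^sub>F n in sequentially. dist (\<integral>\<omega>. h (step_path m (\<lambda>i. rescale n (X n) (real i / m) \<omega>)) \<partial>N n) (c k) < r / 3"
        unfolding ck by (rule tendstoD[OF discretized_tendsto[OF h \<open>0 < m\<close> assms(6) walk \<kappa>(3)] r3])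
      then show "\<forall>\<^sub>F n in sequentially. dist (\<integral>x. h x \<partial>path_law (N n) (rescale n (X n))) L < r"
        using m0(2)[OF \<open>m0 \<le> m\<close>] eventually_admissible
      proof eventually_elim
        case (elim n)
        have "(\<integral>x. h x \<partial>path_law (N n) (rescale n (X n))) = (\<integral>\<omega>. h (restrict (\<lambda>t. rescale n (X n) t \<omega>) {0..}) \<partial>N n)"
          by (rule integral_path_law[OF rescale_measurable[OF walk[OF elim(3)]] rescale_cadlag[OF n0[OF elim(3)]] h])
        moreover have "\<bar>(\<integral>\<omega>. h (restrict (\<lambda>t. rescale n (X n) t \<omega>) {0..}) \<partial>N n) - (\<integral>\<omega>. h (step_path m (\<lambda>i. rescale n (X n) (real i / m) \<omega>)) \<partial>N n)\<bar> \<le> r / 3"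
          using elim(2) walk[OF elim(3)] by simp
        ultimately show ?case using elim(1) k(1) unfolding dist_real_def by linarith
      qed
    qed
    moreover have "(\<integral>x. h x \<partial>path_law M B) = L"
      unfolding L_def by (rule integral_path_law[of B M, OF Bm cad h])
    ultimately show "(\<lambda>n. \<integral>x. h x \<partial>path_law (N n) (rescale n (X n))) \<longlonglongrightarrow> (\<integral>x. h x \<partial>path_law M B)"
      by simp
  qed
qed

end
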